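(* Let $\widehat K_1,\widehat K_2$ and $H$ be the operators defined in the context, where $c$ is an arbitrary non-vanishing scalar function on $\Omega$. If the Fredholm determinant $\det(1-\widehat K_1\widehat K_2)$ is well defined as a series expansion and $H$ is a trace class operator, then $$\det(1-\widehat K_1\widehat K_2)=\det(1-H).$$ Furthermore, $f_i(z)\,g_i(z)=0$ for every $z\in\Omega$ and $i\in\{1,\dots,m+1\}$.
   Context: Fix $m\ge1$ and pairwise disjoint sets $\Omega_{1,1},\dots,\Omega_{1,m},\Omega_{2,1},\dots,\Omega_{2,m}\subset\mathbb C$, either all finite unions of contours (then $d\mu=dz$) or all discrete (then $\mu$ is counting measure). Put $\Omega_\ell=\bigcup_{j=1}^m\Omega_{\ell,j}$ ($\ell=1,2$), $\Omega=\Omega_1\cup\Omega_2$. Let $A_1,\dots,A_m$, $B_1,\dots,B_m$ be scalar functions on $\Omega$ and $m_1,\dots,m_m$ non-vanishing scalar functions on $\Omega$. Let $M_1=m_1$, $M_2=m_1/m_2$, $M_3=m_3/m_2$, $M_4=m_3/m_4,\dots$ (the first $m$ terms). With $\delta_i(j)$ the Kronecker delta, the operators $\widehat K_1:L^2(\Omega_2,\mu)\to L^2(\Omega_1,\mu)$ and $\widehat K_2:L^2(\Omega_1,\mu)\to L^2(\Omega_2,\mu)$ have kernels $$\widehat K_1(u,v)=(\delta_i(j)+\delta_i(j+(-1)^i))\frac{M_i(u)A_i(u)B_j(v)}{u-v},\quad u\in\Omega_{1,i},\ v\in\Omega_{2,j},$$ $$\widehat K_2(u,v)=(\delta_i(j)+\delta_i(j-(-1)^i))\frac{M_i(u)^{-1}A_i(u)B_j(v)}{u-v},\quad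 u\in\Omega_{2,i},\ v\in\Omega_{1,j}.$$ Let $\mathsf X_\ell(z)=\mathrm{diag}(\chi_{\Omega_{\ell,j}}(z))_{j=1}^m$, $\mathbf A=\mathrm{diag}(A_j)_{j=1}^m$, $\mathbf B=\mathrm{diag}(B_j)_{j=1}^m$, $e=(1,\dots,1)^T\in\mathbb R^m$, $E_{11}=\mathrm{diag}(1,0,\dots,0)$ ($m\times m$), $P=(I_{m+1}\ \ 0)$ of size $(m+1)\times 2m$, $\mathsf U=\begin{pmatrix}1&1\\0&0\end{pmatrix}$, and let $\Lambda_1,\Lambda_2$ be the $m\times m$ block-diagonal matrices $\Lambda_1=\mathrm{diag}(\mathsf U,\dots,\mathsf U)$, $\Lambda_2=\mathrm{diag}(1,\mathsf U,\dots,\mathsf U,1)$ if $m$ is even, and $\Lambda_1=\mathrm{diag}(\mathsf U,\dots,\mathsf U,1)$, $\Lambda_2=\mathrm{diag}(1,\mathsf U,\dots,\mathsf U)$ if $m$ is odd. Set $$U=P\begin{pmatrix}\Lambda_1&\Lambda_2-E_{11}\\0&E_{11}\end{pmatrix}\begin{pmatrix}\mathbf A\mathsf X_1e\\ \mathbf A\mathsf X_2e\end{pmatrix},\qquad V=P\begin{pmatrix}\Lambda_1&\Lambda_2-E_{11}\\0&E_{11}\end{pmatrix}\begin{pmatrix}\mathbf B\mathsf X_2e\\ \mathbf B\mathsf X_1e\end{pmatrix},$$ $\Delta(z)=\mathrm{diag}(m_1(z),\dots,m_m(z),1)$, and $f=(f_1,\dots,f_{m+1})^T=c\,\Delta U$,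 $g=(g_1,\dots,g_{m+1})^T=c^{-1}\Delta^{-1}V$. The operator $H$ on $L^2(\Omega,\mu)$ has kernel $H(u,v)=\frac{f(u)^Tg(v)}{u-v}$ for $u\ne v$ and $H(u,u)=0$. *)

theory Defs
  imports "HOL-Analysis.Analysis" "Jordan_Normal_Form.Determinant"
begin

section \<open>The measure space\<close>

text \<open>
  A contour is a piecewise continuously differentiable curve, given by a parametrisation and its
  parameter interval.  The interval may be unbounded, so that contours going to infinity are
  included.
\<close>

type_synonym contour = "(real \<Rightarrow> complex) \<times> real set"

definition is_contour :: "contour \<Rightarrow> bool" where
  "is_contour = (\<lambda>(\<gamma>, I). is_interval I \<and> interior I \<noteq> {} \<and> \<gamma> piecewise_C1_differentiable_on I)"

definition contour_trace :: "contour set \<Rightarrow> complex set" where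
  "contour_trace C = (\<Union>(\<gamma>, I)\<in>C. \<gamma> ` I)"

text \<open>
  The contours of a union may cross themselves and each other (or be closed), but only at countably
  many parameter values: otherwise \<open>dz\<close> would not be determined by the point set.
\<close>

definition contour_union :: "contour set \<Rightarrow> bool" where
  "contour_union C \<longleftrightarrow> finite C \<and> (\<forall>x\<in>C. is_contour x) \<and>
     (\<forall>x\<in>C. countable {t \<in> snd x. \<exists>y\<in>C. \<exists>s\<in>snd y. (y, s) \<noteq> (x, t) \<and> fst y s = fst x t})"

text \<open>
  The complex measure \<open>dz\<close> is represented in polar form, \<open>dz = \<tau>(z) |dz|\<close>, by the arc length
  measure \<open>|dz|\<close> and the unit tangent \<open>\<tau>\<close>.  The choice in the definition of \<open>\<tau>\<close> matters only at the
  countably many crossing points.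
\<close>

definition arclength_measure :: "contour set \<Rightarrow> complex measure" where
  "arclength_measure C =
     measure_of (contour_trace C) (sets (restrict_space borel (contour_trace C)))
       (\<lambda>S. \<Sum>(\<gamma>, I)\<in>C. \<integral>\<^sup>+t\<in>I. indicator S (\<gamma> t) * ennreal (norm (vector_derivative \<gamma> (at t))) \<partial>lborel)"

definition unit_tangent :: "contour set \<Rightarrow> complex \<Rightarrow> complex" where
  "unit_tangent C z =
     (let (x, t) = (SOME (x, t). x \<in> C \<and> t \<in> snd x \<and> fst x t = z)
      in sgn (vector_derivative (fst x) (at t)))"

definition Omega :: "nat \<Rightarrow> (nat \<Rightarrow> nat \<Rightarrow> complex set) \<Rightarrow> nat \<Rightarrow> complex set" where
  "Omega m \<Omega> l = (\<Union>j\<in>{1..m}. \<Omega> l j)"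

definition Omega_total :: "nat \<Rightarrow> (nat \<Rightarrow> nat \<Rightarrow> complex set) \<Rightarrow> complex set" where
  "Omega_total m \<Omega> = Omega m \<Omega> 1 \<union> Omega m \<Omega> 2"

text \<open>
  \<open>\<mu>\<close> is \<open>\<tau> \<cdot> M\<close>, where \<open>M = |\<mu>|\<close>: either all sets are finite unions of contours and \<open>d\<mu> = dz\<close>,
  or all sets are discrete and \<open>\<mu>\<close> is counting measure.
\<close>

definition contour_setting ::
    "nat \<Rightarrow> (nat \<Rightarrow> nat \<Rightarrow> complex set) \<Rightarrow> complex measure \<Rightarrow> (complex \<Rightarrow> complex) \<Rightarrow> bool" where
  "contour_setting m \<Omega> M \<tau> \<longleftrightarrow>
     (\<exists>C. (\<forall>l\<in>{1, 2}. \<forall>j\<in>{1..m}. contour_union (C l j) \<and> \<Omega> l j = contour_trace (C l j)) \<and>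
          M = arclength_measure (\<Union>l\<in>{1, 2}. \<Union>j\<in>{1..m}. C l j) \<and>
          \<tau> = unit_tangent (\<Union>l\<in>{1, 2}. \<Union>j\<in>{1..m}. C l j))"

definition discrete_setting ::
    "nat \<Rightarrow> (nat \<Rightarrow> nat \<Rightarrow> complex set) \<Rightarrow> complex measure \<Rightarrow> (complex \<Rightarrow> complex) \<Rightarrow> bool" where
  "discrete_setting m \<Omega> M \<tau> \<longleftrightarrow>
     (\<forall>l\<in>{1, 2}. \<forall>j\<in>{1..m}. discrete (\<Omega> l j)) \<and>
     M = count_space (Omega_total m \<Omega>) \<and> \<tau> = (\<lambda>_. 1)"


section \<open>Integral operators, trace class operators and determinants\<close>

text \<open>
  Elements of \<open>L\<^sup>2\<close> are represented by functions, and equality in \<open>L\<^sup>2\<close> is equality almost everywhere.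
\<close>

definition L2 :: "complex measure \<Rightarrow> (complex \<Rightarrow> complex) set" where
  "L2 M = {f \<in> borel_measurable M. integrable M (\<lambda>z. (norm (f z))\<^sup>2)}"

definition L2_inner :: "complex measure \<Rightarrow> (complex \<Rightarrow> complex) \<Rightarrow> (complex \<Rightarrow> complex) \<Rightarrow> complex" where
  "L2_inner M f g = (\<integral>z. cnj (f z) * g z \<partial>M)"

definition L2_norm :: "complex measure \<Rightarrow> (complex \<Rightarrow> complex) \<Rightarrow> real" where
  "L2_norm M f = sqrt (\<integral>z. (norm (f z))\<^sup>2 \<partial>M)"

definition L2_onb :: "complex measure \<Rightarrow> (complex \<Rightarrow> complex) set \<Rightarrow> bool" where
  "L2_onb M E \<longleftrightarrow> E \<subseteq> L2 M \<and>
     (\<forall>e\<in>E. \<forall>e'\<in>E. L2_inner M e e' = of_bool (e = e')) \<and>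
     (\<forall>f\<in>L2 M. (\<forall>e\<in>E. L2_inner M e f = 0) \<longrightarrow> (AE z in M. f z = 0))"

definition kernel_op ::
    "complex measure \<Rightarrow> (complex \<Rightarrow> complex) \<Rightarrow> (complex \<Rightarrow> complex \<Rightarrow> complex) \<Rightarrow>
     (complex \<Rightarrow> complex) \<Rightarrow> complex \<Rightarrow> complex" where
  "kernel_op N \<tau> K f u = (\<integral>v. K u v * f v * \<tau> v \<partial>N)"

text \<open>\<open>K\<close> is the kernel of an operator from \<open>L\<^sup>2(N)\<close> to \<open>L\<^sup>2(M)\<close>.\<close>

definition L2_kernel ::
    "complex measure \<Rightarrow> complex measure \<Rightarrow> (complex \<Rightarrow> complex) \<Rightarrow> (complex \<Rightarrow> complex \<Rightarrow> complex) \<Rightarrow> bool" where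
  "L2_kernel N M \<tau> K \<longleftrightarrow> case_prod K \<in> borel_measurable (M \<Otimes>\<^sub>M N) \<and>
     (\<forall>f\<in>L2 N. (AE u in M. integrable N (\<lambda>v. K u v * f v * \<tau> v)) \<and> kernel_op N \<tau> K f \<in> L2 M)"

text \<open>
  Trace class in terms of the Schmidt expansion
  \<open>T = \<Sum>\<^sub>k s\<^sub>k \<langle>\<phi>\<^sub>k, \<cdot>\<rangle> \<psi>\<^sub>k\<close>: the (positive) singular values \<open>s\<^sub>k\<close> are summable.  The index set is a
  subset of the naturals because there may be only finitely many of them.
\<close>

definition trace_class :: "complex measure \<Rightarrow> ((complex \<Rightarrow> complex) \<Rightarrow> complex \<Rightarrow> complex) \<Rightarrow> bool" where
  "trace_class M T \<longleftrightarrow>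
     (\<exists>(I :: nat set) (s :: nat \<Rightarrow> real) \<phi> \<psi>.
        (\<forall>k\<in>I. s k > 0 \<and> \<phi> k \<in> L2 M \<and> \<psi> k \<in> L2 M) \<and>
        (\<forall>j\<in>I. \<forall>k\<in>I. L2_inner M (\<phi> j) (\<phi> k) = of_bool (j = k) \<and>
                       L2_inner M (\<psi> j) (\<psi> k) = of_bool (j = k)) \<and>
        s summable_on I \<and>
        (\<forall>f\<in>L2 M. T f \<in> L2 M \<and>
           (\<lambda>N. L2_norm M (\<lambda>z. T f z -
                  (\<Sum>k\<in>I \<inter> {..<N}. of_real (s k) * L2_inner M (\<phi> k) f * \<psi> k z))) \<longlonglongrightarrow> 0))"

text \<open>
  The trace of the exterior power \<open>\<Lambda>\<^sup>n T\<close> in the orthonormal basis of the vectors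
  \<open>e\<^sub>1 \<and> \<dots> \<and> e\<^sub>n\<close>; the division by \<open>n!\<close> compensates for summing over ordered tuples.
  The determinant of a trace class operator is \<open>det(1 - T) = \<Sum>\<^sub>n (-1)\<^sup>n tr(\<Lambda>\<^sup>n T)\<close>, which does not
  depend on the basis.
\<close>

definition ext_power_trace ::
    "complex measure \<Rightarrow> (complex \<Rightarrow> complex) set \<Rightarrow> ((complex \<Rightarrow> complex) \<Rightarrow> complex \<Rightarrow> complex) \<Rightarrow>
     nat \<Rightarrow> complex" where
  "ext_power_trace M E T n =
     (\<Sum>\<^sub>\<infinity>e\<in>PiE {..<n} (\<lambda>_. E).
        Determinant.det (Matrix.mat n n (\<lambda>(i, j). L2_inner M (e i) (T (e j))))) / fact n"

definition det_one_minus ::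
    "complex measure \<Rightarrow> ((complex \<Rightarrow> complex) \<Rightarrow> complex \<Rightarrow> complex) \<Rightarrow> complex" where
  "det_one_minus M T =
     (THE d. \<forall>E. L2_onb M E \<longrightarrow> (\<lambda>n. (- 1) ^ n * ext_power_trace M E T n) sums d)"

text \<open>
  The Fredholm series \<open>\<Sum>\<^sub>n (-1)\<^sup>n / n! \<integral> det (K(u\<^sub>i, u\<^sub>j)) d\<mu>(u\<^sub>1) \<dots> d\<mu>(u\<^sub>n)\<close>.
\<close>

definition fredholm_integrand ::
    "(complex \<Rightarrow> complex) \<Rightarrow> (complex \<Rightarrow> complex \<Rightarrow> complex) \<Rightarrow> nat \<Rightarrow> (nat \<Rightarrow> complex) \<Rightarrow> complex" where
  "fredholm_integrand \<tau> K n u =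
     Determinant.det (Matrix.mat n n (\<lambda>(i, j). K (u i) (u j))) * (\<Prod>i<n. \<tau> (u i))"

definition fredholm_term ::
    "complex measure \<Rightarrow> (complex \<Rightarrow> complex) \<Rightarrow> (complex \<Rightarrow> complex \<Rightarrow> complex) \<Rightarrow> nat \<Rightarrow> complex" where
  "fredholm_term M \<tau> K n =
     (- 1) ^ n / fact n * (\<integral>u. fredholm_integrand \<tau> K n u \<partial>(PiM {..<n} (\<lambda>_. M)))"

definition fredholm_series_well_defined ::
    "complex measure \<Rightarrow> (complex \<Rightarrow> complex) \<Rightarrow> (complex \<Rightarrow> complex \<Rightarrow> complex) \<Rightarrow> bool" where
  "fredholm_series_well_defined M \<tau> K \<longleftrightarrow>
     (\<forall>n. integrable (PiM {..<n} (\<lambda>_. M)) (fredholm_integrand \<tau> K n)) \<and>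
     summable (fredholm_term M \<tau> K)"

definition fredholm_series ::
    "complex measure \<Rightarrow> (complex \<Rightarrow> complex) \<Rightarrow> (complex \<Rightarrow> complex \<Rightarrow> complex) \<Rightarrow> complex" where
  "fredholm_series M \<tau> K = (\<Sum>n. fredholm_term M \<tau> K n)"

text \<open>
  The kernel of a product of integral operators, and its existence outside a null set (of points,
  so that the values on the diagonal, which enter the Fredholm series, exist almost everywhere).
\<close>

definition kernel_prod ::
    "complex measure \<Rightarrow> (complex \<Rightarrow> complex) \<Rightarrow> (complex \<Rightarrow> complex \<Rightarrow> complex) \<Rightarrow>
     (complex \<Rightarrow> complex \<Rightarrow> complex) \<Rightarrow> complex \<Rightarrow> complex \<Rightarrow> complex" where
  "kernel_prod N \<tau> K L u w = (\<integral>v. K u v * L v w * \<tau> v \<partial>N)"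

definition kernel_prod_exists ::
    "complex measure \<Rightarrow> complex measure \<Rightarrow> (complex \<Rightarrow> complex) \<Rightarrow> (complex \<Rightarrow> complex \<Rightarrow> complex) \<Rightarrow>
     (complex \<Rightarrow> complex \<Rightarrow> complex) \<Rightarrow> bool" where
  "kernel_prod_exists M N \<tau> K L \<longleftrightarrow>
     (\<exists>Z\<in>null_sets M. \<forall>u\<in>space M - Z. \<forall>w\<in>space M - Z. integrable N (\<lambda>v. K u v * L v w * \<tau> v))"


section \<open>The operators \<open>K\<^sub>1\<close> and \<open>K\<^sub>2\<close>\<close>

definition kronecker :: "int \<Rightarrow> int \<Rightarrow> complex" where
  "kronecker i j = of_bool (i = j)"

text \<open>\<open>M\<^sub>1 = m\<^sub>1, M\<^sub>2 = m\<^sub>1/m\<^sub>2, M\<^sub>3 = m\<^sub>3/m\<^sub>2, M\<^sub>4 = m\<^sub>3/m\<^sub>4, \<dots>\<close>\<close>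

definition Mratio :: "(nat \<Rightarrow> complex \<Rightarrow> complex) \<Rightarrow> nat \<Rightarrow> complex \<Rightarrow> complex" where
  "Mratio ms i z = (if i = 1 then ms 1 z
                    else if even i then ms (i - 1) z / ms i z
                    else ms i z / ms (i - 1) z)"

text \<open>
  The indicators select the blocks \<open>\<Omega>\<^sub>1\<^sub>,\<^sub>i \<times> \<Omega>\<^sub>2\<^sub>,\<^sub>j\<close> and \<open>\<Omega>\<^sub>2\<^sub>,\<^sub>i \<times> \<Omega>\<^sub>1\<^sub>,\<^sub>j\<close>; by disjointness at most one
  summand is nonzero.
\<close>

definition K1_kernel ::
    "nat \<Rightarrow> (nat \<Rightarrow> nat \<Rightarrow> complex set) \<Rightarrow> (nat \<Rightarrow> complex \<Rightarrow> complex) \<Rightarrow> (nat \<Rightarrow> complex \<Rightarrow> complex) \<Rightarrow>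
     (nat \<Rightarrow> complex \<Rightarrow> complex) \<Rightarrow> complex \<Rightarrow> complex \<Rightarrow> complex" where
  "K1_kernel m \<Omega> A B ms u v =
     (\<Sum>i=1..m. \<Sum>j=1..m. indicator (\<Omega> 1 i) u * indicator (\<Omega> 2 j) v *
        ((kronecker (int i) (int j) + kronecker (int i) (int j + (- 1) ^ i)) *
         (Mratio ms i u * A i u * B j v / (u - v))))"

definition K2_kernel ::
    "nat \<Rightarrow> (nat \<Rightarrow> nat \<Rightarrow> complex set) \<Rightarrow> (nat \<Rightarrow> complex \<Rightarrow> complex) \<Rightarrow> (nat \<Rightarrow> complex \<Rightarrow> complex) \<Rightarrow>
     (nat \<Rightarrow> complex \<Rightarrow> complex) \<Rightarrow> complex \<Rightarrow> complex \<Rightarrow> complex" where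
  "K2_kernel m \<Omega> A B ms u v =
     (\<Sum>i=1..m. \<Sum>j=1..m. indicator (\<Omega> 2 i) u * indicator (\<Omega> 1 j) v *
        ((kronecker (int i) (int j) + kronecker (int i) (int j - (- 1) ^ i)) *
         (inverse (Mratio ms i u) * A i u * B j v / (u - v))))"


section \<open>The operator \<open>H\<close>\<close>

text \<open>Matrix and vector entries are indexed from \<open>0\<close>, whence the occurrences of \<open>Suc\<close>.\<close>

definition X_mat :: "nat \<Rightarrow> (nat \<Rightarrow> nat \<Rightarrow> complex set) \<Rightarrow> nat \<Rightarrow> complex \<Rightarrow> complex mat" where
  "X_mat m \<Omega> l z = mat_diag m (\<lambda>j. indicator (\<Omega> l (Suc j)) z)"

definition diag_fun :: "nat \<Rightarrow> (nat \<Rightarrow> complex \<Rightarrow> complex) \<Rightarrow> complex \<Rightarrow> complex mat" where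
  "diag_fun m A z = mat_diag m (\<lambda>j. A (Suc j) z)"

definition ones_vec :: "nat \<Rightarrow> complex vec" where
  "ones_vec m = Matrix.vec m (\<lambda>_. 1)"

definition E11 :: "nat \<Rightarrow> complex mat" where
  "E11 m = mat_diag m (\<lambda>j. if j = 0 then 1 else 0)"

definition P_mat :: "nat \<Rightarrow> complex mat" where
  "P_mat m = Matrix.mat (m + 1) (2 * m) (\<lambda>(i, j). if i = j then 1 else 0)"

definition U_block :: "complex mat" where
  "U_block = mat_of_rows_list 2 [[1, 1], [0, 0]]"

definition Lambda1 :: "nat \<Rightarrow> complex mat" where
  "Lambda1 m =
     (if even m then diag_block_mat (replicate (m div 2) U_block)
      else diag_block_mat (replicate (m div 2) U_block @ [1\<^sub>m 1]))"

definition Lambda2 :: "nat \<Rightarrow> complex mat" where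
  "Lambda2 m =
     (if even m then diag_block_mat ([1\<^sub>m 1] @ replicate (m div 2 - 1) U_block @ [1\<^sub>m 1])
      else diag_block_mat ([1\<^sub>m 1] @ replicate (m div 2) U_block))"

definition big_mat :: "nat \<Rightarrow> complex mat" where
  "big_mat m = P_mat m * four_block_mat (Lambda1 m) (Lambda2 m - E11 m) (0\<^sub>m m m) (E11 m)"

definition U_vec ::
    "nat \<Rightarrow> (nat \<Rightarrow> nat \<Rightarrow> complex set) \<Rightarrow> (nat \<Rightarrow> complex \<Rightarrow> complex) \<Rightarrow> complex \<Rightarrow> complex vec" where
  "U_vec m \<Omega> A z = big_mat m *\<^sub>v
     ((diag_fun m A z * X_mat m \<Omega> 1 z *\<^sub>v ones_vec m) @\<^sub>v
      (diag_fun m A z * X_mat m \<Omega> 2 z *\<^sub>v ones_vec m))"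

definition V_vec ::
    "nat \<Rightarrow> (nat \<Rightarrow> nat \<Rightarrow> complex set) \<Rightarrow> (nat \<Rightarrow> complex \<Rightarrow> complex) \<Rightarrow> complex \<Rightarrow> complex vec" where
  "V_vec m \<Omega> B z = big_mat m *\<^sub>v
     ((diag_fun m B z * X_mat m \<Omega> 2 z *\<^sub>v ones_vec m) @\<^sub>v
      (diag_fun m B z * X_mat m \<Omega> 1 z *\<^sub>v ones_vec m))"

definition Delta_mat :: "nat \<Rightarrow> (nat \<Rightarrow> complex \<Rightarrow> complex) \<Rightarrow> complex \<Rightarrow> complex mat" where
  "Delta_mat m ms z = mat_diag (m + 1) (\<lambda>j. if j < m then ms (Suc j) z else 1)"

definition Delta_inv_mat :: "nat \<Rightarrow> (nat \<Rightarrow> complex \<Rightarrow> complex) \<Rightarrow> complex \<Rightarrow> complex mat" where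
  "Delta_inv_mat m ms z = mat_diag (m + 1) (\<lambda>j. if j < m then inverse (ms (Suc j) z) else 1)"

definition f_vec ::
    "nat \<Rightarrow> (nat \<Rightarrow> nat \<Rightarrow> complex set) \<Rightarrow> (nat \<Rightarrow> complex \<Rightarrow> complex) \<Rightarrow> (nat \<Rightarrow> complex \<Rightarrow> complex) \<Rightarrow>
     (complex \<Rightarrow> complex) \<Rightarrow> complex \<Rightarrow> complex vec" where
  "f_vec m \<Omega> A ms c z = c z \<cdot>\<^sub>v (Delta_mat m ms z *\<^sub>v U_vec m \<Omega> A z)"

definition g_vec ::
    "nat \<Rightarrow> (nat \<Rightarrow> nat \<Rightarrow> complex set) \<Rightarrow> (nat \<Rightarrow> complex \<Rightarrow> complex) \<Rightarrow> (nat \<Rightarrow> complex \<Rightarrow> complex) \<Rightarrow>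
     (complex \<Rightarrow> complex) \<Rightarrow> complex \<Rightarrow> complex vec" where
  "g_vec m \<Omega> B ms c z = inverse (c z) \<cdot>\<^sub>v (Delta_inv_mat m ms z *\<^sub>v V_vec m \<Omega> B z)"

text \<open>\<open>scalar_prod\<close> is bilinear (without conjugation), so this is \<open>f(u)\<^sup>T g(v) / (u - v)\<close>.\<close>

definition H_kernel ::
    "nat \<Rightarrow> (nat \<Rightarrow> nat \<Rightarrow> complex set) \<Rightarrow> (nat \<Rightarrow> complex \<Rightarrow> complex) \<Rightarrow> (nat \<Rightarrow> complex \<Rightarrow> complex) \<Rightarrow>
     (nat \<Rightarrow> complex \<Rightarrow> complex) \<Rightarrow> (complex \<Rightarrow> complex) \<Rightarrow> complex \<Rightarrow> complex \<Rightarrow> complex" where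
  "H_kernel m \<Omega> A B ms c u v =
     (if u = v then 0
      else scalar_prod (f_vec m \<Omega> A ms c u) (g_vec m \<Omega> B ms c v) / (u - v))"

end

theory Submission
  imports Defs
begin

text \<open>
  At a point of \<open>\<Omega>\<^sub>l\<^sub>,\<^sub>i\<close> the vectors \<open>A X\<^sub>1 e\<close>, \<open>A X\<^sub>2 e\<close> stacked on top of each other have at
  most one nonzero entry, and so has each column of the matrix in the definition of \<open>U\<close> and \<open>V\<close>.
  Hence \<open>f(z)\<close> and \<open>g(z)\<close> have at most one nonzero component each.  On \<open>\<Omega>\<^sub>1\<close> the component of \<open>f\<close> is an odd number
  \<open>\<le> m\<close> and that of \<open>g\<close> is an even number \<open>\<le> m\<close> or \<open>m + 1\<close>; on \<open>\<Omega>\<^sub>2\<close> it is the other way round.  This gives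
  \<open>f\<^sub>i g\<^sub>i = 0\<close>, and also that \<open>H\<close> vanishes on \<open>\<Omega>\<^sub>1 \<times> \<Omega>\<^sub>1\<close> and \<open>\<Omega>\<^sub>2 \<times> \<Omega>\<^sub>2\<close>.  In the off-diagonal blocks
  \<open>H\<^sub>1\<^sub>2\<close> and \<open>H\<^sub>2\<^sub>1\<close> the two components agree exactly where the Kronecker deltas in \<open>K\<^sub>1\<close> and \<open>K\<^sub>2\<close> do
  not vanish, and there the ratios \<open>M\<^sub>i\<close> turn out to be the effect of a conjugation:
  \<open>K\<^sub>1 = a\<^sub>1\<^sup>-\<^sup>1 H\<^sub>1\<^sub>2 a\<^sub>2\<close> and \<open>K\<^sub>2 = a\<^sub>2\<^sup>-\<^sup>1 H\<^sub>2\<^sub>1 a\<^sub>1\<close> with non-vanishing functions \<open>a\<^sub>1, a\<^sub>2\<close>.  So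
  \<open>K\<^sub>1 K\<^sub>2\<close> and \<open>H\<^sub>1\<^sub>2 H\<^sub>2\<^sub>1\<close> have the same Fredholm series (\<open>kernel_prod_conjugate\<close>,
  \<open>fredholm_term_conjugate\<close>), and the claim becomes
  \<open>det (1 - H) = det (1 - H\<^sub>1\<^sub>2 H\<^sub>2\<^sub>1)\<close> for an operator with zero diagonal blocks.

  For matrices this is the Schur complement.  Here the right side is a series of integrals of
  determinants of a kernel, which involve its values on the diagonal, and the left side a sum of traces of
  exterior powers in an orthonormal basis.  So the two series are compared term by term: the odd
  exterior powers of \<open>H\<close> have trace \<open>0\<close>, and the trace of \<open>\<Lambda>\<^sup>2\<^sup>n H\<close> is the \<open>n\<close>-th Fredholm term
  (\<open>ext_power_trace_fredholm\<close>).

  The common value of both sides lives on the index set of the Schmidt expansion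
  \<open>H = \<Sum>\<^sub>k s\<^sub>k \<langle>\<phi>\<^sub>k, \<cdot>\<rangle> \<psi>\<^sub>k\<close>.  The tool is \<open>perm_det_integral_swap\<close>: for square integrable kernels, the integral
  of the \<open>n \<times> n\<close> minors does not change if \<open>\<Phi> \<Psi>\<close> is replaced by \<open>\<Psi> \<Phi>\<close>, because for every single permutation both
  sides are iterated integrals of one function.  Cutting \<open>\<phi>\<^sub>k\<close> and \<open>\<psi>\<^sub>k\<close> into their parts on \<open>\<Omega>\<^sub>1\<close>
  and \<open>\<Omega>\<^sub>2\<close> and factorizing \<open>H\<close> through square summable sequences turns the exterior trace into a sum of minors of
  an infinite block matrix with zero diagonal blocks and off-diagonal blocks \<open>L\<close>, \<open>N\<close>
  (\<open>ext_power_trace_eq\<close>); the basis has disappeared.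
  Since the kernel of \<open>H\<close> equals its Schmidt series almost everywhere (\<open>kernel_eq_series\<close>), the same
  tool turns the Fredholm terms into sums of minors of \<open>L N\<close> (\<open>fredholm_integral_eq\<close>).
  The remaining identity between minors of the block matrix and minors of \<open>L N\<close> is obtained for finite
  sections from Newton's identities, since the traces of the powers are related in an obvious
  way (\<open>minor_sum_offdiag\<close>), and then by dominated convergence (\<open>offdiag_integral\<close>).

  All this needs \<open>|\<mu>|\<close> to be sigma-finite, with a countably generated sigma-algebra, and the
  unit tangent to be measurable.  For unions of contours this follows from sigma-compactness of the
  images of suitable parameter sets.
\<close>

section \<open>Sums of minors and Newton's identities\<close>

text \<open>
  The Leibniz formula over an arbitrary finite index set, to which single elements can be added.
\<close>

definition perm_det :: "'i set \<Rightarrow> ('i \<Rightarrow> 'i \<Rightarrow> complex) \<Rightarrow> complex" where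
  "perm_det S f = (\<Sum>p | p permutes S. of_int (sign p) * (\<Prod>i\<in>S. f i (p i)))"

text \<open>
  This is \<open>n!\<close> times the trace of the \<open>n\<close>-th exterior power of the matrix \<open>K\<close> over \<open>J\<close>, where \<open>n\<close> is the
  size of \<open>S\<close>: the tuples are ordered, and those with repetitions contribute \<open>0\<close>.
\<close>

definition minor_sum :: "'i set \<Rightarrow> 'a set \<Rightarrow> ('a \<Rightarrow> 'a \<Rightarrow> complex) \<Rightarrow> complex" where
  "minor_sum S J K = (\<Sum>x\<in>PiE S (\<lambda>_. J). perm_det S (\<lambda>i j. K (x i) (x j)))"

text \<open>
  One column of each minor, the marked one, is taken from another matrix \<open>L\<close>.  Such sums
  interpolate between minor sums and traces of powers.
\<close>

definition marked_minor_sum ::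
    "'i \<Rightarrow> 'i set \<Rightarrow> 'a set \<Rightarrow> ('a \<Rightarrow> 'a \<Rightarrow> complex) \<Rightarrow> ('a \<Rightarrow> 'a \<Rightarrow> complex) \<Rightarrow> complex" where
  "marked_minor_sum a S J K L = (\<Sum>x\<in>PiE (insert a S) (\<lambda>_. J).
     perm_det (insert a S) (\<lambda>i j. if j = a then L (x i) (x a) else K (x i) (x j)))"

definition mat_comp :: "'a set \<Rightarrow> ('a \<Rightarrow> 'a \<Rightarrow> complex) \<Rightarrow> ('a \<Rightarrow> 'a \<Rightarrow> complex) \<Rightarrow> 'a \<Rightarrow> 'a \<Rightarrow> complex" where
  "mat_comp J L K x y = (\<Sum>z\<in>J. L x z * K z y)"

definition mat_trace :: "'a set \<Rightarrow> ('a \<Rightarrow> 'a \<Rightarrow> complex) \<Rightarrow> complex" where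
  "mat_trace J L = (\<Sum>x\<in>J. L x x)"

lemma sum_PiE_insert:
  assumes "a \<notin> S"
  shows "(\<Sum>x\<in>PiE (insert a S) T. g x) = (\<Sum>x\<in>PiE S T. \<Sum>z\<in>T a. g (x(a := z)))"
proof -
  have "(\<Sum>x\<in>PiE (insert a S) T. g x) = (\<Sum>(z, x)\<in>T a \<times> PiE S T. g (x(a := z)))"
    unfolding PiE_insert_eq
    by (subst sum.reindex[OF inj_combinator[OF assms]]) (auto simp: case_prod_unfold intro!: sum.cong)
  also have "\<dots> = (\<Sum>z\<in>T a. \<Sum>x\<in>PiE S T. g (x(a := z)))" by (rule sum.cartesian_product[symmetric])
  also have "\<dots> = (\<Sum>x\<in>PiE S T. \<Sum>z\<in>T a. g (x(a := z)))" by (rule sum.swap)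
  finally show ?thesis .
qed

lemma minor_sum_insert: "minor_sum (insert a S) J K = marked_minor_sum a S J K K"
  unfolding minor_sum_def marked_minor_sum_def
  by (intro sum.cong refl arg_cong[where f="perm_det _"] ext) auto

text \<open>
  Expansion according to the image \<open>b\<close> of \<open>a\<close>: a permutation of \<open>insert a S\<close> is a permutation \<open>q\<close> of
  \<open>S\<close> with \<open>a\<close> inserted into a cycle before \<open>b\<close>, which costs a sign unless \<open>a\<close> is a fixed point.
\<close>

lemma perm_det_expand_marked:
  assumes S: "finite S" "a \<notin> S"
  shows "perm_det (insert a S) F =
    F a a * perm_det S F -
    (\<Sum>b\<in>S. \<Sum>q | q permutes S. of_int (sign q) *
        (F a b * (\<Prod>i\<in>S. F i (if q i = b then a else q i))))"
proof -
  have sg: "sign (Transposition.transpose a b \<circ> q) = (if a = b then 1 else -1) * sign q" if "q permutes S" for b q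
    using that S by (subst sign_compose)
      (auto simp: sign_swap_id permutation_swap_id permutes_imp_permutation)
  have pr: "(\<Prod>i\<in>insert a S. F i ((Transposition.transpose a b \<circ> q) i)) =
      F a b * (\<Prod>i\<in>S. F i (if q i = b then a else q i))" if "q permutes S" for b q
  proof -
    have qa: "q a = a" using that S by (meson permutes_not_in)
    have "(\<Prod>i\<in>S. F i ((Transposition.transpose a b \<circ> q) i)) = (\<Prod>i\<in>S. F i (if q i = b then a else q i))"
      using permutes_in_image[OF that] S by (intro prod.cong) (auto simp: Transposition.transpose_def)
    then show ?thesis using S qa by simp
  qed
  have "perm_det (insert a S) F = (\<Sum>b\<in>insert a S. \<Sum>q | q permutes S.
      of_int (sign (Transposition.transpose a b \<circ> q)) * (\<Prod>i\<in>insert a S. F i ((Transposition.transpose a b \<circ> q) i)))"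
    unfolding perm_det_def by (rule sum_over_permutations_insert[OF S])
  also have "\<dots> = (\<Sum>b\<in>insert a S. \<Sum>q | q permutes S. (if a = b then 1 else -1) * of_int (sign q) *
      (F a b * (\<Prod>i\<in>S. F i (if q i = b then a else q i))))"
    by (intro sum.cong refl) (simp only: mem_Collect_eq sg pr, simp)
  also have "\<dots> = (\<Sum>q | q permutes S. of_int (sign q) * (F a a * (\<Prod>i\<in>S. F i (if q i = a then a else q i))))
     + (\<Sum>b\<in>S. \<Sum>q | q permutes S. - (of_int (sign q) * (F a b * (\<Prod>i\<in>S. F i (if q i = b then a else q i)))))"
    using S by (auto intro!: sum.cong)
  also have "(\<Sum>q | q permutes S. of_int (sign q) * (F a a * (\<Prod>i\<in>S. F i (if q i = a then a else q i))))
     = F a a * perm_det S F"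
    unfolding perm_det_def sum_distrib_left by (intro sum.cong refl) (auto intro!: prod.cong)
  finally show ?thesis by (simp add: sum_negf)
qed

text \<open>
  If the permutation fixes the marked index, the trace of \<open>L\<close> splits off.  Otherwise the index
  occurs in a factor of \<open>L\<close> and in a factor of \<open>K\<close>; summing over its value multiplies the
  matrices, and the mark moves on to the successor in the cycle.
\<close>

lemma marked_minor_sum_rec:
  assumes S: "finite S" "a \<notin> S"
  shows "marked_minor_sum a S J K L =
    mat_trace J L * minor_sum S J K -
    (\<Sum>b\<in>S. marked_minor_sum b (S - {b}) J K (mat_comp J L K))"
proof -
  let ?P = "PiE S (\<lambda>_. J)"
  let ?LK = "mat_comp J L K"
  let ?F = "\<lambda>x z i j. if j = a then L ((x(a := z)) i) z else K ((x(a := z)) i) ((x(a := z)) j)"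
  have pS: "perm_det S (?F x z) = perm_det S (\<lambda>i j. K (x i) (x j))" for x z
    unfolding perm_det_def
  proof (intro sum.cong refl arg_cong2[where f="(*)"] prod.cong)
    fix q i assume "q \<in> {p. p permutes S}" "i \<in> S"
    then have "q i \<in> S" by (auto simp: permutes_in_image)
    with \<open>i \<in> S\<close> S show "?F x z i (q i) = K (x i) (x (q i))" by auto
  qed
  have z: "(\<Sum>z\<in>J. ?F x z a b * (\<Prod>i\<in>S. ?F x z i (if q i = b then a else q i))) =
      (\<Prod>i\<in>S. if q i = b then ?LK (x i) (x b) else K (x i) (x (q i)))"
    if b: "b \<in> S" and q: "q permutes S" for x b q
  proof -
    \<comment> \<open>In the permutation with \<open>a\<close> inserted, \<open>i0\<close> is the index that is mapped to \<open>a\<close>.\<close>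
    obtain i0 where i0: "i0 \<in> S" "q i0 = b"
      using b permutes_image[OF q] by (metis imageE)
    have i0': "\<And>i. q i = b \<longleftrightarrow> i = i0"
      using permutes_inj[OF q] i0(2) by (auto dest: injD)
    have ia: "i0 \<noteq> a" "b \<noteq> a" using i0 b S by auto
    let ?R = "\<Prod>i\<in>S - {i0}. K (x i) (x (q i))"
    have "?F x z a b * (\<Prod>i\<in>S. ?F x z i (if q i = b then a else q i)) = K z (x b) * (L (x i0) z * ?R)" for z
    proof -
      have "(\<Prod>i\<in>S. ?F x z i (if q i = b then a else q i)) = L (x i0) z * (\<Prod>i\<in>S - {i0}. ?F x z i (if q i = b then a else q i))"
        using S i0 ia by (subst prod.remove[OF _ i0(1)]) auto
      also have "(\<Prod>i\<in>S - {i0}. ?F x z i (if q i = b then a else q i)) = ?R"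
      proof (intro prod.cong refl)
        fix i assume i: "i \<in> S - {i0}"
        then have "q i \<in> S" "i \<noteq> a" using q S by (auto simp: permutes_in_image)
        with i S show "?F x z i (if q i = b then a else q i) = K (x i) (x (q i))"
          using i0' by auto
      qed
      finally show ?thesis using ia by simp
    qed
    then have "(\<Sum>z\<in>J. ?F x z a b * (\<Prod>i\<in>S. ?F x z i (if q i = b then a else q i))) = ?LK (x i0) (x b) * ?R"
      by (simp add: mat_comp_def sum_distrib_left sum_distrib_right mult_ac)
    also have "\<dots> = (\<Prod>i\<in>S. if q i = b then ?LK (x i) (x b) else K (x i) (x (q i)))"
      using S i0 by (subst prod.remove[OF _ i0(1)]) (auto simp: i0' intro!: prod.cong)
    finally show ?thesis .
  qed
  have mark: "marked_minor_sum b (S - {b}) J K ?LK = (\<Sum>x\<in>?P. \<Sum>q | q permutes S. of_int (sign q) *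
      (\<Prod>i\<in>S. if q i = b then ?LK (x i) (x b) else K (x i) (x (q i))))" if "b \<in> S" for b
    using that by (simp add: marked_minor_sum_def insert_absorb perm_det_def)
  have "marked_minor_sum a S J K L = (\<Sum>x\<in>?P. \<Sum>z\<in>J. perm_det (insert a S) (?F x z))"
    unfolding marked_minor_sum_def
    by (subst sum_PiE_insert[OF S(2)]) (auto intro!: sum.cong arg_cong[where f="perm_det _"] simp: fun_eq_iff)
  also have "\<dots> = (\<Sum>x\<in>?P. \<Sum>z\<in>J. L z z * perm_det S (\<lambda>i j. K (x i) (x j))) -
      (\<Sum>x\<in>?P. \<Sum>z\<in>J. \<Sum>b\<in>S. \<Sum>q | q permutes S. of_int (sign q) *
        (?F x z a b * (\<Prod>i\<in>S. ?F x z i (if q i = b then a else q i))))"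
    unfolding perm_det_expand_marked[OF S] pS by (simp add: sum_subtractf)
  also have "(\<Sum>x\<in>?P. \<Sum>z\<in>J. L z z * perm_det S (\<lambda>i j. K (x i) (x j))) = mat_trace J L * minor_sum S J K"
    by (simp add: mat_trace_def minor_sum_def sum_distrib_left sum_distrib_right)
  also have "(\<Sum>x\<in>?P. \<Sum>z\<in>J. \<Sum>b\<in>S. \<Sum>q | q permutes S. of_int (sign q) *
        (?F x z a b * (\<Prod>i\<in>S. ?F x z i (if q i = b then a else q i)))) =
     (\<Sum>b\<in>S. \<Sum>x\<in>?P. \<Sum>q | q permutes S. \<Sum>z\<in>J. of_int (sign q) *
        (?F x z a b * (\<Prod>i\<in>S. ?F x z i (if q i = b then a else q i))))"
    by (subst sum.swap, subst sum.swap, intro sum.cong refl, subst sum.swap, rule refl)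
  also have "\<dots> = (\<Sum>b\<in>S. marked_minor_sum b (S - {b}) J K ?LK)"
  proof (intro sum.cong refl)
    fix b assume b: "b \<in> S"
    show "(\<Sum>x\<in>?P. \<Sum>q | q permutes S. \<Sum>z\<in>J. of_int (sign q) *
        (?F x z a b * (\<Prod>i\<in>S. ?F x z i (if q i = b then a else q i)))) = marked_minor_sum b (S - {b}) J K ?LK"
      unfolding mark[OF b]
      by (intro sum.cong refl) (simp only: mem_Collect_eq sum_distrib_left[symmetric] z[OF b])
  qed
  finally show ?thesis .
qed

text \<open>
  \<open>mat_pow J K r\<close> is the power with exponent \<open>r + 1\<close>; the power with exponent \<open>0\<close> does not occur
  in Newton's identities.
\<close>

primrec mat_pow :: "'a set \<Rightarrow> ('a \<Rightarrow> 'a \<Rightarrow> complex) \<Rightarrow> nat \<Rightarrow> 'a \<Rightarrow> 'a \<Rightarrow> complex" where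
  "mat_pow J K 0 = K"
| "mat_pow J K (Suc r) = mat_comp J (mat_pow J K r) K"

text \<open>
  Newton's identities, read as a recursion for the elementary symmetric functions in terms of the
  power sums.  The entry \<open>p r\<close> stands for the power sum with exponent \<open>r + 1\<close>.
\<close>

fun newton_seq :: "(nat \<Rightarrow> complex) \<Rightarrow> nat \<Rightarrow> complex" where
  "newton_seq p 0 = 1"
| "newton_seq p (Suc n) = (\<Sum>r\<le>n. (- 1) ^ r * p r * newton_seq p (n - r)) / of_nat (Suc n)"

declare newton_seq.simps(2)[simp del]

lemma fact_times_newton_seq:
  "fact n * newton_seq p (Suc n) * of_nat (Suc n) = fact n * (\<Sum>r\<le>n. (- 1) ^ r * p r * newton_seq p (n - r))"
  by (simp add: newton_seq.simps(2) del: of_nat_Suc)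

text \<open>
  Iteration of \<open>marked_minor_sum_rec\<close>: the marked column collects the powers of \<open>K\<close>.
\<close>

lemma marked_minor_sum_newton:
  fixes S :: "'i set"
  assumes "finite S" "a \<notin> S" "card S = n"
    "\<And>S'::'i set. finite S' \<Longrightarrow> card S' \<le> n \<Longrightarrow>
       minor_sum S' J K = fact (card S') * newton_seq (\<lambda>r. mat_trace J (mat_pow J K r)) (card S')"
  shows "marked_minor_sum a S J K (mat_pow J K l) =
    fact n * (\<Sum>r\<le>n. (- 1) ^ r * mat_trace J (mat_pow J K (l + r)) *
       newton_seq (\<lambda>r. mat_trace J (mat_pow J K r)) (n - r))"
  using assms
proof (induction n arbitrary: S a l)
  case 0
  then show ?case using marked_minor_sum_rec[of S a J K "mat_pow J K l"] 0(4)[of S] by simp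
next
  case (Suc n)
  let ?N = "newton_seq (\<lambda>r. mat_trace J (mat_pow J K r))"
  let ?t = "\<lambda>r. mat_trace J (mat_pow J K r)"
  have "marked_minor_sum b (S - {b}) J K (mat_pow J K (Suc l)) =
      fact n * (\<Sum>r\<le>n. (- 1) ^ r * ?t (Suc l + r) * ?N (n - r))" if "b \<in> S" for b
    by (rule Suc.IH) (use Suc.prems that in auto)
  then have "marked_minor_sum a S J K (mat_pow J K l) = ?t l * (fact (Suc n) * ?N (Suc n))
      - of_nat (Suc n) * (fact n * (\<Sum>r\<le>n. (- 1) ^ r * ?t (Suc l + r) * ?N (n - r)))"
    using marked_minor_sum_rec[of S a J K "mat_pow J K l"] Suc.prems(1-3) Suc.prems(4)[of S]
    by simp
  also have "\<dots> = fact (Suc n) * (?t l * ?N (Suc n) - (\<Sum>r\<le>n. (- 1) ^ r * ?t (Suc l + r) * ?N (n - r)))"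
    by (simp add: algebra_simps del: of_nat_Suc)
  also have "?t l * ?N (Suc n) - (\<Sum>r\<le>n. (- 1) ^ r * ?t (Suc l + r) * ?N (n - r)) =
      (\<Sum>r\<le>Suc n. (- 1) ^ r * ?t (l + r) * ?N (Suc n - r))"
    by (subst sum.atMost_Suc_shift) (simp add: sum_negf[symmetric])
  finally show ?case .
qed

theorem minor_sum_newton:
  assumes "finite S"
  shows "minor_sum S J K = fact (card S) * newton_seq (\<lambda>r. mat_trace J (mat_pow J K r)) (card S)"
  using assms
proof (induction "card S" arbitrary: S rule: less_induct)
  case less
  show ?case
  proof (cases "S = {}")
    case True then show ?thesis by (simp add: minor_sum_def perm_det_def)
  next
    case False
    then obtain a S' where S': "S = insert a S'" "a \<notin> S'" by (meson Set.set_insert ex_in_conv)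
    with less have f: "finite S'" by simp
    have "minor_sum S J K = marked_minor_sum a S' J K (mat_pow J K 0)"
      by (simp add: S' minor_sum_insert)
    also have "\<dots> = fact (card S') * (\<Sum>r\<le>card S'. (- 1) ^ r * mat_trace J (mat_pow J K (0 + r)) *
         newton_seq (\<lambda>r. mat_trace J (mat_pow J K r)) (card S' - r))"
      by (rule marked_minor_sum_newton) (use f S' less in auto)
    also have "\<dots> = fact (card S') * newton_seq (\<lambda>r. mat_trace J (mat_pow J K r)) (Suc (card S')) * of_nat (Suc (card S'))"
      unfolding fact_times_newton_seq by simp
    finally show ?thesis using S' f by (simp add: mult_ac)
  qed
qed

text \<open>
  The block matrix with zero diagonal blocks and off-diagonal blocks \<open>L\<close> (upper right) and \<open>N\<close> (lower
  left); \<open>True\<close> marks the upper, resp. left, half.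
\<close>

definition offdiag :: "('a \<Rightarrow> 'a \<Rightarrow> complex) \<Rightarrow> ('a \<Rightarrow> 'a \<Rightarrow> complex) \<Rightarrow> 'a \<times> bool \<Rightarrow> 'a \<times> bool \<Rightarrow> complex" where
  "offdiag L N x y =
     (if snd x = snd y then 0 else if snd x then L (fst x) (fst y) else N (fst x) (fst y))"

lemma mat_comp_assoc: "mat_comp J (mat_comp J K L) N = mat_comp J K (mat_comp J L N)"
  unfolding mat_comp_def
  by (intro ext) (simp add: sum_distrib_left sum_distrib_right mult.assoc, rule sum.swap)

lemma mat_trace_comp: "mat_trace J (mat_comp J K L) = mat_trace J (mat_comp J L K)"
  unfolding mat_trace_def mat_comp_def by (subst sum.swap) (simp add: mult.commute)

lemma mat_trace_pow_comp:
  "mat_trace J (mat_pow J (mat_comp J N L) r) = mat_trace J (mat_pow J (mat_comp J L N) r)"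
proof -
  define X where "X = rec_nat L (\<lambda>_ X. mat_comp J X (mat_comp J N L))"
  have 1: "mat_pow J (mat_comp J N L) r = mat_comp J N (X r)" for r
    by (induction r) (simp_all add: X_def mat_comp_assoc)
  have 2: "mat_pow J (mat_comp J L N) r = mat_comp J (X r) N" for r
    by (induction r) (simp_all add: X_def mat_comp_assoc)
  show ?thesis unfolding 1 2 by (rule mat_trace_comp)
qed

lemma sum_times_bool:
  "(\<Sum>x\<in>J \<times> (UNIV::bool set). g x) = (\<Sum>k\<in>J. g (k, True) + g (k, False))"
  by (simp add: sum.cartesian_product[symmetric, of "\<lambda>k b. g (k, b)", simplified case_prod_eta] UNIV_bool add.commute)

lemma mat_comp_times_bool:
  "mat_comp (J \<times> (UNIV::bool set)) K L x y =
    (\<Sum>k\<in>J. K x (k, True) * L (k, True) y + K x (k, False) * L (k, False) y)"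
  unfolding mat_comp_def by (rule sum_times_bool)

lemma mat_pow_offdiag:
  fixes J :: "'a set"
  defines "J' \<equiv> J \<times> (UNIV::bool set)"
  shows "mat_pow J' (offdiag L N) (2 * t) (k, b) (l, b) = 0"
    and "mat_pow J' (offdiag L N) (2 * t + 1) (k, a) (l, b) =
      (if a \<noteq> b then 0 else if a then mat_pow J (mat_comp J L N) t k l else mat_pow J (mat_comp J N L) t k l)"
proof -
  let ?A = "offdiag L N"
  have sq: "mat_comp J' ?A ?A (k, a) (l, b) =
      (if a \<noteq> b then 0 else if a then mat_comp J L N k l else mat_comp J N L k l)" for k l a b
    unfolding J'_def mat_comp_def sum_times_bool by (auto simp: offdiag_def)
  have odd: "mat_pow J' ?A (2 * t + 1) (k, a) (l, b) =
      (if a \<noteq> b then 0 else if a then mat_pow J (mat_comp J L N) t k l else mat_pow J (mat_comp J N L) t k l)" for t k l a b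
  proof (induction t arbitrary: k l a b)
    case 0 show ?case by (simp add: sq)
  next
    case (Suc t)
    have "mat_pow J' ?A (2 * Suc t + 1) (k, a) (l, b) =
        mat_comp J' (mat_pow J' ?A (2 * t + 1)) (mat_comp J' ?A ?A) (k, a) (l, b)"
      by (simp add: mat_comp_assoc)
    also have "\<dots> = (\<Sum>z\<in>J. mat_pow J' ?A (2 * t + 1) (k, a) (z, True) * mat_comp J' ?A ?A (z, True) (l, b) +
        mat_pow J' ?A (2 * t + 1) (k, a) (z, False) * mat_comp J' ?A ?A (z, False) (l, b))"
      unfolding J'_def by (rule mat_comp_times_bool)
    also have "\<dots> = (if a \<noteq> b then 0 else if a then mat_pow J (mat_comp J L N) (Suc t) k l
        else mat_pow J (mat_comp J N L) (Suc t) k l)"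
      unfolding Suc.IH sq by (cases a; cases b) (simp_all add: mat_comp_def[of J "mat_pow _ _ _"])
    finally show ?case .
  qed
  show "mat_pow J' ?A (2 * t + 1) (k, a) (l, b) =
      (if a \<noteq> b then 0 else if a then mat_pow J (mat_comp J L N) t k l else mat_pow J (mat_comp J N L) t k l)"
    by (rule odd)
  show "mat_pow J' ?A (2 * t) (k, b) (l, b) = 0"
  proof (cases t)
    case 0 then show ?thesis by (simp add: offdiag_def)
  next
    case (Suc t')
    have "mat_pow J' ?A (2 * t) (k, b) (l, b) = mat_comp J' (mat_pow J' ?A (2 * t' + 1)) ?A (k, b) (l, b)"
      by (simp add: Suc)
    also have "\<dots> = (\<Sum>z\<in>J. mat_pow J' ?A (2 * t' + 1) (k, b) (z, True) * ?A (z, True) (l, b) +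
        mat_pow J' ?A (2 * t' + 1) (k, b) (z, False) * ?A (z, False) (l, b))"
      unfolding J'_def by (rule mat_comp_times_bool)
    also have "\<dots> = 0" unfolding odd by (cases b) (simp_all add: offdiag_def)
    finally show ?thesis .
  qed
qed

lemma mat_trace_pow_offdiag:
  "mat_trace (J \<times> UNIV) (mat_pow (J \<times> UNIV) (offdiag L N) (2 * t)) = 0"
  "mat_trace (J \<times> UNIV) (mat_pow (J \<times> UNIV) (offdiag L N) (2 * t + 1)) =
     2 * mat_trace J (mat_pow J (mat_comp J L N) t)"
proof -
  show "mat_trace (J \<times> UNIV) (mat_pow (J \<times> UNIV) (offdiag L N) (2 * t)) = 0"
    unfolding mat_trace_def sum_times_bool by (simp only: mat_pow_offdiag) simp
  have "mat_trace (J \<times> UNIV) (mat_pow (J \<times> UNIV) (offdiag L N) (2 * t + 1)) =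
     mat_trace J (mat_pow J (mat_comp J L N) t) + mat_trace J (mat_pow J (mat_comp J N L) t)"
    unfolding mat_trace_def sum_times_bool by (simp only: mat_pow_offdiag) (simp add: sum.distrib)
  then show "mat_trace (J \<times> UNIV) (mat_pow (J \<times> UNIV) (offdiag L N) (2 * t + 1)) =
     2 * mat_trace J (mat_pow J (mat_comp J L N) t)"
    by (simp add: mat_trace_pow_comp)
qed

text \<open>
  In terms of generating functions: if \<open>q\<close> leads to the series \<open>e(z)\<close>, then \<open>p\<close> leads to
  \<open>e(- z\<^sup>2)\<close>.
\<close>

lemma newton_seq_even:
  assumes p: "\<And>t. p (2 * t) = 0" "\<And>t. p (2 * t + 1) = 2 * q t"
  shows "newton_seq p (2 * n) = (- 1) ^ n * newton_seq q n"
    and "newton_seq p (2 * n + 1) = 0"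
proof -
  have split: "(\<Sum>r\<le>2 * n + 1. f r) = (\<Sum>t\<le>n. f (2 * t) + f (2 * t + 1))" for f :: "nat \<Rightarrow> complex" and n
    by (induction n) (simp_all add: numeral_eq_Suc)
  have "newton_seq p (2 * n) = (- 1) ^ n * newton_seq q n \<and> newton_seq p (2 * n + 1) = 0" for n
  proof (induction n rule: less_induct)
    case (less n)
    have even: "newton_seq p (2 * n) = (- 1) ^ n * newton_seq q n"
    proof (cases n)
      case (Suc k)
      have "newton_seq p (2 * n) =
          (\<Sum>r\<le>2 * k + 1. (- 1) ^ r * p r * newton_seq p (2 * k + 1 - r)) / of_nat (2 * n)"
        using newton_seq.simps(2)[of p "2 * k + 1"] by (simp add: Suc)
      also have "(\<Sum>r\<le>2 * k + 1. (- 1) ^ r * p r * newton_seq p (2 * k + 1 - r)) =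
          (\<Sum>t\<le>k. - 2 * q t * newton_seq p (2 * (k - t)))"
        unfolding split p by (intro sum.cong) (simp_all add: diff_mult_distrib2)
      also have "\<dots> = (\<Sum>t\<le>k. 2 * (- 1) ^ n * ((- 1) ^ t * q t * newton_seq q (k - t)))"
      proof (intro sum.cong refl)
        fix t assume "t \<in> {..k}"
        then have t: "t \<le> k" "k - t < n" by (auto simp: Suc)
        have "(- 1 :: complex) ^ (k - t) = (- 1) ^ (k + t)" using t by (simp add: minus_one_power_iff)
        then show "- 2 * q t * newton_seq p (2 * (k - t)) =
            2 * (- 1) ^ n * ((- 1) ^ t * q t * newton_seq q (k - t))"
          using less[OF t(2)] by (simp add: Suc power_add mult_ac)
      qed
      also have "\<dots> / of_nat (2 * n) = (- 1) ^ n * newton_seq q n"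
      proof -
        have n: "(of_nat (2 * n) :: complex) = 2 * of_nat (Suc k)" by (simp add: Suc)
        have S: "(\<Sum>t\<le>k. (- 1) ^ t * q t * newton_seq q (k - t)) = newton_seq q n * of_nat (Suc k)"
          by (simp add: Suc newton_seq.simps(2) del: of_nat_Suc)
        show ?thesis unfolding n sum_distrib_left[symmetric] S by (simp del: of_nat_Suc)
      qed
      finally show ?thesis .
    qed simp
    have "newton_seq p (2 * n + 1) = (\<Sum>r\<le>2 * n. (- 1) ^ r * p r * newton_seq p (2 * n - r)) / of_nat (2 * n + 1)"
      using newton_seq.simps(2)[of p "2 * n"] by simp
    also have "(\<Sum>r\<le>2 * n. (- 1) ^ r * p r * newton_seq p (2 * n - r)) = 0"
    proof (intro sum.neutral ballI)
      fix r assume r: "r \<in> {..2 * n}"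
      show "(- 1) ^ r * p r * newton_seq p (2 * n - r) = 0"
      proof (cases "even r")
        case True then show ?thesis using p(1) by (auto elim!: evenE)
      next
        case False
        then obtain t where t: "r = 2 * t + 1" by (auto elim: oddE)
        with r have "2 * n - r = 2 * (n - Suc t) + 1" "n - Suc t < n" by auto
        then show ?thesis using less[of "n - Suc t"] by simp
      qed
    qed
    finally show ?case using even by simp
  qed
  then show "newton_seq p (2 * n) = (- 1) ^ n * newton_seq q n" "newton_seq p (2 * n + 1) = 0" by auto
qed

text \<open>
  This is \<open>det (1 + z (0, L; N, 0)) = det (1 - z\<^sup>2 L N)\<close>, compared coefficientwise: of the powers of
  the block matrix, the odd ones have trace \<open>0\<close> and the even ones twice the trace of a power of \<open>L N\<close>.
\<close>

theorem minor_sum_offdiag: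
  "minor_sum {..<2 * n} (J \<times> UNIV) (offdiag L N) =
     (- 1) ^ n * fact (2 * n) / fact n * minor_sum {..<n} J (mat_comp J L N)"
  "minor_sum {..<2 * n + 1} (J \<times> UNIV) (offdiag L N) = 0"
  by (simp_all only: minor_sum_newton finite_lessThan card_lessThan
      newton_seq_even[where q="\<lambda>t. mat_trace J (mat_pow J (mat_comp J L N) t)", OF mat_trace_pow_offdiag])
    simp_all

section \<open>Interchanging the factors of a product of kernels\<close>

lemma det_mat_eq_perm_det:
  "Determinant.det (Matrix.mat n n (\<lambda>(i, j). f i j)) = perm_det {..<n} f"
proof -
  have "(\<Prod>i<n. Matrix.mat n n (\<lambda>(i, j). f i j) $$ (i, p i)) = (\<Prod>i<n. f i (p i))"
    if "p permutes {..<n}" for p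
    using permutes_in_image[OF that] by (intro prod.cong) auto
  then show ?thesis
    unfolding Determinant.det_def perm_det_def atLeast0LessThan by (auto intro!: sum.cong)
qed

lemma AE_PiM_lessThan:
  assumes "sigma_finite_measure M" "AE x in M. P x"
  shows "AE x in PiM {..<n::nat} (\<lambda>_. M). \<forall>i<n. P (x i)"
proof -
  interpret sigma_finite_measure M by fact
  interpret product_sigma_finite "\<lambda>_. M" ..
  obtain Z where Z: "Z \<in> null_sets M" "{x \<in> space M. \<not> P x} \<subseteq> Z"
    by (rule AE_E[OF assms(2)]) (simp add: null_sets_def)
  have "AE x in PiM {..<n} (\<lambda>_. M). P (x i)" if "i < n" for i
  proof (rule AE_I')
    let ?C = "PiE {..<n} (\<lambda>j. if j = i then Z else space M)"
    have "emeasure (PiM {..<n} (\<lambda>_. M)) ?C = (\<Prod>j<n. emeasure M (if j = i then Z else space M))"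
      using Z(1) by (intro emeasure_PiM) (simp_all add: null_setsD2)
    also have "\<dots> = 0" using Z that by (intro prod_zero bexI[of _ i]) auto
    finally show "?C \<in> null_sets (PiM {..<n} (\<lambda>_. M))"
      using Z(1) by (intro null_setsI) (simp_all add: sets_PiM_I_finite null_setsD2)
    show "{x \<in> space (PiM {..<n} (\<lambda>_. M)). \<not> P (x i)} \<subseteq> ?C"
    proof (intro subsetI PiE_I)
      fix x j assume x: "x \<in> {x \<in> space (PiM {..<n} (\<lambda>_. M)). \<not> P (x i)}" and j: "j \<in> {..<n}"
      then have "x j \<in> space M" by (auto simp: space_PiM)
      with x Z(2) show "x j \<in> (if j = i then Z else space M)" by auto
    qed (auto simp: space_PiM)
  qed
  then have "AE x in PiM {..<n} (\<lambda>_. M). \<forall>i\<in>{..<n}. P (x i)"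
    by (rule AE_finite_allI[OF finite_lessThan]) (simp only: lessThan_iff)
  then show ?thesis by (simp only: Ball_def lessThan_iff)
qed

lemma sigma_finite_PiM:
  assumes "sigma_finite_measure M" "finite I"
  shows "sigma_finite_measure (PiM I (\<lambda>_. M))"
proof -
  interpret sigma_finite_measure M by fact
  interpret product_sigma_finite "\<lambda>_. M" ..
  show ?thesis by (rule sigma_finite[OF assms(2)])
qed

lemma measurable_fst_component:
  "i \<in> I \<Longrightarrow> (\<lambda>z. fst z i) \<in> measurable (PiM I (\<lambda>_. M) \<Otimes>\<^sub>M N) M"
  by (rule measurable_compose[OF measurable_fst measurable_component_singleton])

lemma measurable_snd_component:
  "i \<in> I \<Longrightarrow> (\<lambda>z. snd z i) \<in> measurable (N \<Otimes>\<^sub>M PiM I (\<lambda>_. M)) M"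
  by (rule measurable_compose[OF measurable_snd measurable_component_singleton])

lemma measurable_kernel_comp:
  assumes "case_prod f \<in> borel_measurable (M \<Otimes>\<^sub>M N)" "g \<in> measurable L M" "h \<in> measurable L N"
  shows "(\<lambda>z. f (g z) (h z)) \<in> borel_measurable L"
  using measurable_compose[OF measurable_Pair[OF assms(2,3)] assms(1)] by simp

text \<open>
  By Tonelli, the integral is the \<open>n\<close>-th power of the integral of \<open>\<phi>\<close>: the permutation is absorbed once
  the \<open>y\<close> variables are integrated out.
\<close>

lemma integrable_prod_pairs:
  fixes \<phi> :: "'a \<Rightarrow> 'b \<Rightarrow> real"
  assumes M: "sigma_finite_measure M" and N: "sigma_finite_measure N"
    and int: "integrable (M \<Otimes>\<^sub>M N) (case_prod \<phi>)" and nn: "\<And>x y. \<phi> x y \<ge> 0"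
    and \<rho>: "\<rho> permutes {..<n::nat}"
  shows "integrable (PiM {..<n} (\<lambda>_. M) \<Otimes>\<^sub>M PiM {..<n} (\<lambda>_. N))
     (\<lambda>(x, y). \<Prod>i<n. \<phi> (x (\<rho> i)) (y i))"
proof -
  interpret M: sigma_finite_measure M by fact
  interpret N: sigma_finite_measure N by fact
  interpret PM: product_sigma_finite "\<lambda>_. M" ..
  interpret PN: product_sigma_finite "\<lambda>_. N" ..
  let ?M = "PiM {..<n} (\<lambda>_. M)" and ?N = "PiM {..<n} (\<lambda>_. N)"
  interpret N': sigma_finite_measure ?N by (rule sigma_finite_PiM[OF N]) simp
  have [measurable]: "case_prod \<phi> \<in> borel_measurable (M \<Otimes>\<^sub>M N)" using int by simp
  have \<rho>': "\<rho> i < n" if "i < n" for i using permutes_in_image[OF \<rho>] that by auto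
  have m: "(\<lambda>z. \<phi> (fst z (\<rho> i)) (snd z i)) \<in> borel_measurable (?M \<Otimes>\<^sub>M ?N)" if "i < n" for i
    by (rule measurable_kernel_comp[where f=\<phi>])
      (use that \<rho>'[OF that] in \<open>auto intro!: measurable_fst_component measurable_snd_component\<close>)
  have m': "(\<lambda>z. \<Prod>i<n. \<phi> (fst z (\<rho> i)) (snd z i)) \<in> borel_measurable (?M \<Otimes>\<^sub>M ?N)"
    using m by (intro borel_measurable_prod) auto
  define h where "h x = (\<integral>\<^sup>+y. ennreal (\<phi> x y) \<partial>N)" for x
  have [measurable]: "h \<in> borel_measurable M" unfolding h_def by measurable
  have prod: "(\<integral>\<^sup>+y. (\<Prod>i<n. ennreal (\<phi> (x (\<rho> i)) (y i))) \<partial>?N) = (\<Prod>i<n. h (x i))"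
    if x: "x \<in> space ?M" for x
  proof -
    have "(\<lambda>y. ennreal (\<phi> (x (\<rho> i)) y)) \<in> borel_measurable N" if "i \<in> {..<n}" for i
    proof -
      have "x \<in> PiE {..<n} (\<lambda>_. space M)" using x by (simp add: space_PiM)
      then have "x (\<rho> i) \<in> space M" by (rule PiE_mem) (use \<rho>'[of i] that in simp)
      then show ?thesis by measurable
    qed
    from PN.product_nn_integral_prod[OF finite_lessThan this]
    have "(\<integral>\<^sup>+y. (\<Prod>i<n. ennreal (\<phi> (x (\<rho> i)) (y i))) \<partial>?N) = (\<Prod>i<n. h (x (\<rho> i)))"
      unfolding h_def .
    also have "\<dots> = (\<Prod>i<n. h (x i))"
      using prod.permute[OF \<rho>, where g="\<lambda>i. h (x i)"] by (simp only: o_def)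
    finally show ?thesis .
  qed
  have "(\<integral>\<^sup>+z. ennreal (\<Prod>i<n. \<phi> (fst z (\<rho> i)) (snd z i)) \<partial>(?M \<Otimes>\<^sub>M ?N)) =
      (\<integral>\<^sup>+x. \<integral>\<^sup>+y. ennreal (\<Prod>i<n. \<phi> (x (\<rho> i)) (y i)) \<partial>?N \<partial>?M)"
    using N'.nn_integral_fst[OF measurable_compose[OF m' measurable_ennreal]] by (simp only: fst_conv snd_conv)
  also have "\<dots> = (\<integral>\<^sup>+x. (\<Prod>i<n. h (x i)) \<partial>?M)"
    by (intro nn_integral_cong) (simp only: prod_ennreal[symmetric] nn prod)
  also have "\<dots> = (\<Prod>i<n. \<integral>\<^sup>+x. h x \<partial>M)"
    by (rule PM.product_nn_integral_prod[where f="\<lambda>_. h", OF finite_lessThan]) simp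
  also have "(\<integral>\<^sup>+x. h x \<partial>M) = (\<integral>\<^sup>+z. ennreal (case_prod \<phi> z) \<partial>(M \<Otimes>\<^sub>M N))"
    unfolding h_def using N.nn_integral_fst[of "\<lambda>z. ennreal (case_prod \<phi> z)" M] by simp
  also have "(\<Prod>i<n. (\<integral>\<^sup>+z. ennreal (case_prod \<phi> z) \<partial>(M \<Otimes>\<^sub>M N))) < \<infinity>"
  proof -
    have "(\<integral>\<^sup>+z. ennreal (case_prod \<phi> z) \<partial>(M \<Otimes>\<^sub>M N)) = (\<integral>\<^sup>+z. ennreal (norm (case_prod \<phi> z)) \<partial>(M \<Otimes>\<^sub>M N))"
      using nn by (intro nn_integral_cong) (auto simp: abs_of_nonneg)
    also have "\<dots> < \<infinity>" using int by (simp add: integrable_iff_bounded)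
    finally show ?thesis by (simp add: power_less_top_ennreal)
  qed
  finally have fin: "(\<integral>\<^sup>+z. ennreal (\<Prod>i<n. \<phi> (fst z (\<rho> i)) (snd z i)) \<partial>(?M \<Otimes>\<^sub>M ?N)) < \<infinity>" .
  have "integrable (?M \<Otimes>\<^sub>M ?N) (\<lambda>z. \<Prod>i<n. \<phi> (fst z (\<rho> i)) (snd z i))"
    by (rule integrableI_bounded[OF m']) (use fin nn in \<open>simp add: prod_nonneg abs_of_nonneg\<close>)
  then show ?thesis by (simp add: case_prod_unfold)
qed

lemma permutes_lessThan: "\<sigma> permutes {..<n::nat} \<Longrightarrow> i < n \<Longrightarrow> \<sigma> i < n"
  using permutes_in_image[of \<sigma> "{..<n}" i] by auto

lemma space_PiM_lessThan: "x \<in> space (PiM {..<n::nat} (\<lambda>_. M)) \<Longrightarrow> i < n \<Longrightarrow> x i \<in> space M"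
  by (auto simp: space_PiM)

text \<open>
  The exceptional set is a null set of points, not of pairs, so that the diagonal \<open>x = x'\<close> is covered;
  the entries of a minor on the diagonal are needed below.
\<close>

lemma AE_integrable_kernel_product:
  fixes M :: "'a measure" and N :: "'b measure"
    and \<Phi> :: "'a \<Rightarrow> 'b \<Rightarrow> complex" and \<Psi> :: "'b \<Rightarrow> 'a \<Rightarrow> complex"
  assumes M: "sigma_finite_measure M" and N: "sigma_finite_measure N"
    and m\<Phi>[measurable]: "case_prod \<Phi> \<in> borel_measurable (M \<Otimes>\<^sub>M N)"
    and m\<Psi>[measurable]: "case_prod \<Psi> \<in> borel_measurable (N \<Otimes>\<^sub>M M)"
    and i\<Phi>: "integrable (M \<Otimes>\<^sub>M N) (\<lambda>(x, y). (norm (\<Phi> x y))\<^sup>2)"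
    and i\<Psi>: "integrable (N \<Otimes>\<^sub>M M) (\<lambda>(y, x). (norm (\<Psi> y x))\<^sup>2)"
  obtains P where "AE x in M. P x"
    "\<And>x x'. P x \<Longrightarrow> P x' \<Longrightarrow> x \<in> space M \<Longrightarrow> x' \<in> space M \<Longrightarrow> integrable N (\<lambda>y. \<Phi> x y * \<Psi> y x')"
proof -
  interpret M: sigma_finite_measure M by fact
  interpret N: sigma_finite_measure N by fact
  interpret MN: pair_sigma_finite M N ..
  interpret NM: pair_sigma_finite N M ..
  let ?P = "\<lambda>x. integrable N (\<lambda>y. (norm (\<Phi> x y))\<^sup>2) \<and> integrable N (\<lambda>y. (norm (\<Psi> y x))\<^sup>2)"
  have 1: "AE x in M. integrable N (\<lambda>y. (norm (\<Phi> x y))\<^sup>2)"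
    using MN.AE_integrable_fst'[OF i\<Phi>] by simp
  have "integrable (M \<Otimes>\<^sub>M N) (\<lambda>(x, y). (norm (\<Psi> y x))\<^sup>2)"
    using NM.integrable_product_swap_iff[of "\<lambda>(y, x). (norm (\<Psi> y x))\<^sup>2"] i\<Psi> by simp
  from MN.AE_integrable_fst'[OF this]
  have 2: "AE x in M. integrable N (\<lambda>y. (norm (\<Psi> y x))\<^sup>2)" by simp
  show ?thesis
  proof (rule that[of ?P])
    show "AE x in M. ?P x" using 1 2 by eventually_elim auto
    fix x x' assume P: "?P x" "?P x'" and [simp]: "x \<in> space M" "x' \<in> space M"
    show "integrable N (\<lambda>y. \<Phi> x y * \<Psi> y x')"
    proof (rule Bochner_Integration.integrable_bound)
      show "integrable N (\<lambda>y. (norm (\<Phi> x y))\<^sup>2 + (norm (\<Psi> y x'))\<^sup>2)" using P by auto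
      show "AE y in N. norm (\<Phi> x y * \<Psi> y x') \<le> norm ((norm (\<Phi> x y))\<^sup>2 + (norm (\<Psi> y x'))\<^sup>2)"
      proof (intro AE_I2)
        fix y
        show "norm (\<Phi> x y * \<Psi> y x') \<le> norm ((norm (\<Phi> x y))\<^sup>2 + (norm (\<Psi> y x'))\<^sup>2)"
          using sum_squares_bound[of "norm (\<Phi> x y)" "norm (\<Psi> y x')"]
          by (simp add: norm_mult) (use mult_nonneg_nonneg[OF norm_ge_zero[of "\<Phi> x y"] norm_ge_zero[of "\<Psi> y x'"]] in linarith)
      qed
    qed measurable
  qed
qed

context
  fixes M :: "'a measure" and N :: "'b measure"
    and \<Phi> :: "'a \<Rightarrow> 'b \<Rightarrow> complex" and \<Psi> :: "'b \<Rightarrow> 'a \<Rightarrow> complex"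
  assumes M: "sigma_finite_measure M" and N: "sigma_finite_measure N"
    and m\<Phi>[measurable]: "case_prod \<Phi> \<in> borel_measurable (M \<Otimes>\<^sub>M N)"
    and m\<Psi>[measurable]: "case_prod \<Psi> \<in> borel_measurable (N \<Otimes>\<^sub>M M)"
    and i\<Phi>: "integrable (M \<Otimes>\<^sub>M N) (\<lambda>(x, y). (norm (\<Phi> x y))\<^sup>2)"
    and i\<Psi>: "integrable (N \<Otimes>\<^sub>M M) (\<lambda>(y, x). (norm (\<Psi> y x))\<^sup>2)"
begin

text \<open>
  Both sides are iterated integrals of
  \<open>\<Prod>i. \<Phi> (x i) (y i) * \<Psi> (y i) (x (\<sigma> i))\<close>.  Fubini applies because this product is bounded by
  the sum of the squares of the \<open>\<Phi>\<close> part and the \<open>\<Psi>\<close> part, and each of these squares is integrable.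
\<close>

lemma permutation_integral_swap:
  assumes \<sigma>: "\<sigma> permutes {..<n::nat}"
  shows "integrable (PiM {..<n} (\<lambda>_. M)) (\<lambda>x. \<Prod>i<n. \<integral>y. \<Phi> (x i) y * \<Psi> y (x (\<sigma> i)) \<partial>N)"
    and "(\<integral>x. (\<Prod>i<n. \<integral>y. \<Phi> (x i) y * \<Psi> y (x (\<sigma> i)) \<partial>N) \<partial>PiM {..<n} (\<lambda>_. M)) =
         (\<integral>y. (\<Prod>i<n. \<integral>x. \<Psi> (y i) x * \<Phi> x (y (\<sigma> i)) \<partial>M) \<partial>PiM {..<n} (\<lambda>_. N))"
proof -
  interpret M: sigma_finite_measure M by fact
  interpret N: sigma_finite_measure N by fact
  interpret MN: pair_sigma_finite M N ..
  interpret NM: pair_sigma_finite N M ..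
  interpret PM: product_sigma_finite "\<lambda>_. M" ..
  interpret PN: product_sigma_finite "\<lambda>_. N" ..
  let ?M = "PiM {..<n} (\<lambda>_. M)" and ?N = "PiM {..<n} (\<lambda>_. N)"
  interpret M': sigma_finite_measure ?M by (rule sigma_finite_PiM[OF M]) simp
  interpret N': sigma_finite_measure ?N by (rule sigma_finite_PiM[OF N]) simp
  interpret MN': pair_sigma_finite ?M ?N ..
  note \<sigma>' = permutes_lessThan[OF \<sigma>]
  define F where "F x y = (\<Prod>i<n. \<Phi> (x i) (y i) * \<Psi> (y i) (x (\<sigma> i)))" for x y
  have mF: "case_prod F \<in> borel_measurable (?M \<Otimes>\<^sub>M ?N)"
  proof -
    have "(\<lambda>z. \<Phi> (fst z i) (snd z i) * \<Psi> (snd z i) (fst z (\<sigma> i))) \<in> borel_measurable (?M \<Otimes>\<^sub>M ?N)"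
      if "i < n" for i
      by (intro borel_measurable_times measurable_kernel_comp[OF m\<Phi>] measurable_kernel_comp[OF m\<Psi>]
        measurable_fst_component measurable_snd_component) (use that \<sigma>'[OF that] in auto)
    then show ?thesis unfolding F_def case_prod_unfold by (intro borel_measurable_prod) auto
  qed
  have "integrable (M \<Otimes>\<^sub>M N) (\<lambda>(x, y). (norm (\<Psi> y x))\<^sup>2)"
    using NM.integrable_product_swap_iff[of "\<lambda>(y, x). (norm (\<Psi> y x))\<^sup>2"] i\<Psi> by simp
  from integrable_prod_pairs[OF M N this _ \<sigma>]
  have G2: "integrable (?M \<Otimes>\<^sub>M ?N) (\<lambda>(x, y). \<Prod>i<n. (norm (\<Psi> (y i) (x (\<sigma> i))))\<^sup>2)" by simp
  from integrable_prod_pairs[OF M N i\<Phi> _ permutes_id]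
  have G1: "integrable (?M \<Otimes>\<^sub>M ?N) (\<lambda>(x, y). \<Prod>i<n. (norm (\<Phi> (x i) (y i)))\<^sup>2)" by simp
  have iF: "integrable (?M \<Otimes>\<^sub>M ?N) (case_prod F)"
  proof (rule Bochner_Integration.integrable_bound[OF _ mF])
    show "integrable (?M \<Otimes>\<^sub>M ?N) (\<lambda>z. (case z of (x, y) \<Rightarrow> \<Prod>i<n. (norm (\<Phi> (x i) (y i)))\<^sup>2) +
        (case z of (x, y) \<Rightarrow> \<Prod>i<n. (norm (\<Psi> (y i) (x (\<sigma> i))))\<^sup>2))"
      by (rule Bochner_Integration.integrable_add[OF G1 G2])
    have "norm (F x y) \<le> (\<Prod>i<n. (norm (\<Phi> (x i) (y i)))\<^sup>2) + (\<Prod>i<n. (norm (\<Psi> (y i) (x (\<sigma> i))))\<^sup>2)" for x y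
    proof -
      let ?a = "\<Prod>i<n. norm (\<Phi> (x i) (y i))" and ?b = "\<Prod>i<n. norm (\<Psi> (y i) (x (\<sigma> i)))"
      have "?a \<ge> 0" "?b \<ge> 0" by (auto intro: prod_nonneg)
      then have "0 \<le> ?a * ?b" by (rule mult_nonneg_nonneg)
      then have "?a * ?b \<le> ?a\<^sup>2 + ?b\<^sup>2" using sum_squares_bound[of ?a ?b] by linarith
      then show ?thesis by (simp add: F_def prod_norm[symmetric] norm_mult prod.distrib prod_power_distrib)
    qed
    then show "AE z in ?M \<Otimes>\<^sub>M ?N. norm (case_prod F z) \<le>
       norm ((case z of (x, y) \<Rightarrow> \<Prod>i<n. (norm (\<Phi> (x i) (y i)))\<^sup>2) +
        (case z of (x, y) \<Rightarrow> \<Prod>i<n. (norm (\<Psi> (y i) (x (\<sigma> i))))\<^sup>2))"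
      by (intro AE_I2) (fastforce intro: order_trans[OF _ abs_ge_self])
  qed
  obtain P where P: "AE x in M. P x" "\<And>x x'. P x \<Longrightarrow> P x' \<Longrightarrow> x \<in> space M \<Longrightarrow> x' \<in> space M \<Longrightarrow>
      integrable N (\<lambda>y. \<Phi> x y * \<Psi> y x')"
    by (rule AE_integrable_kernel_product[OF M N m\<Phi> m\<Psi> i\<Phi> i\<Psi>]) blast
  obtain Q where Q: "AE y in N. Q y" "\<And>y y'. Q y \<Longrightarrow> Q y' \<Longrightarrow> y \<in> space N \<Longrightarrow> y' \<in> space N \<Longrightarrow>
      integrable M (\<lambda>x. \<Psi> y x * \<Phi> x y')"
    by (rule AE_integrable_kernel_product[OF N M m\<Psi> m\<Phi> i\<Psi> i\<Phi>]) blast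
  have AE1: "AE x in ?M. (\<integral>y. F x y \<partial>?N) = (\<Prod>i<n. \<integral>y. \<Phi> (x i) y * \<Psi> y (x (\<sigma> i)) \<partial>N)"
    using AE_PiM_lessThan[OF M P(1)] AE_space[of ?M]
  proof eventually_elim
    case (elim x)
    have *: "integrable N (\<lambda>y. \<Phi> (x i) y * \<Psi> y (x (\<sigma> i)))" if "i \<in> {..<n}" for i
    proof (rule P(2))
      show "P (x i)" "P (x (\<sigma> i))" using elim(1) \<sigma>' that by auto
      show "x i \<in> space M" "x (\<sigma> i) \<in> space M"
        using elim(2) \<sigma>' that by (simp_all add: space_PiM_lessThan)
    qed
    show ?case unfolding F_def
      by (rule PN.product_integral_prod[where f="\<lambda>i y. \<Phi> (x i) y * \<Psi> y (x (\<sigma> i))", OF finite_lessThan *])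
  qed
  have AE2: "AE y in ?N. (\<integral>x. F x y \<partial>?M) = (\<Prod>i<n. \<integral>x. \<Psi> (y i) x * \<Phi> x (y (\<sigma> i)) \<partial>M)"
    using AE_PiM_lessThan[OF N Q(1)] AE_space[of ?N]
  proof eventually_elim
    case (elim y)
    let ?\<tau> = "Hilbert_Choice.inv \<sigma>"
    have \<tau>: "?\<tau> permutes {..<n}" by (rule permutes_inv[OF \<sigma>])
    note \<tau>' = permutes_lessThan[OF \<tau>]
    \<comment> \<open>Before the integration over \<open>x\<close>, the factors are sorted by the index of \<open>x\<close>.\<close>
    have F: "F x y = (\<Prod>i<n. \<Psi> (y (?\<tau> i)) (x i) * \<Phi> (x i) (y i))" for x
    proof -
      have "(\<Prod>i<n. \<Psi> (y i) (x (\<sigma> i))) = (\<Prod>i<n. \<Psi> (y (?\<tau> i)) (x i))"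
        using prod.permute[OF \<sigma>, where g="\<lambda>i. \<Psi> (y (?\<tau> i)) (x i)"]
        by (simp only: o_def permutes_inverses[OF \<sigma>])
      then show ?thesis unfolding F_def prod.distrib by (simp only: mult.commute)
    qed
    have *: "integrable M (\<lambda>x. \<Psi> (y (?\<tau> i)) x * \<Phi> x (y i))" if "i \<in> {..<n}" for i
    proof (rule Q(2))
      show "Q (y i)" "Q (y (?\<tau> i))" using elim(1) \<tau>' that by auto
      show "y i \<in> space N" "y (?\<tau> i) \<in> space N"
        using elim(2) \<tau>' that by (simp_all add: space_PiM_lessThan)
    qed
    have e1: "(\<integral>x. F x y \<partial>?M) = (\<Prod>i<n. \<integral>x. \<Psi> (y (?\<tau> i)) x * \<Phi> x (y i) \<partial>M)"
      unfolding F by (rule PM.product_integral_prod[where f="\<lambda>i x. \<Psi> (y (?\<tau> i)) x * \<Phi> x (y i)", OF finite_lessThan *])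
    have e2: "(\<Prod>i<n. \<integral>x. \<Psi> (y (?\<tau> i)) x * \<Phi> x (y i) \<partial>M) =
        (\<Prod>i<n. \<integral>x. \<Psi> (y i) x * \<Phi> x (y (\<sigma> i)) \<partial>M)"
      using prod.permute[OF \<sigma>, where g="\<lambda>i. \<integral>x. \<Psi> (y (?\<tau> i)) x * \<Phi> x (y i) \<partial>M"]
      by (simp only: o_def permutes_inverses[OF \<sigma>])
    show ?case by (rule trans[OF e1 e2])
  qed
  have mK1: "(\<lambda>(x, x'). \<integral>y. \<Phi> x y * \<Psi> y x' \<partial>N) \<in> borel_measurable (M \<Otimes>\<^sub>M M)"
    by measurable
  have mK2: "(\<lambda>(y, y'). \<integral>x. \<Psi> y x * \<Phi> x y' \<partial>M) \<in> borel_measurable (N \<Otimes>\<^sub>M N)"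
    by measurable
  have m1: "(\<lambda>x. \<Prod>i<n. \<integral>y. \<Phi> (x i) y * \<Psi> y (x (\<sigma> i)) \<partial>N) \<in> borel_measurable ?M"
    by (intro borel_measurable_prod measurable_kernel_comp[OF mK1] measurable_component_singleton)
      (use \<sigma>' in auto)
  have m2: "(\<lambda>y. \<Prod>i<n. \<integral>x. \<Psi> (y i) x * \<Phi> x (y (\<sigma> i)) \<partial>M) \<in> borel_measurable ?N"
    by (intro borel_measurable_prod measurable_kernel_comp[OF mK2] measurable_component_singleton)
      (use \<sigma>' in auto)
  have i1: "integrable ?M (\<lambda>x. \<integral>y. F x y \<partial>?N)"
    using MN'.integrable_fst'[OF iF] by simp
  show "integrable ?M (\<lambda>x. \<Prod>i<n. \<integral>y. \<Phi> (x i) y * \<Psi> y (x (\<sigma> i)) \<partial>N)"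
    by (rule integrable_cong_AE_imp[OF i1 m1]) (use AE1 in \<open>eventually_elim, simp\<close>)
  have "(\<integral>x. (\<Prod>i<n. \<integral>y. \<Phi> (x i) y * \<Psi> y (x (\<sigma> i)) \<partial>N) \<partial>?M) = (\<integral>x. \<integral>y. F x y \<partial>?N \<partial>?M)"
    by (rule integral_cong_AE) (use m1 i1 AE1 in auto)
  also have "\<dots> = (\<integral>y. \<integral>x. F x y \<partial>?M \<partial>?N)"
    by (rule MN'.Fubini_integral[symmetric, OF iF])
  also have "\<dots> = (\<integral>y. (\<Prod>i<n. \<integral>x. \<Psi> (y i) x * \<Phi> x (y (\<sigma> i)) \<partial>M) \<partial>?N)"
    by (rule integral_cong_AE) (use m2 AE2 MN'.integrable_snd[OF iF] in auto)
  finally show "(\<integral>x. (\<Prod>i<n. \<integral>y. \<Phi> (x i) y * \<Psi> y (x (\<sigma> i)) \<partial>N) \<partial>?M) =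
    (\<integral>y. (\<Prod>i<n. \<integral>x. \<Psi> (y i) x * \<Phi> x (y (\<sigma> i)) \<partial>M) \<partial>?N)" .
qed

end

text \<open>
  The coefficientwise form of \<open>det (1 + z \<Phi> \<Psi>) = det (1 + z \<Psi> \<Phi>)\<close> for Hilbert-Schmidt kernels.
\<close>

theorem perm_det_integral_swap:
  fixes M :: "'a measure" and N :: "'b measure"
    and \<Phi> :: "'a \<Rightarrow> 'b \<Rightarrow> complex" and \<Psi> :: "'b \<Rightarrow> 'a \<Rightarrow> complex"
    and n :: nat
  assumes MN: "sigma_finite_measure M" "sigma_finite_measure N"
    "case_prod \<Phi> \<in> borel_measurable (M \<Otimes>\<^sub>M N)"
    "case_prod \<Psi> \<in> borel_measurable (N \<Otimes>\<^sub>M M)"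
    "integrable (M \<Otimes>\<^sub>M N) (\<lambda>(x, y). (norm (\<Phi> x y))\<^sup>2)"
    "integrable (N \<Otimes>\<^sub>M M) (\<lambda>(y, x). (norm (\<Psi> y x))\<^sup>2)"
  shows "integrable (PiM {..<n} (\<lambda>_. M)) (\<lambda>x. perm_det {..<n} (\<lambda>i j. \<integral>y. \<Phi> (x i) y * \<Psi> y (x j) \<partial>N))"
    and "(\<integral>x. perm_det {..<n} (\<lambda>i j. \<integral>y. \<Phi> (x i) y * \<Psi> y (x j) \<partial>N) \<partial>PiM {..<n} (\<lambda>_. M)) =
         (\<integral>y. perm_det {..<n} (\<lambda>i j. \<integral>x. \<Psi> (y i) x * \<Phi> x (y j) \<partial>M) \<partial>PiM {..<n} (\<lambda>_. N))"
proof -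
  note a = permutation_integral_swap[OF MN]
  note b = permutation_integral_swap(1)[OF MN(2,1,4,3,6,5)]
  show "integrable (PiM {..<n} (\<lambda>_. M)) (\<lambda>x. perm_det {..<n} (\<lambda>i j. \<integral>y. \<Phi> (x i) y * \<Psi> y (x j) \<partial>N))"
    unfolding perm_det_def by (auto intro!: Bochner_Integration.integrable_sum a(1))
  show "(\<integral>x. perm_det {..<n} (\<lambda>i j. \<integral>y. \<Phi> (x i) y * \<Psi> y (x j) \<partial>N) \<partial>PiM {..<n} (\<lambda>_. M)) =
         (\<integral>y. perm_det {..<n} (\<lambda>i j. \<integral>x. \<Psi> (y i) x * \<Phi> x (y j) \<partial>M) \<partial>PiM {..<n} (\<lambda>_. N))"
    unfolding perm_det_def
    by (subst (1 2) Bochner_Integration.integral_sum) (auto simp: a(2) intro!: sum.cong a(1) b)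
qed

section \<open>Orthonormal bases of square integrable functions\<close>

lemma borel_measurable_cnj [measurable]:
  assumes [measurable]: "f \<in> borel_measurable M"
  shows "(\<lambda>z. cnj (f z)) \<in> borel_measurable M"
  using measurable_compose[OF assms borel_measurable_continuous_onI[of cnj]]
  by (simp add: continuous_on_cnj)

lemma L2_D: "f \<in> L2 M \<Longrightarrow> f \<in> borel_measurable M" "f \<in> L2 M \<Longrightarrow> integrable M (\<lambda>z. (norm (f z))\<^sup>2)"
  by (auto simp: L2_def)

lemma L2_I: "f \<in> borel_measurable M \<Longrightarrow> integrable M (\<lambda>z. (norm (f z))\<^sup>2) \<Longrightarrow> f \<in> L2 M"
  by (auto simp: L2_def)

lemma L2_integrable_norm_mult:
  assumes "f \<in> L2 M" "g \<in> L2 M"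
  shows "integrable M (\<lambda>z. norm (f z) * norm (g z))"
proof (rule Bochner_Integration.integrable_bound)
  show "integrable M (\<lambda>z. (norm (f z))\<^sup>2 + (norm (g z))\<^sup>2)"
    using assms by (intro Bochner_Integration.integrable_add L2_D)
  show "(\<lambda>z. norm (f z) * norm (g z)) \<in> borel_measurable M"
    using L2_D(1)[OF assms(1)] L2_D(1)[OF assms(2)] by measurable
  have "norm (f z) * norm (g z) \<le> (norm (f z))\<^sup>2 + (norm (g z))\<^sup>2" for z
    using sum_squares_bound[of "norm (f z)" "norm (g z)"] mult_nonneg_nonneg[OF norm_ge_zero[of "f z"] norm_ge_zero[of "g z"]]
    by linarith
  then show "AE z in M. norm (norm (f z) * norm (g z)) \<le> norm ((norm (f z))\<^sup>2 + (norm (g z))\<^sup>2)"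
    by simp
qed

lemma L2_integrable_mult:
  assumes "f \<in> L2 M" "g \<in> L2 M"
  shows "integrable M (\<lambda>z. f z * g z)" "integrable M (\<lambda>z. cnj (f z) * g z)"
proof -
  have m: "f \<in> borel_measurable M" "g \<in> borel_measurable M" using assms L2_D(1) by auto
  show "integrable M (\<lambda>z. f z * g z)"
    by (rule Bochner_Integration.integrable_bound[OF L2_integrable_norm_mult[OF assms]])
      (use m in \<open>auto simp: norm_mult\<close>)
  show "integrable M (\<lambda>z. cnj (f z) * g z)"
    by (rule Bochner_Integration.integrable_bound[OF L2_integrable_norm_mult[OF assms]])
      (use m in \<open>auto simp: norm_mult\<close>)
qed

lemma L2_scale: "f \<in> L2 M \<Longrightarrow> (\<lambda>z. c * f z) \<in> L2 M"
  by (auto simp: L2_def norm_mult power_mult_distrib)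

lemma L2_zero: "(\<lambda>z. 0) \<in> L2 M"
  by (auto simp: L2_def)

lemma L2_add:
  assumes "f \<in> L2 M" "g \<in> L2 M"
  shows "(\<lambda>z. f z + g z) \<in> L2 M"
proof (rule L2_I)
  have m: "f \<in> borel_measurable M" "g \<in> borel_measurable M" using assms L2_D(1) by auto
  then show "(\<lambda>z. f z + g z) \<in> borel_measurable M" by measurable
  show "integrable M (\<lambda>z. (norm (f z + g z))\<^sup>2)"
  proof (rule Bochner_Integration.integrable_bound)
    show "integrable M (\<lambda>z. 2 * (norm (f z))\<^sup>2 + 2 * (norm (g z))\<^sup>2)"
      using assms by (intro Bochner_Integration.integrable_add integrable_mult_right L2_D)
    show "(\<lambda>z. (norm (f z + g z))\<^sup>2) \<in> borel_measurable M" using m by measurable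
    have "(norm (f z + g z))\<^sup>2 \<le> 2 * (norm (f z))\<^sup>2 + 2 * (norm (g z))\<^sup>2" for z
    proof -
      have "(norm (f z + g z))\<^sup>2 \<le> (norm (f z) + norm (g z))\<^sup>2"
        by (intro power_mono norm_triangle_ineq norm_ge_zero)
      also have "\<dots> \<le> 2 * (norm (f z))\<^sup>2 + 2 * (norm (g z))\<^sup>2"
        using sum_squares_bound[of "norm (f z)" "norm (g z)"] by (simp add: power2_sum)
      finally show ?thesis .
    qed
    then show "AE z in M. norm ((norm (f z + g z))\<^sup>2) \<le> norm (2 * (norm (f z))\<^sup>2 + 2 * (norm (g z))\<^sup>2)"
      by simp
  qed
qed

lemma L2_diff:
  assumes "f \<in> L2 M" "g \<in> L2 M"
  shows "(\<lambda>z. f z - g z) \<in> L2 M"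
  using L2_add[OF assms(1) L2_scale[OF assms(2), of "-1"]] by simp

lemma L2_sum: "(\<And>i. i \<in> I \<Longrightarrow> f i \<in> L2 M) \<Longrightarrow> (\<lambda>z. \<Sum>i\<in>I. f i z) \<in> L2 M"
  by (induction I rule: infinite_finite_induct) (auto intro: L2_zero L2_add)

lemma L2_restrict:
  assumes "f \<in> L2 M" "S \<in> sets M"
  shows "(\<lambda>z. indicator S z * f z) \<in> L2 M"
proof (rule L2_I)
  have m: "f \<in> borel_measurable M" using assms L2_D(1) by auto
  show "(\<lambda>z. indicator S z * f z) \<in> borel_measurable M" using m assms(2) by measurable
  show "integrable M (\<lambda>z. (norm (indicator S z * f z))\<^sup>2)"
    by (rule Bochner_Integration.integrable_bound[OF L2_D(2)[OF assms(1)]])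
      (use m assms(2) in \<open>auto simp: indicator_def\<close>)
qed

lemma L2_inner_cnj: "cnj (L2_inner M f g) = L2_inner M g f"
  unfolding L2_inner_def by (subst Bochner_Integration.integral_cnj[symmetric]) (simp add: mult.commute)

lemma L2_inner_scale: "L2_inner M f (\<lambda>z. c * g z) = c * L2_inner M f g"
  unfolding L2_inner_def by (subst integral_mult_right_zero[symmetric]) (simp add: mult_ac)

lemma L2_inner_add:
  assumes "f \<in> L2 M" "g \<in> L2 M" "h \<in> L2 M"
  shows "L2_inner M f (\<lambda>z. g z + h z) = L2_inner M f g + L2_inner M f h"
  unfolding L2_inner_def distrib_left
  by (intro Bochner_Integration.integral_add L2_integrable_mult assms)

lemma L2_inner_diff:
  assumes "f \<in> L2 M" "g \<in> L2 M" "h \<in> L2 M"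
  shows "L2_inner M f (\<lambda>z. g z - h z) = L2_inner M f g - L2_inner M f h"
  unfolding L2_inner_def right_diff_distrib
  by (intro Bochner_Integration.integral_diff L2_integrable_mult assms)

lemma L2_inner_zero: "L2_inner M f (\<lambda>z. 0) = 0"
  by (simp add: L2_inner_def)

lemma L2_inner_sum:
  assumes "f \<in> L2 M" "\<And>i. i \<in> I \<Longrightarrow> g i \<in> L2 M"
  shows "L2_inner M f (\<lambda>z. \<Sum>i\<in>I. c i * g i z) = (\<Sum>i\<in>I. c i * L2_inner M f (g i))"
  using assms(2)
proof (induction I rule: infinite_finite_induct)
  case (insert i I)
  then have "L2_inner M f (\<lambda>z. c i * g i z + (\<Sum>i\<in>I. c i * g i z)) =
      L2_inner M f (\<lambda>z. c i * g i z) + L2_inner M f (\<lambda>z. \<Sum>i\<in>I. c i * g i z)"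
    by (intro L2_inner_add assms(1) L2_scale L2_sum) auto
  with insert show ?case by (simp add: L2_inner_scale)
qed (simp_all add: L2_inner_zero)

lemma L2_norm_nonneg: "L2_norm M f \<ge> 0"
  by (simp add: L2_norm_def)

lemma L2_norm_power2: "(L2_norm M f)\<^sup>2 = (\<integral>z. (norm (f z))\<^sup>2 \<partial>M)"
  by (simp add: L2_norm_def)

lemma L2_inner_self: "L2_inner M f f = of_real ((L2_norm M f)\<^sup>2)"
proof -
  have "L2_inner M f f = (\<integral>z. of_real ((norm (f z))\<^sup>2) \<partial>M)"
    unfolding L2_inner_def complex_norm_square by (simp only: mult.commute)
  also have "\<dots> = of_real (\<integral>z. (norm (f z))\<^sup>2 \<partial>M)" by (rule integral_complex_of_real)
  finally show ?thesis by (simp only: L2_norm_power2)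
qed

lemma L2_norm_mult_le:
  assumes "f \<in> L2 M" "g \<in> L2 M"
  shows "(\<integral>z. norm (f z) * norm (g z) \<partial>M) \<le> L2_norm M f * L2_norm M g"
proof -
  have m: "f \<in> borel_measurable M" "g \<in> borel_measurable M" using assms L2_D(1) by auto
  let ?I = "\<integral>z. norm (f z) * norm (g z) \<partial>M"
  have I0: "?I \<ge> 0" by simp
  have e1: "(\<integral>\<^sup>+z. ennreal (norm (f z)) * ennreal (norm (g z)) \<partial>M) = ennreal ?I"
    by (subst nn_integral_eq_integral[symmetric])
      (use L2_integrable_norm_mult[OF assms] in \<open>auto simp: ennreal_mult\<close>)
  have e2: "(\<integral>\<^sup>+z. (ennreal (norm (h z)))\<^sup>2 \<partial>M) = ennreal ((L2_norm M h)\<^sup>2)" if "h \<in> L2 M" for h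
    unfolding L2_norm_power2
    by (subst nn_integral_eq_integral[symmetric]) (use L2_D(2)[OF that] in \<open>auto simp: ennreal_power\<close>)
  have "(\<integral>\<^sup>+z. ennreal (norm (f z)) * ennreal (norm (g z)) \<partial>M)\<^sup>2 \<le>
      (\<integral>\<^sup>+z. (ennreal (norm (f z)))\<^sup>2 \<partial>M) * (\<integral>\<^sup>+z. (ennreal (norm (g z)))\<^sup>2 \<partial>M)"
    by (rule Cauchy_Schwarz_nn_integral) (use m in measurable)
  then have "ennreal (?I\<^sup>2) \<le> ennreal ((L2_norm M f * L2_norm M g)\<^sup>2)"
    unfolding e1 e2[OF assms(1)] e2[OF assms(2)] using I0
    by (simp add: ennreal_power ennreal_mult[symmetric] power_mult_distrib)
  then have "?I\<^sup>2 \<le> (L2_norm M f * L2_norm M g)\<^sup>2" by (simp add: ennreal_le_iff)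
  then show ?thesis by (rule power2_le_imp_le) (simp add: L2_norm_nonneg)
qed

lemma L2_Cauchy_Schwarz:
  assumes "f \<in> L2 M" "g \<in> L2 M"
  shows "norm (L2_inner M f g) \<le> L2_norm M f * L2_norm M g"
proof -
  have "norm (L2_inner M f g) \<le> (\<integral>z. norm (cnj (f z) * g z) \<partial>M)"
    unfolding L2_inner_def by (rule integral_norm_bound)
  also have "\<dots> = (\<integral>z. norm (f z) * norm (g z) \<partial>M)" by (simp add: norm_mult)
  also have "\<dots> \<le> L2_norm M f * L2_norm M g" by (rule L2_norm_mult_le[OF assms])
  finally show ?thesis .
qed

lemma L2_inner_cong_AE:
  assumes "f \<in> L2 M" "g \<in> L2 M" "h \<in> L2 M" "AE z in M. g z = h z"
  shows "L2_inner M f g = L2_inner M f h"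
proof -
  have m: "f \<in> borel_measurable M" "g \<in> borel_measurable M" "h \<in> borel_measurable M" using assms L2_D(1) by auto
  show ?thesis unfolding L2_inner_def
    by (rule integral_cong_AE) (use m assms(4) in auto)
qed

lemma L2_norm_zero_AE:
  assumes "f \<in> L2 M" "L2_norm M f = 0"
  shows "AE z in M. f z = 0"
proof -
  have "(\<integral>z. (norm (f z))\<^sup>2 \<partial>M) = 0" using assms(2) by (simp add: L2_norm_def)
  then have "AE z in M. (norm (f z))\<^sup>2 = 0"
    by (rule integral_nonneg_eq_0_iff_AE[OF L2_D(2)[OF assms(1)], THEN iffD1, rotated]) simp
  then show ?thesis by (simp only: power_eq_0_iff norm_eq_zero) simp
qed

lemma L2_inner_tendsto:
  assumes "h \<in> L2 M" "f \<in> L2 M" "\<And>n. g n \<in> L2 M"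
    "(\<lambda>n. L2_norm M (\<lambda>z. f z - g n z)) \<longlonglongrightarrow> 0"
  shows "(\<lambda>n. L2_inner M h (g n)) \<longlonglongrightarrow> L2_inner M h f"
proof -
  have "(\<lambda>n. L2_inner M h f - L2_inner M h (g n)) \<longlonglongrightarrow> 0"
  proof (rule Lim_null_comparison)
    have "norm (L2_inner M h f - L2_inner M h (g n)) \<le> L2_norm M h * L2_norm M (\<lambda>z. f z - g n z)" for n
      using L2_Cauchy_Schwarz[OF assms(1) L2_diff[OF assms(2) assms(3)[of n]]] L2_inner_diff[OF assms(1-2) assms(3)[of n]]
      by simp
    then show "\<forall>\<^sub>F n in sequentially. norm (L2_inner M h f - L2_inner M h (g n)) \<le>
        L2_norm M h * L2_norm M (\<lambda>z. f z - g n z)" by simp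
    show "(\<lambda>n. L2_norm M h * L2_norm M (\<lambda>z. f z - g n z)) \<longlonglongrightarrow> 0"
      using tendsto_mult_right_zero[OF assms(4)] .
  qed
  from tendsto_diff[OF tendsto_const[of "L2_inner M h f"] this] show ?thesis by simp
qed

text \<open>
  Riesz and Fischer: a sufficiently fast subsequence converges almost everywhere, and Fatou's lemma
  carries the Cauchy estimates over to its pointwise limit.
\<close>

theorem L2_complete:
  assumes S: "\<And>n. S n \<in> L2 M"
    and C: "\<And>\<epsilon>. \<epsilon> > 0 \<Longrightarrow> \<exists>N. \<forall>m\<ge>N. \<forall>n\<ge>N. (L2_norm M (\<lambda>z. S m z - S n z))\<^sup>2 < \<epsilon>"
  obtains g where "g \<in> L2 M" "(\<lambda>n. L2_norm M (\<lambda>z. S n z - g z)) \<longlonglongrightarrow> 0"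
proof -
  have mS: "S n \<in> borel_measurable M" for n using S L2_D(1) by auto
  have "\<exists>N. \<forall>m\<ge>N. \<forall>n\<ge>N. (L2_norm M (\<lambda>z. S m z - S n z))\<^sup>2 < (1/4) ^ k" for k :: nat
    by (rule C) simp
  then obtain N where N: "\<And>k m n. m \<ge> N k \<Longrightarrow> n \<ge> N k \<Longrightarrow> (L2_norm M (\<lambda>z. S m z - S n z))\<^sup>2 < (1/4) ^ k"
    by metis
  \<comment> \<open>A monotone sequence of indices above every \<open>N k\<close>.\<close>
  define r where "r k = (\<Sum>j\<le>k. N j)" for k
  have r: "N k \<le> r k" "r k \<le> r (Suc k)" for k
    unfolding r_def by (simp_all add: member_le_sum)
  have rmono: "r k \<le> r l" if "k \<le> l" for k l using lift_Suc_mono_le[of r, OF r(2) that] .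
  define \<Delta> where "\<Delta> k z = S (r (Suc k)) z - S (r k) z" for k z
  have \<Delta>2: "\<Delta> k \<in> L2 M" for k unfolding \<Delta>_def by (intro L2_diff S)
  have m\<Delta>: "\<Delta> k \<in> borel_measurable M" for k using \<Delta>2 L2_D(1) by auto
  have \<Delta>: "(\<integral>\<^sup>+z. ennreal (2 ^ k * (norm (\<Delta> k z))\<^sup>2) \<partial>M) \<le> ennreal ((1/2) ^ k)" for k
  proof -
    have "(\<integral>z. 2 ^ k * (norm (\<Delta> k z))\<^sup>2 \<partial>M) = 2 ^ k * (L2_norm M (\<Delta> k))\<^sup>2"
      by (simp add: L2_norm_power2)
    also have "\<dots> \<le> 2 ^ k * (1/4) ^ k"
      unfolding \<Delta>_def using N[of k "r (Suc k)" "r k"] r[of k] by (intro mult_left_mono) auto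
    also have "\<dots> = (1/2) ^ k" by (simp add: power_mult_distrib[symmetric])
    finally have "ennreal (\<integral>z. 2 ^ k * (norm (\<Delta> k z))\<^sup>2 \<partial>M) \<le> ennreal ((1/2) ^ k)" by (rule ennreal_leI)
    then show ?thesis
      by (subst nn_integral_eq_integral) (use L2_D(2)[OF \<Delta>2[of k]] in auto)
  qed
  have "(\<integral>\<^sup>+z. (\<Sum>k. ennreal (2 ^ k * (norm (\<Delta> k z))\<^sup>2)) \<partial>M) = (\<Sum>k. \<integral>\<^sup>+z. ennreal (2 ^ k * (norm (\<Delta> k z))\<^sup>2) \<partial>M)"
    by (rule nn_integral_suminf) (use m\<Delta> in measurable)
  also have "\<dots> \<le> (\<Sum>k. ennreal ((1/2) ^ k))" by (intro suminf_le \<Delta>) auto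
  also have "\<dots> = ennreal (\<Sum>k. (1/2) ^ k)" by (rule suminf_ennreal2) auto
  also have "\<dots> < \<infinity>" by simp
  finally have fin: "(\<integral>\<^sup>+z. (\<Sum>k. ennreal (2 ^ k * (norm (\<Delta> k z))\<^sup>2)) \<partial>M) < \<infinity>" .
  have "AE z in M. (\<Sum>k. ennreal (2 ^ k * (norm (\<Delta> k z))\<^sup>2)) \<noteq> \<infinity>"
  proof (rule nn_integral_PInf_AE)
    show "(\<lambda>z. \<Sum>k. ennreal (2 ^ k * (norm (\<Delta> k z))\<^sup>2)) \<in> borel_measurable M" using m\<Delta> by measurable
    show "(\<integral>\<^sup>+z. (\<Sum>k. ennreal (2 ^ k * (norm (\<Delta> k z))\<^sup>2)) \<partial>M) \<noteq> \<infinity>" using fin by (rule less_imp_neq)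
  qed
  then have conv: "AE z in M. convergent (\<lambda>k. S (r k) z)"
  proof eventually_elim
    case (elim z)
    then have s: "summable (\<lambda>k. 2 ^ k * (norm (\<Delta> k z))\<^sup>2)"
      by (intro summable_suminf_not_top) auto
    \<comment> \<open>Either the increment is at most \<open>(1/2)\<^sup>k\<close>, or \<open>1 \<le> 2\<^sup>k |\<Delta>|\<close> and the square dominates.\<close>
    have "norm (\<Delta> k z) \<le> (1/2) ^ k + 2 ^ k * (norm (\<Delta> k z))\<^sup>2" for k
    proof (cases "norm (\<Delta> k z) \<le> (1/2) ^ k")
      case False
      have "(1::real) = 2 ^ k * (1/2) ^ k" by (simp add: power_mult_distrib[symmetric])
      also have "\<dots> \<le> 2 ^ k * norm (\<Delta> k z)" using False by (intro mult_left_mono) simp_all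
      finally have "1 \<le> 2 ^ k * norm (\<Delta> k z)" .
      then have "norm (\<Delta> k z) * 1 \<le> norm (\<Delta> k z) * (2 ^ k * norm (\<Delta> k z))" by (intro mult_left_mono) auto
      then have "norm (\<Delta> k z) \<le> 2 ^ k * (norm (\<Delta> k z))\<^sup>2" by (simp add: power2_eq_square mult_ac)
      moreover have "(0::real) \<le> (1/2) ^ k" by simp
      ultimately show ?thesis by linarith
    next
      case True
      have "0 \<le> 2 ^ k * (norm (\<Delta> k z))\<^sup>2" by simp
      with True show ?thesis by linarith
    qed
    then have "summable (\<lambda>k. \<Delta> k z)"
      by (intro summable_comparison_test'[OF summable_add[OF summable_geometric[of "1/2 :: real"] s]]) simp_all
    then have "convergent (\<lambda>n. \<Sum>k<n. \<Delta> k z)" by (simp add: summable_iff_convergent)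
    moreover have "(\<Sum>k<n. \<Delta> k z) = S (r n) z - S (r 0) z" for n
      unfolding \<Delta>_def by (rule sum_lessThan_telescope[of "\<lambda>k. S (r k) z"])
    ultimately have "convergent (\<lambda>n. S (r n) z - S (r 0) z)" by (simp only:)
    from convergent_add[OF this convergent_const[of "S (r 0) z"]] show ?case
      by (simp only: diff_add_cancel)
  qed
  define g where "g z = lim (\<lambda>k. S (r k) z)" for z
  have mg: "g \<in> borel_measurable M"
    unfolding g_def by (rule borel_measurable_lim_metric) (rule mS)
  have est: "(\<lambda>z. S n z - g z) \<in> L2 M" "(L2_norm M (\<lambda>z. S n z - g z))\<^sup>2 \<le> (1/4) ^ k" if n: "n \<ge> N k" for n k
  proof -
    have "AE z in M. ennreal ((norm (S n z - g z))\<^sup>2) = liminf (\<lambda>l. ennreal ((norm (S n z - S (r l) z))\<^sup>2))"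
      using conv
    proof eventually_elim
      case (elim z)
      then have "(\<lambda>l. S (r l) z) \<longlonglongrightarrow> g z" unfolding g_def by (simp add: convergent_LIMSEQ_iff)
      then have "(\<lambda>l. ennreal ((norm (S n z - S (r l) z))\<^sup>2)) \<longlonglongrightarrow> ennreal ((norm (S n z - g z))\<^sup>2)"
        by (intro tendsto_intros tendsto_ennrealI)
      then show ?case by (rule lim_imp_Liminf[symmetric, OF trivial_limit_sequentially])
    qed
    then have "(\<integral>\<^sup>+z. ennreal ((norm (S n z - g z))\<^sup>2) \<partial>M) =
        (\<integral>\<^sup>+z. liminf (\<lambda>l. ennreal ((norm (S n z - S (r l) z))\<^sup>2)) \<partial>M)"
      by (rule nn_integral_cong_AE)
    also have "\<dots> \<le> liminf (\<lambda>l. \<integral>\<^sup>+z. ennreal ((norm (S n z - S (r l) z))\<^sup>2) \<partial>M)"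
      by (rule nn_integral_liminf) (use mS in measurable)
    also have "\<dots> \<le> ennreal ((1/4) ^ k)"
    proof -
      have "eventually (\<lambda>l. (\<integral>\<^sup>+z. ennreal ((norm (S n z - S (r l) z))\<^sup>2) \<partial>M) \<le> ennreal ((1/4) ^ k)) sequentially"
        using eventually_ge_at_top[of k]
      proof eventually_elim
        case (elim l)
        have "N k \<le> r l" using rmono[OF elim] r(1)[of k] by linarith
        then have "(L2_norm M (\<lambda>z. S n z - S (r l) z))\<^sup>2 \<le> (1/4) ^ k" using N[OF n] by (simp add: less_imp_le)
        moreover have "(\<integral>\<^sup>+z. ennreal ((norm (S n z - S (r l) z))\<^sup>2) \<partial>M) = ennreal ((L2_norm M (\<lambda>z. S n z - S (r l) z))\<^sup>2)"
          unfolding L2_norm_power2 by (rule nn_integral_eq_integral) (simp_all add: L2_D(2)[OF L2_diff[OF S[of n] S[of "r l"]]])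
        ultimately show ?case by (simp add: ennreal_leI)
      qed
      then have "liminf (\<lambda>l. \<integral>\<^sup>+z. ennreal ((norm (S n z - S (r l) z))\<^sup>2) \<partial>M) \<le> liminf (\<lambda>l. ennreal ((1/4) ^ k))"
        by (rule Liminf_mono)
      then show "liminf (\<lambda>l. \<integral>\<^sup>+z. ennreal ((norm (S n z - S (r l) z))\<^sup>2) \<partial>M) \<le> ennreal ((1/4) ^ k)"
        by (simp add: Liminf_const)
    qed
    finally have le: "(\<integral>\<^sup>+z. ennreal ((norm (S n z - g z))\<^sup>2) \<partial>M) \<le> ennreal ((1/4) ^ k)" .
    have int: "integrable M (\<lambda>z. (norm (S n z - g z))\<^sup>2)"
    proof (rule integrableI_bounded)
      show "(\<lambda>z. (norm (S n z - g z))\<^sup>2) \<in> borel_measurable M" using mS mg by measurable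
      show "(\<integral>\<^sup>+z. ennreal (norm ((norm (S n z - g z))\<^sup>2)) \<partial>M) < \<infinity>"
        using order_le_less_trans[OF le ennreal_less_top] by (simp only: real_norm_def abs_power2 infinity_ennreal_def)
    qed
    then show "(\<lambda>z. S n z - g z) \<in> L2 M" using mS mg by (intro L2_I) measurable
    have "ennreal ((L2_norm M (\<lambda>z. S n z - g z))\<^sup>2) \<le> ennreal ((1/4) ^ k)"
      using le unfolding L2_norm_power2 by (subst nn_integral_eq_integral[symmetric]) (use int in auto)
    then show "(L2_norm M (\<lambda>z. S n z - g z))\<^sup>2 \<le> (1/4) ^ k" by (simp add: ennreal_le_iff)
  qed
  have g2: "g \<in> L2 M" using L2_diff[OF S[of "N 0"] est(1)[of 0 "N 0"]] by simp
  have lim: "(\<lambda>n. L2_norm M (\<lambda>z. S n z - g z)) \<longlonglongrightarrow> 0"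
  proof (rule LIMSEQ_I)
    fix e :: real assume e: "e > 0"
    obtain k where k: "(1/4) ^ k < e\<^sup>2" by (rule exE[OF real_arch_pow_inv[of "e\<^sup>2" "1/4"]]) (use e in simp_all)
    have "norm (L2_norm M (\<lambda>z. S n z - g z) - 0) < e" if "n \<ge> N k" for n
    proof -
      have "(L2_norm M (\<lambda>z. S n z - g z))\<^sup>2 < e\<^sup>2" using est(2)[OF that] k by linarith
      then have "L2_norm M (\<lambda>z. S n z - g z) < e" by (rule power2_less_imp_less) (use e in simp)
      then show ?thesis by (simp add: L2_norm_nonneg)
    qed
    then show "\<exists>no. \<forall>n\<ge>no. norm (L2_norm M (\<lambda>z. S n z - g z) - 0) < e"
      by (intro exI[of _ "N k"] allI impI)
  qed
  show ?thesis by (rule that[OF g2 lim])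
qed

definition orthonormal :: "complex measure \<Rightarrow> (complex \<Rightarrow> complex) set \<Rightarrow> bool" where
  "orthonormal M E \<longleftrightarrow> E \<subseteq> L2 M \<and> (\<forall>e\<in>E. \<forall>e'\<in>E. L2_inner M e e' = of_bool (e = e'))"

lemma L2_onb_orthonormal: "L2_onb M E \<Longrightarrow> orthonormal M E"
  by (auto simp: L2_onb_def orthonormal_def)

lemma orthonormalD:
  assumes "orthonormal M E"
  shows "e \<in> E \<Longrightarrow> e \<in> L2 M" "e \<in> E \<Longrightarrow> e' \<in> E \<Longrightarrow> L2_inner M e e' = of_bool (e = e')"
  using assms by (auto simp: orthonormal_def)

lemma orthonormal_inner_sum:
  assumes E: "orthonormal M E" and F: "finite F" "F \<subseteq> E" and e: "e \<in> E"
  shows "L2_inner M e (\<lambda>z. \<Sum>e\<in>F. c e * e z) = (if e \<in> F then c e else 0)"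
proof -
  have "L2_inner M e (\<lambda>z. \<Sum>e\<in>F. c e * e z) = (\<Sum>e'\<in>F. c e' * L2_inner M e e')"
    using F e by (intro L2_inner_sum orthonormalD(1)[OF E]) blast+
  also have "\<dots> = (\<Sum>e'\<in>F. if e' = e then c e' else 0)"
    using F e by (intro sum.cong refl) (auto simp: orthonormalD(2)[OF E] subset_iff)
  also have "\<dots> = (if e \<in> F then c e else 0)" using F by simp
  finally show ?thesis .
qed

lemma orthonormal_norm_sum:
  assumes E: "orthonormal M E" and F: "finite F" "F \<subseteq> E"
  shows "(L2_norm M (\<lambda>z. \<Sum>e\<in>F. c e * e z))\<^sup>2 = (\<Sum>e\<in>F. (norm (c e))\<^sup>2)"
proof -
  let ?p = "\<lambda>z. \<Sum>e\<in>F. c e * e z"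
  have p: "?p \<in> L2 M" using F by (intro L2_sum L2_scale orthonormalD(1)[OF E]) blast
  have "L2_inner M ?p ?p = (\<Sum>e\<in>F. c e * L2_inner M ?p e)"
    using F by (intro L2_inner_sum p orthonormalD(1)[OF E]) blast
  also have "\<dots> = (\<Sum>e\<in>F. c e * cnj (c e))"
  proof (intro sum.cong refl)
    fix e assume "e \<in> F"
    with F have "L2_inner M e ?p = c e" by (subst orthonormal_inner_sum[OF E F]) auto
    then have "L2_inner M ?p e = cnj (c e)" using L2_inner_cnj[of M e ?p] by simp
    then show "c e * L2_inner M ?p e = c e * cnj (c e)" by simp
  qed
  also have "\<dots> = of_real (\<Sum>e\<in>F. (norm (c e))\<^sup>2)" by (simp only: complex_norm_square of_real_sum)
  finally show ?thesis unfolding L2_inner_self of_real_eq_iff .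
qed

theorem Bessel:
  assumes E: "orthonormal M E" and F: "finite F" "F \<subseteq> E" and f: "f \<in> L2 M"
  shows "(\<Sum>e\<in>F. (norm (L2_inner M e f))\<^sup>2) \<le> (L2_norm M f)\<^sup>2"
proof -
  let ?p = "\<lambda>z. \<Sum>e\<in>F. L2_inner M e f * e z" and ?s = "\<Sum>e\<in>F. (norm (L2_inner M e f))\<^sup>2"
  let ?d = "\<lambda>z. f z - ?p z"
  have p: "?p \<in> L2 M" using F by (intro L2_sum L2_scale orthonormalD(1)[OF E]) blast
  have d: "?d \<in> L2 M" by (rule L2_diff[OF f p])
  have fp: "L2_inner M f ?p = of_real ?s"
  proof -
    have "L2_inner M f ?p = (\<Sum>e\<in>F. L2_inner M e f * L2_inner M f e)"
      using F by (intro L2_inner_sum f orthonormalD(1)[OF E]) blast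
    also have "\<dots> = (\<Sum>e\<in>F. L2_inner M e f * cnj (L2_inner M e f))" by (simp only: L2_inner_cnj)
    finally show ?thesis by (simp only: complex_norm_square of_real_sum)
  qed
  have pf: "L2_inner M ?p f = of_real ?s"
    using L2_inner_cnj[of M f ?p] fp by (simp only: complex_cnj_complex_of_real)
  have pp: "L2_inner M ?p ?p = of_real ?s"
    by (simp only: L2_inner_self orthonormal_norm_sum[OF E F])
  have "L2_inner M f ?d = of_real ((L2_norm M f)\<^sup>2 - ?s)"
    by (simp only: L2_inner_diff[OF f f p] fp L2_inner_self of_real_diff)
  moreover have "L2_inner M ?p ?d = 0"
    by (simp only: L2_inner_diff[OF p f p] pf pp diff_self)
  moreover have "L2_inner M ?d ?d = cnj (L2_inner M f ?d) - cnj (L2_inner M ?p ?d)"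
    by (simp only: L2_inner_cnj L2_inner_diff[OF d f p])
  ultimately have "of_real ((L2_norm M ?d)\<^sup>2) = (of_real ((L2_norm M f)\<^sup>2 - ?s) :: complex)"
    by (simp only: L2_inner_self complex_cnj_complex_of_real complex_cnj_zero diff_zero)
  then have "(L2_norm M ?d)\<^sup>2 = (L2_norm M f)\<^sup>2 - ?s" by (simp only: of_real_eq_iff)
  then show ?thesis using zero_le_power2[of "L2_norm M ?d"] by linarith
qed

lemma Bessel_summable:
  assumes E: "orthonormal M E" and f: "f \<in> L2 M"
  shows "(\<lambda>e. (norm (L2_inner M e f))\<^sup>2) summable_on E"
    and "(\<Sum>\<^sub>\<infinity>e\<in>E. (norm (L2_inner M e f))\<^sup>2) \<le> (L2_norm M f)\<^sup>2"
proof -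
  show s: "(\<lambda>e. (norm (L2_inner M e f))\<^sup>2) summable_on E"
  proof (rule nonneg_bdd_above_summable_on)
    show "bdd_above (sum (\<lambda>e. (norm (L2_inner M e f))\<^sup>2) ` {F. F \<subseteq> E \<and> finite F})"
    proof (rule bdd_aboveI)
      fix x assume "x \<in> sum (\<lambda>e. (norm (L2_inner M e f))\<^sup>2) ` {F. F \<subseteq> E \<and> finite F}"
      then obtain F where F: "F \<subseteq> E" "finite F" "x = (\<Sum>e\<in>F. (norm (L2_inner M e f))\<^sup>2)" by blast
      show "x \<le> (L2_norm M f)\<^sup>2" unfolding F(3) by (rule Bessel[OF E F(2,1) f])
    qed
  qed simp
  show "(\<Sum>\<^sub>\<infinity>e\<in>E. (norm (L2_inner M e f))\<^sup>2) \<le> (L2_norm M f)\<^sup>2"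
    by (rule infsum_le_finite_sums[OF s]) (rule Bessel[OF E _ _ f])
qed

lemma L2_inner_support_countable:
  assumes E: "orthonormal M E" and f: "f \<in> L2 M"
  shows "countable {e\<in>E. L2_inner M e f \<noteq> 0}"
proof -
  have "(\<lambda>e. norm ((norm (L2_inner M e f))\<^sup>2)) summable_on E" using Bessel_summable(1)[OF assms] by simp
  from abs_summable_countable[OF this] show ?thesis by simp
qed

lemma has_sum_exhaustion:
  assumes "(f has_sum s) A" "\<And>n. finite (F n)" "\<And>n. F n \<subseteq> A" "\<And>m n. m \<le> n \<Longrightarrow> F m \<subseteq> F n"
    "A \<subseteq> (\<Union>n. F n)"
  shows "(\<lambda>n. sum f (F n)) \<longlonglongrightarrow> s"
proof -
  have "filterlim F (finite_subsets_at_top A) sequentially"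
    unfolding filterlim_finite_subsets_at_top
  proof (intro allI impI)
    fix X assume X: "finite X \<and> X \<subseteq> A"
    then have "finite X" "X \<subseteq> A" by auto
    then have "\<exists>N. X \<subseteq> F N"
    proof (induction X rule: finite_induct)
      case (insert x X)
      then obtain N where N: "X \<subseteq> F N" by blast
      from insert.prems assms(5) obtain n where n: "x \<in> F n" by blast
      have "insert x X \<subseteq> F (max N n)"
        using N n assms(4)[of N "max N n"] assms(4)[of n "max N n"] by auto
      then show ?case by blast
    qed simp
    then obtain N where N: "X \<subseteq> F N" by blast
    show "\<forall>\<^sub>F n in sequentially. finite (F n) \<and> X \<subseteq> F n \<and> F n \<subseteq> A"
      using eventually_ge_at_top[of N]
      by eventually_elim (use N assms(2-4) in blast)
  qed
  with assms(1) show ?thesis unfolding has_sum_def by (rule filterlim_compose)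
qed

text \<open>
  Only countably many coefficients of \<open>f\<close> are nonzero.  Along an enumeration of them, the partial
  sums of the expansion form a Cauchy sequence by Bessel's inequality; its limit has the same coefficients as
  \<open>f\<close>, hence equals \<open>f\<close> almost everywhere by maximality of the basis.
\<close>

theorem Parseval:
  assumes E: "L2_onb M E" and f: "f \<in> L2 M" and h: "h \<in> L2 M"
  shows "((\<lambda>e. L2_inner M h e * L2_inner M e f) has_sum L2_inner M h f) E"
proof -
  note oE = L2_onb_orthonormal[OF E]
  let ?c = "\<lambda>e. L2_inner M e f"
  define A where "A = {e\<in>E. ?c e \<noteq> 0}"
  have cA: "countable A" unfolding A_def by (rule L2_inner_support_countable[OF oE f])
  define F where "F n = {e\<in>A. to_nat_on A e < n}" for n
  have inj: "inj_on (to_nat_on A) A" by (rule inj_on_to_nat_on[OF cA])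
  have finF: "finite (F n)" for n
  proof (rule finite_imageD)
    show "finite (to_nat_on A ` F n)" by (rule finite_subset[of _ "{..<n}"]) (auto simp: F_def)
    show "inj_on (to_nat_on A) (F n)" by (rule inj_on_subset[OF inj]) (auto simp: F_def)
  qed
  have FA: "F n \<subseteq> A" and FE: "F n \<subseteq> E" for n by (auto simp: F_def A_def)
  have Fmono: "F m \<subseteq> F n" if "m \<le> n" for m n using that by (auto simp: F_def)
  have Fex: "A \<subseteq> (\<Union>n. F n)" by (auto simp: F_def)
  let ?S = "\<lambda>n z. \<Sum>e\<in>F n. ?c e * e z"
  have S: "?S n \<in> L2 M" for n
    by (intro L2_sum L2_scale orthonormalD(1)[OF oE]) (use FE in blast)
  let ?a = "\<lambda>n. \<Sum>e\<in>F n. (norm (?c e))\<^sup>2"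
  have "(\<lambda>e. (norm (?c e))\<^sup>2) summable_on A"
    by (rule summable_on_subset_banach[OF Bessel_summable(1)[OF oE f]]) (auto simp: A_def)
  then have "?a \<longlonglongrightarrow> (\<Sum>\<^sub>\<infinity>e\<in>A. (norm (?c e))\<^sup>2)"
    by (rule has_sum_exhaustion[OF has_sum_infsum finF FA Fmono Fex])
  then have Cauchy: "Cauchy ?a" by (rule LIMSEQ_imp_Cauchy)
  have diff: "(L2_norm M (\<lambda>z. ?S m z - ?S n z))\<^sup>2 = \<bar>?a m - ?a n\<bar>" for m n
  proof -
    have le: "(L2_norm M (\<lambda>z. ?S m z - ?S n z))\<^sup>2 = ?a m - ?a n" if "n \<le> m" for m n
    proof -
      have sub: "F n \<subseteq> F m" by (rule Fmono[OF that])
      have "(\<lambda>z. ?S m z - ?S n z) = (\<lambda>z. \<Sum>e\<in>F m - F n. ?c e * e z)"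
        by (intro ext) (simp only: sum_diff[OF finF sub])
      then have "(L2_norm M (\<lambda>z. ?S m z - ?S n z))\<^sup>2 = (\<Sum>e\<in>F m - F n. (norm (?c e))\<^sup>2)"
        by (simp only:) (rule orthonormal_norm_sum[OF oE finite_Diff[OF finF] subset_trans[OF Diff_subset FE]])
      then show ?thesis by (simp only: sum_diff[OF finF sub])
    qed
    have sym: "L2_norm M (\<lambda>z. ?S m z - ?S n z) = L2_norm M (\<lambda>z. ?S n z - ?S m z)"
      unfolding L2_norm_def by (simp only: norm_minus_commute)
    show ?thesis
    proof (cases "n \<le> m")
      case True
      then show ?thesis using le[OF True] zero_le_power2[of "L2_norm M (\<lambda>z. ?S m z - ?S n z)"] by linarith
    next
      case False
      then have "m \<le> n" by simp
      from le[OF this] show ?thesis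
        unfolding sym using zero_le_power2[of "L2_norm M (\<lambda>z. ?S n z - ?S m z)"] by linarith
    qed
  qed
  obtain g where g: "g \<in> L2 M" and lim: "(\<lambda>n. L2_norm M (\<lambda>z. ?S n z - g z)) \<longlonglongrightarrow> 0"
  proof (rule L2_complete[of ?S M])
    show "?S n \<in> L2 M" for n by (rule S)
    fix \<epsilon> :: real assume "\<epsilon> > 0"
    from CauchyD[OF Cauchy this] obtain N where "\<forall>m\<ge>N. \<forall>n\<ge>N. norm (?a m - ?a n) < \<epsilon>" by blast
    then show "\<exists>N. \<forall>m\<ge>N. \<forall>n\<ge>N. (L2_norm M (\<lambda>z. ?S m z - ?S n z))\<^sup>2 < \<epsilon>"
      unfolding diff real_norm_def by (rule exI)
  qed
  have "L2_norm M (\<lambda>z. g z - ?S n z) = L2_norm M (\<lambda>z. ?S n z - g z)" for n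
    unfolding L2_norm_def by (simp only: norm_minus_commute)
  with lim have lim': "(\<lambda>n. L2_norm M (\<lambda>z. g z - ?S n z)) \<longlonglongrightarrow> 0" by (simp only:)
  have perp: "\<forall>e\<in>E. L2_inner M e (\<lambda>z. f z - g z) = 0"
  proof
    fix e assume e: "e \<in> E"
    note e2 = orthonormalD(1)[OF oE e]
    have "(\<lambda>n. L2_inner M e (?S n)) \<longlonglongrightarrow> L2_inner M e g"
      by (rule L2_inner_tendsto[OF e2 g S lim'])
    moreover have "(\<lambda>n. L2_inner M e (?S n)) \<longlonglongrightarrow> ?c e"
    proof (cases "e \<in> A")
      case True
      have "eventually (\<lambda>n. L2_inner M e (?S n) = ?c e) sequentially"
        using eventually_gt_at_top[of "to_nat_on A e"]
      proof eventually_elim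
        case (elim n)
        then have "e \<in> F n" using True by (simp add: F_def)
        then show ?case by (simp add: orthonormal_inner_sum[OF oE finF FE e])
      qed
      then show ?thesis by (rule tendsto_eventually)
    next
      case False
      then have "e \<notin> F n" for n using FA by blast
      moreover have "?c e = 0" using False e by (simp add: A_def)
      ultimately show ?thesis by (simp add: orthonormal_inner_sum[OF oE finF FE e])
    qed
    ultimately have "L2_inner M e g = ?c e" by (rule LIMSEQ_unique)
    then show "L2_inner M e (\<lambda>z. f z - g z) = 0" by (simp add: L2_inner_diff[OF e2 f g])
  qed
  have max: "\<forall>f\<in>L2 M. (\<forall>e\<in>E. L2_inner M e f = 0) \<longrightarrow> (AE z in M. f z = 0)"
    using E unfolding L2_onb_def by (elim conjE)
  have "AE z in M. f z - g z = 0" by (rule max[rule_format, OF L2_diff[OF f g] perp[rule_format]])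
  then have fg: "AE z in M. g z = f z" by eventually_elim simp
  have "L2_inner M h g = L2_inner M h f" by (rule L2_inner_cong_AE[OF h g f fg])
  moreover have "(\<lambda>n. L2_inner M h (?S n)) \<longlonglongrightarrow> L2_inner M h g"
    by (rule L2_inner_tendsto[OF h g S lim'])
  moreover have "L2_inner M h (?S n) = (\<Sum>e\<in>F n. L2_inner M h e * ?c e)" for n
  proof -
    have "L2_inner M h (?S n) = (\<Sum>e\<in>F n. ?c e * L2_inner M h e)"
      by (rule L2_inner_sum[OF h]) (use FE orthonormalD(1)[OF oE] in blast)
    then show ?thesis by (simp only: mult.commute)
  qed
  ultimately have lim1: "(\<lambda>n. \<Sum>e\<in>F n. L2_inner M h e * ?c e) \<longlonglongrightarrow> L2_inner M h f" by simp
  have sumE: "(\<lambda>e. L2_inner M h e * ?c e) summable_on E"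
  proof (rule abs_summable_summable)
    have "(\<lambda>e. (norm (L2_inner M e h))\<^sup>2 + (norm (?c e))\<^sup>2) summable_on E"
      by (intro summable_on_add Bessel_summable(1)[OF oE] f h)
    then show "(\<lambda>e. norm (L2_inner M h e * ?c e)) summable_on E"
    proof (rule summable_on_comparison_test)
      fix e
      have eq: "norm (L2_inner M h e) = norm (L2_inner M e h)"
        by (metis L2_inner_cnj complex_mod_cnj)
      show "norm (L2_inner M h e * ?c e) \<le> (norm (L2_inner M e h))\<^sup>2 + (norm (?c e))\<^sup>2"
        using sum_squares_bound[of "norm (L2_inner M e h)" "norm (?c e)"]
          mult_nonneg_nonneg[OF norm_ge_zero[of "L2_inner M e h"] norm_ge_zero[of "?c e"]]
        unfolding norm_mult eq by linarith
    qed simp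
  qed
  have sumA: "(\<lambda>e. L2_inner M h e * ?c e) summable_on A"
    by (rule summable_on_subset_banach[OF sumE]) (auto simp: A_def)
  have "(\<lambda>n. \<Sum>e\<in>F n. L2_inner M h e * ?c e) \<longlonglongrightarrow> (\<Sum>\<^sub>\<infinity>e\<in>A. L2_inner M h e * ?c e)"
    by (rule has_sum_exhaustion[OF has_sum_infsum[OF sumA] finF FA Fmono Fex])
  with lim1 have "(\<Sum>\<^sub>\<infinity>e\<in>A. L2_inner M h e * ?c e) = L2_inner M h f" by (rule LIMSEQ_unique[rotated])
  moreover have "(\<Sum>\<^sub>\<infinity>e\<in>A. L2_inner M h e * ?c e) = (\<Sum>\<^sub>\<infinity>e\<in>E. L2_inner M h e * ?c e)"
    by (rule infsum_cong_neutral) (auto simp: A_def)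
  ultimately show ?thesis using has_sum_infsum[OF sumE] by simp
qed

text \<open>
  Zorn's lemma.  A basis is needed because the determinant is defined as the number to which the
  series converges in every basis; if there were none, it would be arbitrary.
\<close>

theorem L2_onb_exists: "\<exists>E. L2_onb M E"
proof -
  have "\<exists>E\<in>{E. orthonormal M E}. \<forall>X\<in>{E. orthonormal M E}. E \<subseteq> X \<longrightarrow> X = E"
  proof (rule subset_Zorn')
    fix C assume C: "subset.chain {E. orthonormal M E} C"
    show "\<Union>C \<in> {E. orthonormal M E}"
      unfolding mem_Collect_eq orthonormal_def
    proof (intro conjI ballI)
      show "\<Union>C \<subseteq> L2 M" using C by (auto simp: subset.chain_def orthonormal_def)
      fix e e' assume "e \<in> \<Union>C" "e' \<in> \<Union>C"
      then obtain X Y where XY: "X \<in> C" "Y \<in> C" "e \<in> X" "e' \<in> Y" by blast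
      then have "X \<subseteq> Y \<or> Y \<subseteq> X" using C by (auto simp: subset.chain_def)
      then obtain Z where "Z \<in> C" "e \<in> Z" "e' \<in> Z" using XY by blast
      moreover from \<open>Z \<in> C\<close> C have "orthonormal M Z" by (auto simp: subset.chain_def)
      ultimately show "L2_inner M e e' = of_bool (e = e')" by (intro orthonormalD(2))
    qed
  qed
  then obtain E where E: "orthonormal M E" and max: "\<And>X. orthonormal M X \<Longrightarrow> E \<subseteq> X \<Longrightarrow> X = E" by blast
  have "AE z in M. f z = 0" if f: "f \<in> L2 M" and perp: "\<forall>e\<in>E. L2_inner M e f = 0" for f
  proof (rule L2_norm_zero_AE[OF f], rule ccontr)
    assume n: "L2_norm M f \<noteq> 0"
    define h where "h z = of_real (1 / L2_norm M f) * f z" for z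
    have h2: "h \<in> L2 M" unfolding h_def by (rule L2_scale[OF f])
    have he: "L2_inner M e h = 0" if "e \<in> E" for e
      unfolding h_def using perp that by (simp only: L2_inner_scale mult_zero_right)
    have eh: "L2_inner M h e = 0" if "e \<in> E" for e
      using L2_inner_cnj[of M e h] he[OF that] by simp
    have fh: "L2_inner M h f = of_real (L2_norm M f)"
    proof -
      have "L2_inner M f h = of_real (L2_norm M f)"
        unfolding h_def L2_inner_scale using n by (simp add: L2_inner_self power2_eq_square)
      then show ?thesis using L2_inner_cnj[of M f h] by (simp only: complex_cnj_complex_of_real)
    qed
    have hh: "L2_inner M h h = 1"
    proof -
      have "L2_inner M h h = of_real (1 / L2_norm M f) * L2_inner M h f"
        using L2_inner_scale[of M h "of_real (1 / L2_norm M f)" f] by (simp only: h_def[symmetric])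
      then show ?thesis unfolding fh using n by (simp add: of_real_mult[symmetric])
    qed
    have "orthonormal M (insert h E)"
      unfolding orthonormal_def
    proof (intro conjI ballI)
      show "insert h E \<subseteq> L2 M" using h2 orthonormalD(1)[OF E] by blast
      fix a b assume ab: "a \<in> insert h E" "b \<in> insert h E"
      have "h \<notin> E" using eh[of h] hh by auto
      with ab consider "a = h" "b = h" | "a = h" "b \<in> E" "a \<noteq> b" | "a \<in> E" "b = h" "a \<noteq> b" | "a \<in> E" "b \<in> E"
        by blast
      then show "L2_inner M a b = of_bool (a = b)"
        by cases (simp_all add: hh he eh orthonormalD(2)[OF E])
    qed
    from max[OF this] have "h \<in> E" by blast
    from eh[OF this] hh show False by simp
  qed
  note AE0 = this
  have "L2_onb M E"
    unfolding L2_onb_def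
  proof (intro conjI ballI impI)
    show "E \<subseteq> L2 M" using E by (simp only: orthonormal_def)
    show "L2_inner M e e' = of_bool (e = e')" if "e \<in> E" "e' \<in> E" for e e'
      by (rule orthonormalD(2)[OF E that])
    show "AE z in M. f z = 0" if "f \<in> L2 M" "\<forall>e\<in>E. L2_inner M e f = 0" for f
      by (rule AE0[OF that])
  qed
  then show ?thesis by (rule exI)
qed

section \<open>Schmidt expansions and their kernels\<close>

text \<open>
  A Schmidt expansion over all natural numbers.  Norm bounds instead of orthonormality make it possible
  to fill the gaps of the index set with zero vectors.
\<close>

locale nuclear =
  fixes M :: "complex measure" and T :: "(complex \<Rightarrow> complex) \<Rightarrow> complex \<Rightarrow> complex"
    and s :: "nat \<Rightarrow> real" and \<phi> \<psi> :: "nat \<Rightarrow> complex \<Rightarrow> complex"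
  assumes s_nonneg: "s k \<ge> 0" and s_summable: "summable s"
    and \<phi>: "\<phi> k \<in> L2 M" and \<psi>: "\<psi> k \<in> L2 M"
    and \<phi>_norm: "L2_norm M (\<phi> k) \<le> 1" and \<psi>_norm: "L2_norm M (\<psi> k) \<le> 1"
    and T_L2: "f \<in> L2 M \<Longrightarrow> T f \<in> L2 M"
    and expansion: "f \<in> L2 M \<Longrightarrow>
      (\<lambda>N. L2_norm M (\<lambda>z. T f z - (\<Sum>k<N. of_real (s k) * L2_inner M (\<phi> k) f * \<psi> k z))) \<longlonglongrightarrow> 0"

lemma trace_class_nuclear:
  assumes "trace_class M T"
  obtains s \<phi> \<psi> where "nuclear M T s \<phi> \<psi>"
proof -
  from assms obtain I :: "nat set" and s \<phi> \<psi> where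
    pos: "\<forall>k\<in>I. s k > 0 \<and> \<phi> k \<in> L2 M \<and> \<psi> k \<in> L2 M" and
    on: "\<forall>j\<in>I. \<forall>k\<in>I. L2_inner M (\<phi> j) (\<phi> k) = of_bool (j = k) \<and>
                       L2_inner M (\<psi> j) (\<psi> k) = of_bool (j = k)" and
    sum: "s summable_on I" and
    ex: "\<forall>f\<in>L2 M. T f \<in> L2 M \<and> (\<lambda>N. L2_norm M (\<lambda>z. T f z -
                  (\<Sum>k\<in>I \<inter> {..<N}. of_real (s k) * L2_inner M (\<phi> k) f * \<psi> k z))) \<longlonglongrightarrow> 0"
    unfolding trace_class_def by (elim exE conjE) (rule that)
  note pos = pos[rule_format] and on = on[rule_format] and ex = ex[rule_format]
  have norm1: "L2_norm M g \<le> 1" if "L2_inner M g g = 1" for g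
  proof -
    have "(L2_norm M g)\<^sup>2 = 1" using that unfolding L2_inner_self of_real_eq_1_iff .
    then show ?thesis by (simp add: power2_eq_1_iff L2_norm_nonneg) (use L2_norm_nonneg[of M g] in linarith)
  qed
  define s' where "s' k = (if k \<in> I then s k else 0)" for k
  define \<phi>' where "\<phi>' k = (if k \<in> I then \<phi> k else (\<lambda>_. 0))" for k
  define \<psi>' where "\<psi>' k = (if k \<in> I then \<psi> k else (\<lambda>_. 0))" for k
  have 0: "L2_norm M (\<lambda>_. 0) \<le> 1" by (simp add: L2_norm_def)
  have "nuclear M T s' \<phi>' \<psi>'"
  proof
    show "s' k \<ge> 0" for k using pos[of k] by (simp add: s'_def less_imp_le)
    have "s' summable_on UNIV"
      using sum by (rule summable_on_cong_neutral[THEN iffD1, rotated 3]) (auto simp: s'_def)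
    then show "summable s'" by (rule summable_on_UNIV_nonneg_real_iff[THEN iffD1, rotated]) (use pos in \<open>auto simp: s'_def less_imp_le\<close>)
    show "\<phi>' k \<in> L2 M" "\<psi>' k \<in> L2 M" for k using pos[of k] L2_zero[of M] by (simp_all add: \<phi>'_def \<psi>'_def)
    show "L2_norm M (\<phi>' k) \<le> 1" "L2_norm M (\<psi>' k) \<le> 1" for k
      using norm1[of "\<phi> k"] norm1[of "\<psi> k"] on[of k k] 0 by (simp_all add: \<phi>'_def \<psi>'_def)
    show "T f \<in> L2 M" if "f \<in> L2 M" for f using ex[OF that] by simp
    fix f assume f: "f \<in> L2 M"
    have "(\<Sum>k\<in>I \<inter> {..<N}. of_real (s k) * L2_inner M (\<phi> k) f * \<psi> k z) =
        (\<Sum>k<N. of_real (s' k) * L2_inner M (\<phi>' k) f * \<psi>' k z)" for N z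
      by (rule sum.mono_neutral_cong_left) (auto simp: s'_def \<phi>'_def \<psi>'_def)
    then show "(\<lambda>N. L2_norm M (\<lambda>z. T f z - (\<Sum>k<N. of_real (s' k) * L2_inner M (\<phi>' k) f * \<psi>' k z))) \<longlonglongrightarrow> 0"
      using ex[OF f] by simp
  qed
  then show ?thesis by (rule that)
qed

context nuclear
begin

lemma m\<phi>[measurable]: "\<phi> k \<in> borel_measurable M" and m\<psi>[measurable]: "\<psi> k \<in> borel_measurable M"
  using \<phi> \<psi> L2_D(1) by auto

lemma inner_le: "f \<in> L2 M \<Longrightarrow> norm (L2_inner M (\<phi> k) f) \<le> L2_norm M f"
  "f \<in> L2 M \<Longrightarrow> norm (L2_inner M f (\<psi> k)) \<le> L2_norm M f"
proof -
  assume f: "f \<in> L2 M"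
  show "norm (L2_inner M (\<phi> k) f) \<le> L2_norm M f"
    using L2_Cauchy_Schwarz[OF \<phi> f, of k] mult_right_mono[OF \<phi>_norm[of k] L2_norm_nonneg[of M f]] by simp
  show "norm (L2_inner M f (\<psi> k)) \<le> L2_norm M f"
    using L2_Cauchy_Schwarz[OF f \<psi>, of k] mult_left_mono[OF \<psi>_norm[of k] L2_norm_nonneg[of M f]] by simp
qed

lemma inner_T_summable:
  assumes f: "f \<in> L2 M" and h: "h \<in> L2 M"
  shows "summable (\<lambda>k. norm (of_real (s k) * L2_inner M (\<phi> k) f * L2_inner M h (\<psi> k)))"
proof (rule summable_comparison_test'[OF summable_mult2[OF s_summable]])
  fix k
  have "norm (of_real (s k) * L2_inner M (\<phi> k) f * L2_inner M h (\<psi> k)) =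
      s k * (norm (L2_inner M (\<phi> k) f) * norm (L2_inner M h (\<psi> k)))"
    by (simp add: norm_mult s_nonneg)
  also have "\<dots> \<le> s k * (L2_norm M f * L2_norm M h)"
    by (intro mult_left_mono mult_mono inner_le f h s_nonneg L2_norm_nonneg norm_ge_zero)
  finally show "norm (norm (of_real (s k) * L2_inner M (\<phi> k) f * L2_inner M h (\<psi> k))) \<le> s k * (L2_norm M f * L2_norm M h)"
    by simp
qed

lemma partial_L2: "(\<lambda>z. \<Sum>k<N. of_real (s k) * L2_inner M (\<phi> k) f * \<psi> k z) \<in> L2 M"
  by (intro L2_sum L2_scale \<psi>)

lemma inner_T_sums:
  assumes f: "f \<in> L2 M" and h: "h \<in> L2 M"
  shows "(\<lambda>k. of_real (s k) * L2_inner M (\<phi> k) f * L2_inner M h (\<psi> k)) sums L2_inner M h (T f)"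
proof -
  have "(\<lambda>N. L2_inner M h (\<lambda>z. \<Sum>k<N. of_real (s k) * L2_inner M (\<phi> k) f * \<psi> k z)) \<longlonglongrightarrow> L2_inner M h (T f)"
    by (rule L2_inner_tendsto[OF h T_L2[OF f] partial_L2 expansion[OF f]])
  then show ?thesis unfolding sums_def by (simp add: L2_inner_sum[OF h \<psi>])
qed

text \<open>
  Monotone convergence: the integral is at most \<open>\<Sum>\<^sub>k s\<^sub>k\<close>.  The lemma is used for \<open>\<phi>\<close> and \<open>\<psi>\<close>; the points where the
  weights are finite are those where the Schmidt series can be evaluated.
\<close>

lemma weight_bound:
  assumes \<xi>: "\<And>k. \<xi> k \<in> L2 M" "\<And>k. L2_norm M (\<xi> k) \<le> 1"
  shows "(\<integral>\<^sup>+z. (\<Sum>k. ennreal (s k * (norm (\<xi> k z))\<^sup>2)) \<partial>M) < \<infinity>"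
    and "AE z in M. summable (\<lambda>k. s k * (norm (\<xi> k z))\<^sup>2)"
proof -
  have m: "\<xi> k \<in> borel_measurable M" for k using \<xi> L2_D(1) by auto
  have "(\<integral>\<^sup>+z. (\<Sum>k. ennreal (s k * (norm (\<xi> k z))\<^sup>2)) \<partial>M) = (\<Sum>k. \<integral>\<^sup>+z. ennreal (s k * (norm (\<xi> k z))\<^sup>2) \<partial>M)"
    by (rule nn_integral_suminf) (use m in measurable)
  also have "\<dots> \<le> (\<Sum>k. ennreal (s k))"
  proof (rule suminf_le)
    fix k
    have "(\<integral>\<^sup>+z. ennreal (s k * (norm (\<xi> k z))\<^sup>2) \<partial>M) = ennreal (\<integral>z. s k * (norm (\<xi> k z))\<^sup>2 \<partial>M)"
      by (rule nn_integral_eq_integral) (use L2_D(2)[OF \<xi>(1)[of k]] s_nonneg in simp_all)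
    also have "(\<integral>z. s k * (norm (\<xi> k z))\<^sup>2 \<partial>M) = s k * (L2_norm M (\<xi> k))\<^sup>2"
      by (simp add: L2_norm_power2)
    also have "\<dots> \<le> s k * 1"
      using \<xi>(2)[of k] by (intro mult_left_mono s_nonneg) (simp add: L2_norm_nonneg power_le_one)
    finally show "(\<integral>\<^sup>+z. ennreal (s k * (norm (\<xi> k z))\<^sup>2) \<partial>M) \<le> ennreal (s k)" by (simp add: ennreal_leI)
  qed auto
  also have "\<dots> = ennreal (suminf s)" by (rule suminf_ennreal2[OF s_nonneg s_summable])
  also have "\<dots> < \<infinity>" by simp
  finally show fin: "(\<integral>\<^sup>+z. (\<Sum>k. ennreal (s k * (norm (\<xi> k z))\<^sup>2)) \<partial>M) < \<infinity>" .
  have "AE z in M. (\<Sum>k. ennreal (s k * (norm (\<xi> k z))\<^sup>2)) \<noteq> \<infinity>"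
  proof (rule nn_integral_PInf_AE)
    show "(\<lambda>z. \<Sum>k. ennreal (s k * (norm (\<xi> k z))\<^sup>2)) \<in> borel_measurable M" using m by measurable
    show "(\<integral>\<^sup>+z. (\<Sum>k. ennreal (s k * (norm (\<xi> k z))\<^sup>2)) \<partial>M) \<noteq> \<infinity>" using fin by (rule less_imp_neq)
  qed
  then show "AE z in M. summable (\<lambda>k. s k * (norm (\<xi> k z))\<^sup>2)"
  proof eventually_elim
    case (elim z)
    show ?case by (rule summable_suminf_not_top) (use elim s_nonneg in simp_all)
  qed
qed

text \<open>
  The pointwise series converges where the weight of \<open>\<psi>\<close> is finite; by Fatou's lemma its value is
  the limit in the mean, which is \<open>T f\<close>.
\<close>

lemma T_pointwise:
  assumes f: "f \<in> L2 M"
  shows "AE z in M. (\<lambda>k. of_real (s k) * L2_inner M (\<phi> k) f * \<psi> k z) sums T f z"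
proof -
  let ?S = "\<lambda>N z. \<Sum>k<N. of_real (s k) * L2_inner M (\<phi> k) f * \<psi> k z"
  let ?L = "\<lambda>z. \<Sum>k. of_real (s k) * L2_inner M (\<phi> k) f * \<psi> k z"
  have conv: "AE z in M. (\<lambda>N. ?S N z) \<longlonglongrightarrow> ?L z"
    using weight_bound(2)[of \<psi>, OF \<psi> \<psi>_norm]
  proof eventually_elim
    case (elim z)
    have "summable (\<lambda>k. of_real (s k) * L2_inner M (\<phi> k) f * \<psi> k z)"
    proof (rule summable_comparison_test'[where g="\<lambda>k. s k * (L2_norm M f)\<^sup>2 + s k * (norm (\<psi> k z))\<^sup>2"])
      show "summable (\<lambda>k. s k * (L2_norm M f)\<^sup>2 + s k * (norm (\<psi> k z))\<^sup>2)"
        by (intro summable_add summable_mult2 s_summable elim)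
      fix k
      have "norm (L2_inner M (\<phi> k) f) * norm (\<psi> k z) \<le> L2_norm M f * norm (\<psi> k z)"
        by (intro mult_right_mono inner_le f norm_ge_zero)
      also have "\<dots> \<le> (L2_norm M f)\<^sup>2 + (norm (\<psi> k z))\<^sup>2"
        using sum_squares_bound[of "L2_norm M f" "norm (\<psi> k z)"]
          mult_nonneg_nonneg[OF L2_norm_nonneg[of M f] norm_ge_zero[of "\<psi> k z"]] by linarith
      finally have "s k * (norm (L2_inner M (\<phi> k) f) * norm (\<psi> k z)) \<le> s k * ((L2_norm M f)\<^sup>2 + (norm (\<psi> k z))\<^sup>2)"
        by (rule mult_left_mono[OF _ s_nonneg])
      then show "norm (of_real (s k) * L2_inner M (\<phi> k) f * \<psi> k z) \<le> s k * (L2_norm M f)\<^sup>2 + s k * (norm (\<psi> k z))\<^sup>2"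
        by (simp add: norm_mult s_nonneg mult.assoc distrib_left)
    qed
    then show ?case by (rule summable_LIMSEQ)
  qed
  have mT: "T f \<in> borel_measurable M" using T_L2[OF f] by (rule L2_D(1))
  have int: "(\<integral>\<^sup>+z. ennreal ((norm (T f z - ?S N z))\<^sup>2) \<partial>M) = ennreal ((L2_norm M (\<lambda>z. T f z - ?S N z))\<^sup>2)" for N
    unfolding L2_norm_power2
    by (rule nn_integral_eq_integral) (simp_all add: L2_D(2)[OF L2_diff[OF T_L2[OF f] partial_L2]])
  have lim0: "(\<lambda>N. \<integral>\<^sup>+z. ennreal ((norm (T f z - ?S N z))\<^sup>2) \<partial>M) \<longlonglongrightarrow> 0"
  proof -
    have "(\<lambda>N. (L2_norm M (\<lambda>z. T f z - ?S N z))\<^sup>2) \<longlonglongrightarrow> 0\<^sup>2" by (intro tendsto_power expansion f)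
    then have "(\<lambda>N. ennreal ((L2_norm M (\<lambda>z. T f z - ?S N z))\<^sup>2)) \<longlonglongrightarrow> ennreal (0\<^sup>2)" by (rule tendsto_ennrealI)
    then show ?thesis unfolding int by simp
  qed
  have "AE z in M. liminf (\<lambda>N. ennreal ((norm (T f z - ?S N z))\<^sup>2)) = ennreal ((norm (T f z - ?L z))\<^sup>2)"
    using conv
  proof eventually_elim
    case (elim z)
    have "(\<lambda>N. ennreal ((norm (T f z - ?S N z))\<^sup>2)) \<longlonglongrightarrow> ennreal ((norm (T f z - ?L z))\<^sup>2)"
      by (intro tendsto_ennrealI tendsto_power tendsto_norm tendsto_diff tendsto_const elim)
    then show ?case by (rule lim_imp_Liminf[OF trivial_limit_sequentially])
  qed
  then have "(\<integral>\<^sup>+z. ennreal ((norm (T f z - ?L z))\<^sup>2) \<partial>M) = (\<integral>\<^sup>+z. liminf (\<lambda>N. ennreal ((norm (T f z - ?S N z))\<^sup>2)) \<partial>M)"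
    by (rule nn_integral_cong_AE[OF AE_mp[OF _ AE_I2], OF _ impI[OF sym]])
  also have "\<dots> \<le> liminf (\<lambda>N. \<integral>\<^sup>+z. ennreal ((norm (T f z - ?S N z))\<^sup>2) \<partial>M)"
    by (rule nn_integral_liminf) (use mT in measurable)
  also have "\<dots> = 0" by (rule lim_imp_Liminf[OF trivial_limit_sequentially lim0])
  finally have "(\<integral>\<^sup>+z. ennreal ((norm (T f z - ?L z))\<^sup>2) \<partial>M) = 0" by simp
  then have "AE z in M. ennreal ((norm (T f z - ?L z))\<^sup>2) = 0"
    by (subst (asm) nn_integral_0_iff_AE) (use mT in measurable)
  then show ?thesis using conv
  proof eventually_elim
    case (elim z)
    from elim(1) have "T f z = ?L z" by simp
    with elim(2) show ?case unfolding sums_def by simp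
  qed
qed

text \<open>
  The kernel, with respect to the positive measure \<open>M\<close>, that the Schmidt expansion suggests for \<open>T\<close>.
\<close>

definition F :: "complex \<Rightarrow> complex \<Rightarrow> complex" where
  "F u v = (\<Sum>k. of_real (s k) * \<psi> k u * cnj (\<phi> k v))"

text \<open>
  Integration term by term, for a fixed point \<open>u\<close> outside a null set.
\<close>

lemma F_integral_if_summable:
  assumes u: "summable (\<lambda>k. s k * (norm (\<psi> k u))\<^sup>2)" and f: "f \<in> L2 M"
    and ae: "AE v in M. summable (\<lambda>k. norm (of_real (s k) * \<psi> k u * cnj (\<phi> k v) * f v))"
  shows "integrable M (\<lambda>v. F u v * f v)"
    and "(\<lambda>k. of_real (s k) * \<psi> k u * L2_inner M (\<phi> k) f) sums (\<integral>v. F u v * f v \<partial>M)"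
proof -
  let ?g = "\<lambda>k v. of_real (s k) * \<psi> k u * (cnj (\<phi> k v) * f v)"
  have gi: "integrable M (?g k)" for k by (intro integrable_mult_right L2_integrable_mult \<phi> f)
  have sm: "summable (\<lambda>k. s k + s k * (norm (\<psi> k u))\<^sup>2)" by (intro summable_add s_summable u)
  have le: "(\<integral>v. norm (?g k v) \<partial>M) \<le> (s k + s k * (norm (\<psi> k u))\<^sup>2) * L2_norm M f" for k
  proof -
    have "(\<integral>v. norm (?g k v) \<partial>M) = s k * norm (\<psi> k u) * (\<integral>v. norm (\<phi> k v) * norm (f v) \<partial>M)"
      by (simp add: norm_mult s_nonneg)
    also have "\<dots> \<le> s k * norm (\<psi> k u) * (1 * L2_norm M f)"
      using L2_norm_mult_le[OF \<phi> f, of k] mult_right_mono[OF \<phi>_norm[of k] L2_norm_nonneg[of M f]]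
      by (intro mult_left_mono mult_nonneg_nonneg s_nonneg norm_ge_zero) linarith
    also have "\<dots> \<le> (s k + s k * (norm (\<psi> k u))\<^sup>2) * L2_norm M f"
    proof -
      have "norm (\<psi> k u) \<le> 1 + (norm (\<psi> k u))\<^sup>2"
        using sum_squares_bound[of 1 "norm (\<psi> k u)"] norm_ge_zero[of "\<psi> k u"]
        unfolding mult_1_right power_one by linarith
      from mult_left_mono[OF this s_nonneg[of k]]
      have "s k * norm (\<psi> k u) \<le> s k + s k * (norm (\<psi> k u))\<^sup>2" by (simp add: distrib_left)
      from mult_right_mono[OF this L2_norm_nonneg[of M f]] show ?thesis by simp
    qed
    finally show ?thesis .
  qed
  have s2: "summable (\<lambda>k. \<integral>v. norm (?g k v) \<partial>M)"
    by (rule summable_comparison_test'[OF summable_mult2[OF sm, of "L2_norm M f"]]) (use le in simp)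
  have s1: "AE v in M. summable (\<lambda>k. norm (?g k v))"
    using ae by eventually_elim (simp only: mult.assoc)
  have eq: "AE v in M. (\<Sum>k. ?g k v) = F u v * f v"
    using s1
  proof eventually_elim
    case (elim v)
    show ?case
    proof (cases "f v = 0")
      case False
      have "summable (\<lambda>k. ?g k v * inverse (f v))" by (rule summable_mult2[OF summable_norm_cancel[OF elim]])
      then have "summable (\<lambda>k. of_real (s k) * \<psi> k u * cnj (\<phi> k v))" using False by (simp add: mult.assoc)
      from suminf_mult2[OF this, of "f v"] show ?thesis by (simp add: F_def mult.assoc)
    qed simp
  qed
  have "integrable M (\<lambda>v. \<Sum>k. ?g k v)" by (rule integrable_suminf[OF gi s1 s2])
  then show iF: "integrable M (\<lambda>v. F u v * f v)"
  proof (rule integrable_cong_AE_imp)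
    have "(\<lambda>v. F u v) \<in> borel_measurable M"
      unfolding F_def by (intro borel_measurable_suminf borel_measurable_times borel_measurable_cnj m\<phi> borel_measurable_const)
    then show "(\<lambda>v. F u v * f v) \<in> borel_measurable M" using L2_D(1)[OF f] by measurable
    show "AE v in M. (\<Sum>k. ?g k v) = F u v * f v" by (rule eq)
  qed
  have "(\<integral>v. F u v * f v \<partial>M) = (\<integral>v. (\<Sum>k. ?g k v) \<partial>M)"
  proof (rule integral_cong_AE)
    show "(\<lambda>v. F u v * f v) \<in> borel_measurable M" by (rule borel_measurable_integrable[OF iF])
    show "(\<lambda>v. \<Sum>k. ?g k v) \<in> borel_measurable M"
      by (rule borel_measurable_integrable[OF integrable_suminf[OF gi s1 s2]])
    show "AE v in M. F u v * f v = (\<Sum>k. ?g k v)" using eq by eventually_elim (rule sym)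
  qed
  moreover have "(\<lambda>k. \<integral>v. ?g k v \<partial>M) sums (\<integral>v. (\<Sum>k. ?g k v) \<partial>M)"
    by (rule sums_integral[OF gi s1 s2])
  ultimately show "(\<lambda>k. of_real (s k) * \<psi> k u * L2_inner M (\<phi> k) f) sums (\<integral>v. F u v * f v \<partial>M)"
    by (simp add: L2_inner_def)
qed

lemma F_bound:
  assumes u: "summable (\<lambda>k. s k * (norm (\<psi> k u))\<^sup>2)" and v: "summable (\<lambda>k. s k * (norm (\<phi> k v))\<^sup>2)"
  shows "summable (\<lambda>k. norm (of_real (s k) * \<psi> k u * cnj (\<phi> k v)))"
    and "(norm (F u v))\<^sup>2 \<le> (\<Sum>k. s k * (norm (\<psi> k u))\<^sup>2) * (\<Sum>k. s k * (norm (\<phi> k v))\<^sup>2)"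
proof -
  show sm: "summable (\<lambda>k. norm (of_real (s k) * \<psi> k u * cnj (\<phi> k v)))"
  proof (rule summable_comparison_test'[OF summable_add[OF u v]])
    fix k
    have "norm (\<psi> k u) * norm (\<phi> k v) \<le> (norm (\<psi> k u))\<^sup>2 + (norm (\<phi> k v))\<^sup>2"
      using sum_squares_bound[of "norm (\<psi> k u)" "norm (\<phi> k v)"]
        mult_nonneg_nonneg[OF norm_ge_zero[of "\<psi> k u"] norm_ge_zero[of "\<phi> k v"]] by linarith
    from mult_left_mono[OF this s_nonneg[of k]]
    show "norm (norm (of_real (s k) * \<psi> k u * cnj (\<phi> k v))) \<le> s k * (norm (\<psi> k u))\<^sup>2 + s k * (norm (\<phi> k v))\<^sup>2"
      by (simp add: norm_mult s_nonneg mult.assoc distrib_left)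
  qed
  have "(\<lambda>N. \<Sum>k<N. of_real (s k) * \<psi> k u * cnj (\<phi> k v)) \<longlonglongrightarrow> F u v"
    unfolding F_def by (rule summable_LIMSEQ[OF summable_norm_cancel[OF sm]])
  then have lim: "(\<lambda>N. (norm (\<Sum>k<N. of_real (s k) * \<psi> k u * cnj (\<phi> k v)))\<^sup>2) \<longlonglongrightarrow> (norm (F u v))\<^sup>2"
    by (intro tendsto_power tendsto_norm)
  have "(norm (\<Sum>k<N. of_real (s k) * \<psi> k u * cnj (\<phi> k v)))\<^sup>2 \<le>
      (\<Sum>k. s k * (norm (\<psi> k u))\<^sup>2) * (\<Sum>k. s k * (norm (\<phi> k v))\<^sup>2)" for N
  proof -
    have "norm (\<Sum>k<N. of_real (s k) * \<psi> k u * cnj (\<phi> k v)) \<le>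
        (\<Sum>k<N. (sqrt (s k) * norm (\<psi> k u)) * (sqrt (s k) * norm (\<phi> k v)))"
    proof (rule sum_norm_le)
      fix k
      have "norm (of_real (s k) * \<psi> k u * cnj (\<phi> k v)) = (sqrt (s k) * sqrt (s k)) * norm (\<psi> k u) * norm (\<phi> k v)"
        by (simp add: norm_mult s_nonneg)
      then show "norm (of_real (s k) * \<psi> k u * cnj (\<phi> k v)) \<le> (sqrt (s k) * norm (\<psi> k u)) * (sqrt (s k) * norm (\<phi> k v))"
        by (simp only: mult_ac order_refl)
    qed
    then have "(norm (\<Sum>k<N. of_real (s k) * \<psi> k u * cnj (\<phi> k v)))\<^sup>2 \<le>
        (\<Sum>k<N. (sqrt (s k) * norm (\<psi> k u)) * (sqrt (s k) * norm (\<phi> k v)))\<^sup>2"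
      by (rule power_mono) simp
    also have "\<dots> \<le> (\<Sum>k<N. (sqrt (s k) * norm (\<psi> k u))\<^sup>2) * (\<Sum>k<N. (sqrt (s k) * norm (\<phi> k v))\<^sup>2)"
      by (rule Cauchy_Schwarz_ineq_sum)
    also have "\<dots> = (\<Sum>k<N. s k * (norm (\<psi> k u))\<^sup>2) * (\<Sum>k<N. s k * (norm (\<phi> k v))\<^sup>2)"
      by (simp add: power_mult_distrib s_nonneg)
    also have "\<dots> \<le> (\<Sum>k. s k * (norm (\<psi> k u))\<^sup>2) * (\<Sum>k. s k * (norm (\<phi> k v))\<^sup>2)"
      by (intro mult_mono sum_le_suminf u v sum_nonneg suminf_nonneg) (simp_all add: s_nonneg)
    finally show ?thesis .
  qed
  then show "(norm (F u v))\<^sup>2 \<le> (\<Sum>k. s k * (norm (\<psi> k u))\<^sup>2) * (\<Sum>k. s k * (norm (\<phi> k v))\<^sup>2)"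
    by (intro LIMSEQ_le_const2[OF lim]) blast
qed

end

text \<open>
  The sets over which the integral of \<open>g\<close> vanishes form a Dynkin system, which contains the generator
  and hence the sets where \<open>Re g\<close> or \<open>Im g\<close> is positive or negative.
\<close>

lemma AE_zero_if_integrals_zero:
  fixes g :: "'a \<Rightarrow> complex"
  assumes sets: "sets M = sigma_sets (space M) C" "C \<subseteq> Pow (space M)" "Int_stable C"
    and g: "integrable M g" and C: "\<And>c. c \<in> C \<Longrightarrow> (\<integral>x. indicator c x * g x \<partial>M) = 0"
    and total: "(\<integral>x. g x \<partial>M) = 0"
  shows "AE x in M. g x = 0"
proof -
  have gB: "integrable M (\<lambda>x. indicator B x * g x)" if "B \<in> sets M" for B
    using integrable_mult_indicator[OF that g]
    by (rule Bochner_Integration.integrable_cong[THEN iffD1, OF refl, rotated]) (simp add: indicator_def)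
  have zero: "(\<integral>x. indicator B x * g x \<partial>M) = 0" if "B \<in> sigma_sets (space M) C" for B
    using sets(3,2) that
  proof (induction B rule: sigma_sets_induct_disjoint)
    case (basic B) then show ?case by (rule C)
  next
    case empty show ?case by simp
  next
    case (compl B)
    then have B: "B \<in> sets M" using sets by simp
    have "(\<integral>x. indicator (space M - B) x * g x \<partial>M) = (\<integral>x. g x - indicator B x * g x \<partial>M)"
      by (rule Bochner_Integration.integral_cong) (auto simp: indicator_def)
    also have "\<dots> = 0" using Bochner_Integration.integral_diff[OF g gB[OF B]] total compl by simp
    finally show ?case .
  next
    case (union A)
    have A: "A i \<in> sets M" for i using union sets by auto
    have "(\<integral>x. indicator (\<Union>i. A i) x * g x \<partial>M) = set_lebesgue_integral M (\<Union>i. A i) g"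
      unfolding set_lebesgue_integral_def
      by (rule Bochner_Integration.integral_cong) (auto simp: indicator_def)
    also have "\<dots> = (\<Sum>i. set_lebesgue_integral M (A i) g)"
    proof (rule lebesgue_integral_countable_add)
      show "A i \<in> sets M" for i by (rule A)
      show "A i \<inter> A j = {}" if "i \<noteq> j" for i j using union that by (auto simp: disjoint_family_on_def)
      have "(\<Union>i. A i) \<in> sets M" using A by blast
      then show "set_integrable M (\<Union>i. A i) g"
        unfolding set_integrable_def by (rule integrable_mult_indicator[OF _ g])
    qed
    also have "\<dots> = (\<Sum>i. 0)"
    proof -
      have "set_lebesgue_integral M (A i) g = (\<integral>x. indicator (A i) x * g x \<partial>M)" for i
        unfolding set_lebesgue_integral_def
        by (rule Bochner_Integration.integral_cong) (auto simp: indicator_def)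
      then show ?thesis using union by simp
    qed
    finally show ?case by simp
  qed
  have m: "g \<in> borel_measurable M" using g by simp
  have part: "AE x in M. h (g x) \<le> 0" if h: "h = Re \<or> h = Im \<or> h = (\<lambda>z. - Re z) \<or> h = (\<lambda>z. - Im z)" for h :: "complex \<Rightarrow> real"
  proof -
    have mh: "(\<lambda>x. h (g x)) \<in> borel_measurable M" using h m by auto
    define B where "B = {x\<in>space M. 0 < h (g x)}"
    have B: "B \<in> sets M" unfolding B_def using mh by measurable
    have bl: "bounded_linear h"
      using h bounded_linear_Re bounded_linear_Im bounded_linear_minus[OF bounded_linear_Re]
        bounded_linear_minus[OF bounded_linear_Im] by blast
    have ih: "integrable M (\<lambda>x. h (indicator B x * g x))"
      by (rule integrable_bounded_linear[OF bl gB[OF B]])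
    have "(\<integral>x. h (indicator B x * g x) \<partial>M) = h (\<integral>x. indicator B x * g x \<partial>M)"
      by (rule integral_bounded_linear[OF bl gB[OF B]])
    also have "\<dots> = h 0" using zero[of B] B sets by simp
    also have "\<dots> = 0" using h by auto
    finally have 0: "(\<integral>x. h (indicator B x * g x) \<partial>M) = 0" .
    have h0: "h 0 = 0" using h by auto
    have nn: "AE x in M. 0 \<le> h (indicator B x * g x)"
      by (rule AE_I2) (auto simp: B_def indicator_def h0)
    have "AE x in M. h (indicator B x * g x) = 0"
      using integral_nonneg_eq_0_iff_AE[OF ih nn] 0 by (rule iffD1)
    then show ?thesis using AE_space
    proof eventually_elim
      case (elim x)
      then show ?case by (cases "x \<in> B") (auto simp: B_def)
    qed
  qed
  have "AE x in M. Re (g x) \<le> 0" "AE x in M. - Re (g x) \<le> 0" "AE x in M. Im (g x) \<le> 0" "AE x in M. - Im (g x) \<le> 0"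
    by (rule part, simp)+
  then show ?thesis by eventually_elim (simp add: complex_eq_iff)
qed

text \<open>
  \<open>C\<close> is a countable generator of the sigma-algebra.  It makes one exceptional null set suffice for
  all test functions in the identification of the kernel.
\<close>

locale nuclear_kernel = nuclear M "kernel_op M \<tau> H" s \<phi> \<psi>
  for M and \<tau> :: "complex \<Rightarrow> complex" and H :: "complex \<Rightarrow> complex \<Rightarrow> complex" and s \<phi> \<psi> +
  fixes C :: "complex set set"
  assumes sigma_finite: "sigma_finite_measure M"
    and \<tau>_measurable[measurable]: "\<tau> \<in> borel_measurable M"
    and kernel: "L2_kernel M M \<tau> H"
    and sets_C: "sets M = sigma_sets (space M) C" "C \<subseteq> Pow (space M)" "Int_stable C" "countable C"
begin

sublocale sigma_finite_measure M by (rule sigma_finite)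
sublocale MM: pair_sigma_finite M M ..

text \<open>
  The kernel with respect to the positive measure \<open>M\<close>: the phase \<open>\<tau>\<close> of the complex measure is absorbed.
\<close>

definition Ht :: "complex \<Rightarrow> complex \<Rightarrow> complex" where "Ht u v = H u v * \<tau> v"

lemma Ht_measurable[measurable]: "case_prod Ht \<in> borel_measurable (M \<Otimes>\<^sub>M M)"
proof -
  have "case_prod H \<in> borel_measurable (M \<Otimes>\<^sub>M M)" using kernel by (simp add: L2_kernel_def)
  moreover have "(\<lambda>z. \<tau> (snd z)) \<in> borel_measurable (M \<Otimes>\<^sub>M M)" by measurable
  ultimately show ?thesis unfolding Ht_def case_prod_unfold by (rule borel_measurable_times)
qed

lemma kernel_op_Ht: "kernel_op M \<tau> H f u = (\<integral>v. Ht u v * f v \<partial>M)"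
  unfolding kernel_op_def Ht_def by (simp only: mult_ac)

lemma AE_Ht_integrable: "f \<in> L2 M \<Longrightarrow> AE u in M. integrable M (\<lambda>v. Ht u v * f v)"
proof -
  assume "f \<in> L2 M"
  then have "AE u in M. integrable M (\<lambda>v. H u v * f v * \<tau> v)" using kernel by (simp add: L2_kernel_def)
  then show ?thesis unfolding Ht_def by (simp only: mult_ac)
qed

lemma AE_weights_summable: "AE u in M. summable (\<lambda>k. s k * (norm (\<psi> k u))\<^sup>2)" "AE v in M. summable (\<lambda>k. s k * (norm (\<phi> k v))\<^sup>2)"
  using weight_bound(2)[of \<psi>, OF \<psi> \<psi>_norm] weight_bound(2)[of \<phi>, OF \<phi> \<phi>_norm] by simp_all

lemma F_integral:
  assumes u: "summable (\<lambda>k. s k * (norm (\<psi> k u))\<^sup>2)" and f: "f \<in> L2 M"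
  shows "integrable M (\<lambda>v. F u v * f v)"
    and "(\<lambda>k. of_real (s k) * \<psi> k u * L2_inner M (\<phi> k) f) sums (\<integral>v. F u v * f v \<partial>M)"
proof -
  have "AE v in M. summable (\<lambda>k. norm (of_real (s k) * \<psi> k u * cnj (\<phi> k v) * f v))"
    using AE_weights_summable(2)
  proof eventually_elim
    case (elim v)
    from summable_mult2[OF F_bound(1)[OF u elim], of "norm (f v)"] show ?case by (simp only: norm_mult)
  qed
  from F_integral_if_summable[OF u f this]
  show "integrable M (\<lambda>v. F u v * f v)"
    "(\<lambda>k. of_real (s k) * \<psi> k u * L2_inner M (\<phi> k) f) sums (\<integral>v. F u v * f v \<partial>M)" .
qed

text \<open>
  Both kernels give the same operator.  Tested on indicators of countably many sets of finite
  measure, this says that for almost every \<open>u\<close> the function \<open>Ht u v - F u v\<close> of \<open>v\<close> has integral \<open>0\<close> over a generator.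
\<close>

theorem kernel_eq_series: "AE u in M. AE v in M. Ht u v = F u v"
proof -
  obtain A :: "nat \<Rightarrow> complex set" where A: "range A \<subseteq> sets M" "(\<Union>i. A i) = space M" "\<And>i. emeasure M (A i) \<noteq> \<infinity>"
    by (rule sigma_finite) blast
  define C' where "C' = insert (space M) C"
  have cC': "countable C'" using sets_C(4) by (simp add: C'_def)
  have CM: "c \<in> sets M" if "c \<in> C'" for c
    using that sets_C(1) by (auto simp: C'_def intro: sigma_sets.Basic)
  have AM: "A i \<in> sets M" for i using A(1) by auto
  let ?f = "\<lambda>i c v. indicator (A i \<inter> c) v :: complex"
  have f: "?f i c \<in> L2 M" if "c \<in> C'" for i c
  proof (rule L2_I)
    have AcM: "A i \<inter> c \<in> sets M" using AM CM[OF that] by blast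
    then show "?f i c \<in> borel_measurable M" by measurable
    have "emeasure M (A i \<inter> c) \<le> emeasure M (A i)" by (intro emeasure_mono AM) auto
    also have "emeasure M (A i) < \<infinity>" using A(3)[of i] by (simp add: less_top)
    finally have "emeasure M (A i \<inter> c) < \<infinity>" .
    then have "integrable M (indicator (A i \<inter> c) :: complex \<Rightarrow> real)" using AcM by (simp add: integrable_indicator_iff)
    then show "integrable M (\<lambda>v. (norm (?f i c v))\<^sup>2)"
      by (rule Bochner_Integration.integrable_cong[THEN iffD1, rotated 2]) (auto simp: indicator_def)
  qed
  have "AE u in M. \<forall>c\<in>C'. \<forall>i. integrable M (\<lambda>v. Ht u v * ?f i c v) \<and>
      (\<lambda>k. of_real (s k) * L2_inner M (\<phi> k) (?f i c) * \<psi> k u) sums (\<integral>v. Ht u v * ?f i c v \<partial>M)"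
    unfolding AE_ball_countable[OF cC'] AE_all_countable
  proof (intro ballI allI)
    fix c i assume "c \<in> C'"
    note fc = f[OF this, of i]
    show "AE u in M. integrable M (\<lambda>v. Ht u v * ?f i c v) \<and>
      (\<lambda>k. of_real (s k) * L2_inner M (\<phi> k) (?f i c) * \<psi> k u) sums (\<integral>v. Ht u v * ?f i c v \<partial>M)"
      using AE_Ht_integrable[OF fc] T_pointwise[OF fc]
      by eventually_elim (simp only: kernel_op_Ht simp_thms)
  qed
  then show ?thesis using AE_weights_summable(1) AE_space
  proof eventually_elim
    case (elim u)
    note H = elim(1)[rule_format]
    have z: "AE v in M. indicator (A i) v * (Ht u v - F u v) = 0" for i
    proof (rule AE_zero_if_integrals_zero[OF sets_C(1-3)])
      have int: "integrable M (\<lambda>v. ?f i c v * (Ht u v - F u v))" "(\<integral>v. ?f i c v * (Ht u v - F u v) \<partial>M) = 0"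
        if c: "c \<in> C'" for c
      proof -
        note fc = f[OF c, of i]
        note F = F_integral[OF elim(2) fc]
        have eq: "?f i c v * (Ht u v - F u v) = Ht u v * ?f i c v - F u v * ?f i c v" for v
          by (simp add: algebra_simps)
        show "integrable M (\<lambda>v. ?f i c v * (Ht u v - F u v))"
          unfolding eq using H[OF c, of i] F(1) by (intro Bochner_Integration.integrable_diff) simp_all
        have "(\<lambda>k. of_real (s k) * L2_inner M (\<phi> k) (?f i c) * \<psi> k u) sums (\<integral>v. F u v * ?f i c v \<partial>M)"
          using F(2) by (simp only: mult_ac)
        moreover have "(\<lambda>k. of_real (s k) * L2_inner M (\<phi> k) (?f i c) * \<psi> k u) sums (\<integral>v. Ht u v * ?f i c v \<partial>M)"
          using H[OF c, of i] by simp
        ultimately have "(\<integral>v. F u v * ?f i c v \<partial>M) = (\<integral>v. Ht u v * ?f i c v \<partial>M)" by (rule sums_unique2)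
        then show "(\<integral>v. ?f i c v * (Ht u v - F u v) \<partial>M) = 0"
          unfolding eq using H[OF c, of i] F(1) by (subst Bochner_Integration.integral_diff) simp_all
      qed
      have Asp: "A i \<inter> space M = A i" using sets.sets_into_space[OF AM[of i]] by blast
      show "integrable M (\<lambda>v. indicator (A i) v * (Ht u v - F u v))"
        using int(1)[of "space M"] by (simp add: C'_def Asp)
      show "(\<integral>v. indicator (A i) v * (Ht u v - F u v) \<partial>M) = 0"
        using int(2)[of "space M"] by (simp add: C'_def Asp)
      fix c assume "c \<in> C"
      then show "(\<integral>v. indicator c v * (indicator (A i) v * (Ht u v - F u v)) \<partial>M) = 0"
        using int(2)[of c] by (simp add: C'_def indicator_inter_arith mult_ac)
    qed
    have "AE v in M. \<forall>i. indicator (A i) v * (Ht u v - F u v) = 0"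
      unfolding AE_all_countable by (intro allI z)
    then show "AE v in M. Ht u v = F u v" using AE_space
    proof eventually_elim
      case (elim v)
      then obtain i where "v \<in> A i" using A(2) by blast
      with elim(1)[rule_format, of i] show ?case by simp
    qed
  qed
qed

text \<open>
  The square of the Schmidt series is bounded by the product of the two weights.  So the kernel is
  Hilbert-Schmidt, which makes Fubini's theorem available for products of its blocks.
\<close>

theorem Ht_square_integrable: "integrable (M \<Otimes>\<^sub>M M) (\<lambda>(u, v). (norm (Ht u v))\<^sup>2)"
proof (rule integrableI_bounded)
  show "(\<lambda>(u, v). (norm (Ht u v))\<^sup>2) \<in> borel_measurable (M \<Otimes>\<^sub>M M)" by measurable
  let ?a = "\<lambda>u. \<Sum>k. ennreal (s k * (norm (\<psi> k u))\<^sup>2)" and ?b = "\<lambda>v. \<Sum>k. ennreal (s k * (norm (\<phi> k v))\<^sup>2)"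
  have mb: "?a \<in> borel_measurable M" "?b \<in> borel_measurable M" by measurable
  have "(\<integral>\<^sup>+z. ennreal (norm (case z of (u, v) \<Rightarrow> (norm (Ht u v))\<^sup>2)) \<partial>(M \<Otimes>\<^sub>M M)) =
      (\<integral>\<^sup>+u. \<integral>\<^sup>+v. ennreal ((norm (Ht u v))\<^sup>2) \<partial>M \<partial>M)"
    by (subst nn_integral_fst[symmetric]) simp_all
  also have "\<dots> \<le> (\<integral>\<^sup>+u. \<integral>\<^sup>+v. ?a u * ?b v \<partial>M \<partial>M)"
  proof (rule nn_integral_mono_AE)
    show "AE u in M. (\<integral>\<^sup>+v. ennreal ((norm (Ht u v))\<^sup>2) \<partial>M) \<le> (\<integral>\<^sup>+v. ?a u * ?b v \<partial>M)"
      using kernel_eq_series AE_weights_summable(1)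
    proof eventually_elim
      case (elim u)
      show ?case
      proof (rule nn_integral_mono_AE)
        show "AE v in M. ennreal ((norm (Ht u v))\<^sup>2) \<le> ?a u * ?b v"
          using elim(1) AE_weights_summable(2)
        proof eventually_elim
          case v: (elim v)
          have "?a u = ennreal (\<Sum>k. s k * (norm (\<psi> k u))\<^sup>2)" "?b v = ennreal (\<Sum>k. s k * (norm (\<phi> k v))\<^sup>2)"
            by (intro suminf_ennreal2 mult_nonneg_nonneg s_nonneg zero_le_power2 elim v)+
          then have "?a u * ?b v = ennreal ((\<Sum>k. s k * (norm (\<psi> k u))\<^sup>2) * (\<Sum>k. s k * (norm (\<phi> k v))\<^sup>2))"
            by (simp add: ennreal_mult suminf_nonneg elim v s_nonneg)
          then show ?case using F_bound(2)[OF elim(2) v(2)] v(1) by (simp add: ennreal_leI)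
        qed
      qed
    qed
  qed
  also have "\<dots> = (\<integral>\<^sup>+u. ?a u \<partial>M) * (\<integral>\<^sup>+v. ?b v \<partial>M)"
    using mb by (simp only: nn_integral_cmult nn_integral_multc)
  also have "\<dots> < \<infinity>"
    using weight_bound(1)[of \<psi>, OF \<psi> \<psi>_norm] weight_bound(1)[of \<phi>, OF \<phi> \<phi>_norm]
    by (simp only: infinity_ennreal_def ennreal_mult_less_top) simp
  finally show "(\<integral>\<^sup>+z. ennreal (norm (case z of (u, v) \<Rightarrow> (norm (Ht u v))\<^sup>2)) \<partial>(M \<Otimes>\<^sub>M M)) < \<infinity>" .
qed

end

section \<open>Minors of infinite matrices\<close>

lemma finite_minor_sum_integral:
  assumes "finite J" "J \<subseteq> A" "countable A"
  shows "minor_sum {..<n::nat} J K =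
    (\<integral>x. indicator (PiE {..<n} (\<lambda>_. J)) x * perm_det {..<n} (\<lambda>i j. K (x i) (x j)) \<partial>PiM {..<n} (\<lambda>_. count_space A))"
proof -
  let ?P = "PiE {..<n} (\<lambda>_. J)" and ?Q = "PiE {..<n} (\<lambda>_. A)"
  let ?d = "\<lambda>x. perm_det {..<n} (\<lambda>i j. K (x i) (x j))"
  have fin: "finite ?P" using assms by (intro finite_PiE) auto
  have sub: "?P \<subseteq> ?Q" using assms by (intro PiE_mono) auto
  have "(\<integral>x. indicator ?P x * ?d x \<partial>count_space ?Q) = (\<Sum>x | x \<in> ?Q \<and> indicator ?P x * ?d x \<noteq> 0. indicator ?P x * ?d x)"
    by (rule lebesgue_integral_count_space_finite_support, rule finite_subset[OF _ fin]) (auto simp: indicator_def)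
  also have "\<dots> = (\<Sum>x\<in>?P. ?d x)"
    by (rule sum.mono_neutral_cong_left[OF fin]) (use sub in \<open>auto simp: indicator_def\<close>)
  finally show ?thesis
    using assms by (simp add: minor_sum_def count_space_PiM_finite)
qed

text \<open>
  In each term of the Leibniz formula every \<open>r i\<close> occurs once as a row bound and once as a column bound.
\<close>

lemma norm_perm_det_le:
  fixes S :: "'i set"
  assumes S: "finite S" and K: "\<And>i j. i \<in> S \<Longrightarrow> j \<in> S \<Longrightarrow> norm (f i j) \<le> r i * r j"
  shows "norm (perm_det S f) \<le> fact (card S) * (\<Prod>i\<in>S. (r i)\<^sup>2)"
proof -
  have "norm (of_int (sign p) * (\<Prod>i\<in>S. f i (p i)) :: complex) \<le> (\<Prod>i\<in>S. (r i)\<^sup>2)" if p: "p permutes S" for p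
  proof -
    have "norm (of_int (sign p) * (\<Prod>i\<in>S. f i (p i)) :: complex) = (\<Prod>i\<in>S. norm (f i (p i)))"
      by (simp add: norm_mult sign_def prod_norm)
    also have "\<dots> \<le> (\<Prod>i\<in>S. r i * r (p i))"
      using K permutes_in_image[OF p] by (intro prod_mono) auto
    also have "\<dots> = (\<Prod>i\<in>S. r i) * (\<Prod>i\<in>S. r i)"
      using prod.permute[OF p, of r] by (simp only: prod.distrib o_def)
    also have "\<dots> = (\<Prod>i\<in>S. (r i)\<^sup>2)" by (simp only: power2_eq_square prod.distrib)
    finally show ?thesis .
  qed
  then have "norm (perm_det S f) \<le> (\<Sum>p | p permutes S. \<Prod>i\<in>S. (r i)\<^sup>2)"
    unfolding perm_det_def by (intro sum_norm_le) simp
  also have "\<dots> = fact (card S) * (\<Prod>i\<in>S. (r i)\<^sup>2)"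
    using card_permutations[OF refl S] by simp
  finally show ?thesis .
qed

text \<open>
  Dominated convergence; the majorant \<open>n! \<Prod>i. C (r (x i))\<^sup>2\<close> is integrable because it is a product.
  The matrices may change with the section since products of sections are not sections of products.
\<close>

theorem minor_sum_tendsto:
  fixes K :: "'a \<Rightarrow> 'a \<Rightarrow> complex" and r :: "'a \<Rightarrow> real"
  assumes cnt: "countable (UNIV :: 'a set)"
    and r: "integrable (count_space UNIV) (\<lambda>x. (r x)\<^sup>2)"
    and le: "\<And>N x y. norm (Kn N x y) \<le> C * (r x * r y)" and C: "C \<ge> 0"
    and lim: "\<And>x y. (\<lambda>N. Kn N x y) \<longlonglongrightarrow> K x y"
    and F: "\<And>N. finite (F N)" "\<And>M N. M \<le> N \<Longrightarrow> F M \<subseteq> F N" "(\<Union>N. F N) = (UNIV :: 'a set)"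
  shows "(\<lambda>N::nat. minor_sum {..<n::nat} (F N) (Kn N)) \<longlonglongrightarrow>
    (\<integral>x. perm_det {..<n} (\<lambda>i j. K (x i) (x j)) \<partial>PiM {..<n} (\<lambda>_. count_space UNIV))"
proof -
  interpret sigma_finite_measure "count_space (UNIV :: 'a set)" by (rule sigma_finite_measure_count_space_countable[OF cnt])
  interpret P: product_sigma_finite "\<lambda>_::nat. count_space (UNIV :: 'a set)" ..
  let ?M = "PiM {..<n} (\<lambda>_. count_space (UNIV :: 'a set))"
  let ?Q = "PiE {..<n} (\<lambda>_. UNIV :: 'a set)"
  have eqM: "?M = count_space ?Q" by (rule count_space_PiM_finite) (use cnt in auto)
  define w where "w x = fact n * (\<Prod>i<n. C * (r (x i))\<^sup>2)" for x :: "nat \<Rightarrow> 'a"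
  have w: "integrable ?M w"
    unfolding w_def by (intro integrable_mult_right P.product_integrable_prod r) simp
  have meas: "g \<in> borel_measurable ?M" for g :: "(nat \<Rightarrow> 'a) \<Rightarrow> complex" unfolding eqM by simp
  show ?thesis
    unfolding finite_minor_sum_integral[OF F(1) subset_UNIV cnt]
  proof (rule integral_dominated_convergence[where w=w, OF meas meas w])
    show "AE x in ?M. (\<lambda>N. indicator (PiE {..<n} (\<lambda>_. F N)) x * perm_det {..<n} (\<lambda>i j. Kn N (x i) (x j)))
        \<longlonglongrightarrow> perm_det {..<n} (\<lambda>i j. K (x i) (x j))"
    proof (rule AE_I2)
      fix x assume x: "x \<in> space ?M"
      have "eventually (\<lambda>N. x i \<in> F N) sequentially" for i
      proof -
        obtain N where N: "x i \<in> F N" using F(3) by blast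
        show ?thesis using eventually_ge_at_top[of N] by eventually_elim (use F(2) N in blast)
      qed
      then have "eventually (\<lambda>N. \<forall>i\<in>{..<n}. x i \<in> F N) sequentially"
        by (intro eventually_ball_finite) auto
      then have "eventually (\<lambda>N. indicator (PiE {..<n} (\<lambda>_. F N)) x = (1::complex)) sequentially"
        by eventually_elim (use x in \<open>auto simp: space_PiM indicator_def PiE_iff\<close>)
      then have 1: "(\<lambda>N. indicator (PiE {..<n} (\<lambda>_. F N)) x) \<longlonglongrightarrow> (1::complex)" by (rule tendsto_eventually)
      have 2: "(\<lambda>N. perm_det {..<n} (\<lambda>i j. Kn N (x i) (x j))) \<longlonglongrightarrow> perm_det {..<n} (\<lambda>i j. K (x i) (x j))"
        unfolding perm_det_def by (intro tendsto_sum tendsto_mult tendsto_const tendsto_prod lim)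
      show "(\<lambda>N. indicator (PiE {..<n} (\<lambda>_. F N)) x * perm_det {..<n} (\<lambda>i j. Kn N (x i) (x j)))
        \<longlonglongrightarrow> perm_det {..<n} (\<lambda>i j. K (x i) (x j))"
        using tendsto_mult[OF 1 2] by simp
    qed
    show "AE x in ?M. norm (indicator (PiE {..<n} (\<lambda>_. F N)) x * perm_det {..<n} (\<lambda>i j. Kn N (x i) (x j))) \<le> w x" for N
    proof (rule AE_I2)
      fix x
      have "norm (perm_det {..<n} (\<lambda>i j. Kn N (x i) (x j))) \<le> fact (card {..<n}) * (\<Prod>i<n. (sqrt C * r (x i))\<^sup>2)"
      proof (rule norm_perm_det_le)
        fix i j
        have "norm (Kn N (x i) (x j)) \<le> C * (r (x i) * r (x j))" by (rule le)
        also have "\<dots> = (sqrt C * sqrt C) * (r (x i) * r (x j))" using C by simp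
        also have "\<dots> = (sqrt C * r (x i)) * (sqrt C * r (x j))" by (simp only: mult_ac)
        finally show "norm (Kn N (x i) (x j)) \<le> (sqrt C * r (x i)) * (sqrt C * r (x j))" .
      qed simp
      also have "\<dots> = w x" using C by (simp add: w_def power_mult_distrib)
      finally have "norm (perm_det {..<n} (\<lambda>i j. Kn N (x i) (x j))) \<le> w x" .
      moreover have "0 \<le> w x" unfolding w_def using C by (intro mult_nonneg_nonneg prod_nonneg) auto
      ultimately show "norm (indicator (PiE {..<n} (\<lambda>_. F N)) x * perm_det {..<n} (\<lambda>i j. Kn N (x i) (x j))) \<le> w x"
        by (simp add: norm_mult indicator_def)
    qed
  qed
qed

text \<open>
  The limit of \<open>minor_sum_offdiag\<close> along the sections \<open>{..<J}\<close>.
\<close>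

theorem offdiag_integral:
  fixes L N :: "nat \<Rightarrow> nat \<Rightarrow> complex" and s :: "nat \<Rightarrow> real"
  assumes s: "\<And>k. s k \<ge> 0" "summable s"
    and L: "\<And>k l. norm (L k l) \<le> sqrt (s k) * sqrt (s l)"
    and N: "\<And>k l. norm (N k l) \<le> sqrt (s k) * sqrt (s l)"
  defines "D \<equiv> \<lambda>n. \<integral>x. perm_det {..<n} (\<lambda>i j. offdiag L N (x i) (x j)) \<partial>PiM {..<n} (\<lambda>_. count_space (UNIV :: (nat \<times> bool) set))"
  shows "D (2 * n) = (- 1) ^ n * fact (2 * n) / fact n *
      (\<integral>x. perm_det {..<n} (\<lambda>i j. \<Sum>m. L (x i) m * N m (x j)) \<partial>PiM {..<n} (\<lambda>_. count_space UNIV))"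
    and "D (2 * n + 1) = 0"
proof -
  have limD: "(\<lambda>J. minor_sum {..<n} ({..<J} \<times> UNIV) (offdiag L N)) \<longlonglongrightarrow> D n" for n
    unfolding D_def
  proof (rule minor_sum_tendsto[where r="\<lambda>x. sqrt (s (fst x))" and C=1])
    have "integrable (count_space UNIV \<Otimes>\<^sub>M count_space UNIV) (\<lambda>x::nat \<times> bool. s (fst x))"
    proof -
      interpret A: sigma_finite_measure "count_space (UNIV :: nat set)" by (rule sigma_finite_measure_count_space_countable) simp
      interpret B: sigma_finite_measure "count_space (UNIV :: bool set)" by (rule sigma_finite_measure_count_space_countable) simp
      interpret pair_sigma_finite "count_space (UNIV :: nat set)" "count_space (UNIV :: bool set)" ..
      have "integrable (count_space UNIV) s"
        using s by (simp add: integrable_count_space_nat_iff)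
      then show ?thesis
        by (intro Fubini_integrable)
          (simp_all add: s integrable_count_space_nat_iff lebesgue_integral_count_space_finite
            pair_measure_countable UNIV_Times_UNIV integrable_count_space)
    qed
    then show "integrable (count_space UNIV) (\<lambda>x::nat \<times> bool. (sqrt (s (fst x)))\<^sup>2)"
      by (simp add: s pair_measure_countable UNIV_Times_UNIV)
    show "norm (offdiag L N x y) \<le> 1 * (sqrt (s (fst x)) * sqrt (s (fst y)))" for x y
      using L N s by (simp add: offdiag_def)
    show "(\<Union>J. {..<J} \<times> UNIV) = (UNIV :: (nat \<times> bool) set)" by auto
  qed auto
  have cmp: "summable (\<lambda>m. L k m * N m l)" "norm (\<Sum>m<J. L k m * N m l) \<le> suminf s * (sqrt (s k) * sqrt (s l))" for k l J
  proof -
    have le: "norm (L k m * N m l) \<le> s m * (sqrt (s k) * sqrt (s l))" for m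
    proof -
      have "norm (L k m * N m l) \<le> (sqrt (s k) * sqrt (s m)) * (sqrt (s m) * sqrt (s l))"
        unfolding norm_mult using s by (intro mult_mono L N) auto
      also have "\<dots> = (sqrt (s m) * sqrt (s m)) * (sqrt (s k) * sqrt (s l))" by (simp only: mult_ac)
      also have "sqrt (s m) * sqrt (s m) = s m" using s by simp
      finally show ?thesis .
    qed
    show "summable (\<lambda>m. L k m * N m l)"
      by (rule summable_comparison_test'[OF summable_mult2[OF s(2)] le])
    have "norm (\<Sum>m<J. L k m * N m l) \<le> (\<Sum>m<J. s m * (sqrt (s k) * sqrt (s l)))"
      by (rule sum_norm_le) (rule le)
    also have "\<dots> = (\<Sum>m<J. s m) * (sqrt (s k) * sqrt (s l))" by (simp only: sum_distrib_right)
    also have "\<dots> \<le> suminf s * (sqrt (s k) * sqrt (s l))"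
      using s by (intro mult_right_mono sum_le_suminf) auto
    finally show "norm (\<Sum>m<J. L k m * N m l) \<le> suminf s * (sqrt (s k) * sqrt (s l))" .
  qed
  have limG: "(\<lambda>J. minor_sum {..<n} {..<J} (mat_comp {..<J} L N)) \<longlonglongrightarrow>
      (\<integral>x. perm_det {..<n} (\<lambda>i j. \<Sum>m. L (x i) m * N m (x j)) \<partial>PiM {..<n} (\<lambda>_. count_space UNIV))"
  proof (rule minor_sum_tendsto[where r="\<lambda>k. sqrt (s k)" and C="suminf s"])
    show "integrable (count_space UNIV) (\<lambda>x. (sqrt (s x))\<^sup>2)" using s by (simp add: integrable_count_space_nat_iff)
    show "norm (mat_comp {..<J} L N x y) \<le> suminf s * (sqrt (s x) * sqrt (s y))" for J x y
      unfolding mat_comp_def by (rule cmp)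
    show "suminf s \<ge> 0" using s by (intro suminf_nonneg)
    show "(\<lambda>J. mat_comp {..<J} L N x y) \<longlonglongrightarrow> (\<Sum>m. L x m * N m y)" for x y
      unfolding mat_comp_def by (rule summable_LIMSEQ[OF cmp(1)])
    show "(\<Union>J. {..<J}) = (UNIV :: nat set)" by auto
  qed auto
  show "D (2 * n) = (- 1) ^ n * fact (2 * n) / fact n *
      (\<integral>x. perm_det {..<n} (\<lambda>i j. \<Sum>m. L (x i) m * N m (x j)) \<partial>PiM {..<n} (\<lambda>_. count_space UNIV))"
    using limD[of "2 * n", unfolded minor_sum_offdiag(1)] tendsto_mult_left[OF limG] by (rule LIMSEQ_unique)
  show "D (2 * n + 1) = 0"
    using limD[of "2 * n + 1", unfolded minor_sum_offdiag(2)] tendsto_const by (rule LIMSEQ_unique)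
qed

section \<open>Exterior powers of an operator with zero diagonal blocks\<close>

lemma infsum_eq_integral_count_space:
  fixes f :: "'a \<Rightarrow> complex"
  assumes "integrable (count_space A) f"
  shows "(\<Sum>\<^sub>\<infinity>x\<in>A. f x) = (\<integral>x. f x \<partial>count_space A)"
proof -
  have "Infinite_Set_Sum.abs_summable_on f A" using assms by (simp add: Infinite_Set_Sum.abs_summable_on_def)
  from infsetsum_infsum[OF this] show ?thesis by (simp add: infsetsum_def)
qed

lemma integrable_count_space_if_summable_on:
  fixes f :: "'a \<Rightarrow> 'b :: {banach, second_countable_topology}"
  assumes "(\<lambda>x. norm (f x)) summable_on A"
  shows "integrable (count_space A) f"
  using assms abs_summable_equivalent[of f A] by (simp add: Infinite_Set_Sum.abs_summable_on_def)

lemma sigma_finite_count_space: "countable A \<Longrightarrow> sigma_finite_measure (count_space A)"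
  by (rule sigma_finite_measure_count_space_countable)

lemma integral_count_space_nat_bool:
  fixes f :: "nat \<times> bool \<Rightarrow> complex"
  assumes f: "summable (\<lambda>k. norm (f (k, True)) + norm (f (k, False)))"
  shows "integrable (count_space UNIV) f"
    and "(\<integral>x. f x \<partial>count_space UNIV) = (\<Sum>k. f (k, True) + f (k, False))"
proof -
  interpret A: sigma_finite_measure "count_space (UNIV :: nat set)" by (rule sigma_finite_count_space) simp
  interpret B: sigma_finite_measure "count_space (UNIV :: bool set)" by (rule sigma_finite_count_space) simp
  interpret AB: pair_sigma_finite "count_space (UNIV :: nat set)" "count_space (UNIV :: bool set)" ..
  have P: "count_space (UNIV :: nat set) \<Otimes>\<^sub>M count_space (UNIV :: bool set) = count_space UNIV"
    by (subst pair_measure_countable) (auto simp: UNIV_Times_UNIV)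
  have bool: "(\<integral>b. g b \<partial>count_space (UNIV :: bool set)) = g True + g False" for g :: "bool \<Rightarrow> 'c :: {banach, second_countable_topology}"
    by (simp add: lebesgue_integral_count_space_finite UNIV_bool add.commute)
  have i: "integrable (count_space (UNIV :: nat set) \<Otimes>\<^sub>M count_space (UNIV :: bool set)) f"
  proof (rule AB.Fubini_integrable)
    show "f \<in> borel_measurable (count_space UNIV \<Otimes>\<^sub>M count_space UNIV)" unfolding P by simp
    show "integrable (count_space UNIV) (\<lambda>k. \<integral>b. norm (f (k, b)) \<partial>count_space UNIV)"
      unfolding bool integrable_count_space_nat_iff using f by (simp add: abs_of_nonneg)
    show "AE k in count_space UNIV. integrable (count_space UNIV) (\<lambda>b. f (k, b))"
      by (simp add: integrable_count_space)
  qed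
  then show "integrable (count_space UNIV) f" unfolding P .
  have "(\<integral>x. f x \<partial>count_space UNIV) = (\<integral>k. \<integral>b. f (k, b) \<partial>count_space UNIV \<partial>count_space UNIV)"
    using AB.integral_fst'[OF i] unfolding P by simp
  also have "\<dots> = (\<integral>k. f (k, True) + f (k, False) \<partial>count_space UNIV)" unfolding bool ..
  also have "\<dots> = (\<Sum>k. f (k, True) + f (k, False))"
  proof (rule integral_count_space_nat)
    show "integrable (count_space UNIV) (\<lambda>k. f (k, True) + f (k, False))"
      unfolding integrable_count_space_nat_iff
      by (rule summable_comparison_test'[OF f]) (simp add: norm_triangle_ineq)
  qed
  finally show "(\<integral>x. f x \<partial>count_space UNIV) = (\<Sum>k. f (k, True) + f (k, False))" .
qed

text \<open>
  The situation of \<open>H\<close>, with \<open>S1\<close> and \<open>S2\<close> in place of \<open>\<Omega>\<^sub>1\<close> and \<open>\<Omega>\<^sub>2\<close>.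
\<close>

locale block_kernel = nuclear_kernel +
  fixes S1 S2 :: "complex set"
  assumes S1: "S1 \<in> sets M" and S2: "S2 \<in> sets M"
    and S_disj: "S1 \<inter> S2 = {}" and S_un: "S1 \<union> S2 = space M"
    and H11: "u \<in> S1 \<Longrightarrow> v \<in> S1 \<Longrightarrow> H u v = 0" and H22: "u \<in> S2 \<Longrightarrow> v \<in> S2 \<Longrightarrow> H u v = 0"
begin

abbreviation "T \<equiv> kernel_op M \<tau> H"

definition P :: "bool \<Rightarrow> (complex \<Rightarrow> complex) \<Rightarrow> complex \<Rightarrow> complex" where
  "P b f z = indicator (if b then S1 else S2) z * f z"

lemma P_L2: "f \<in> L2 M \<Longrightarrow> P b f \<in> L2 M"
  unfolding P_def[abs_def] by (rule L2_restrict) (simp_all add: S1 S2)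

lemma P_sum: "z \<in> space M \<Longrightarrow> f z = P True f z + P False f z"
  using S_disj S_un by (auto simp: P_def indicator_def)

lemma P_self_adjoint: "L2_inner M (P b f) g = L2_inner M f (P b g)"
  unfolding L2_inner_def P_def by (intro Bochner_Integration.integral_cong refl) (simp add: indicator_def)

lemma P_idem: "P b (P b f) = P b f"
  by (auto simp: P_def indicator_def fun_eq_iff)

lemma P_inner_other: "L2_inner M (P b f) (P (\<not> b) g) = 0"
  unfolding L2_inner_def P_def using S_disj
  by (subst Bochner_Integration.integral_cong[where g="\<lambda>_. 0", OF refl]) (auto simp: indicator_def)

lemma inner_P_sum:
  assumes "f \<in> L2 M" "g \<in> L2 M"
  shows "L2_inner M f g = L2_inner M f (P True g) + L2_inner M f (P False g)"
proof -
  have "L2_inner M f g = L2_inner M f (\<lambda>z. P True g z + P False g z)"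
    unfolding L2_inner_def using P_sum[of _ g] by (intro Bochner_Integration.integral_cong refl) simp
  then show ?thesis by (simp only: L2_inner_add[OF assms(1) P_L2[OF assms(2)] P_L2[OF assms(2)]])
qed

lemma T_block_zero:
  assumes "b \<longleftrightarrow> u \<in> S1" "u \<in> space M"
  shows "T (P b f) u = 0"
proof -
  have 0: "Ht u v * P b f v = 0" for v
    using assms H11[of u v] H22[of u v] S_un by (auto simp: P_def Ht_def indicator_def)
  show ?thesis unfolding kernel_op_Ht 0 by simp
qed

lemma inner_T_block_zero: "L2_inner M (P b h) (T (P b f)) = 0"
proof -
  have "cnj (P b h z) * T (P b f) z = 0" if "z \<in> space M" for z
    using T_block_zero[of b z f] that S_un S_disj by (cases b) (auto simp: P_def indicator_def)
  then show ?thesis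
    unfolding L2_inner_def by (subst Bochner_Integration.integral_cong[where g="\<lambda>_. 0", OF refl]) simp_all
qed

lemma inner_T_P:
  assumes f: "f \<in> L2 M" and h: "h \<in> L2 M"
  shows "L2_inner M h (T (P b f)) = L2_inner M (P (\<not> b) h) (T (P b f))"
proof -
  note TL = T_L2[OF P_L2[OF f, of b]]
  have "L2_inner M h (T (P b f)) = L2_inner M h (P True (T (P b f))) + L2_inner M h (P False (T (P b f)))"
    by (rule inner_P_sum[OF h TL])
  then show ?thesis
    using inner_T_block_zero[of b h f] by (cases b) (simp_all add: P_self_adjoint)
qed

text \<open>
  Since \<open>T\<close> maps functions on one block to functions on the other one, \<open>\<phi>\<close> and \<open>\<psi>\<close> may be
  replaced by parts on opposite blocks, which gives two terms for each \<open>k\<close>.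
\<close>

lemma inner_T_blocks_sums:
  assumes f: "f \<in> L2 M" and h: "h \<in> L2 M"
  shows "(\<lambda>k. of_real (s k) * L2_inner M (P False (\<phi> k)) f * L2_inner M h (P True (\<psi> k)) +
      of_real (s k) * L2_inner M (P True (\<phi> k)) f * L2_inner M h (P False (\<psi> k))) sums L2_inner M h (T f)"
proof -
  have block: "(\<lambda>k. of_real (s k) * L2_inner M (P b (\<phi> k)) f * L2_inner M h (P (\<not> b) (\<psi> k))) sums L2_inner M h (T (P b f))" for b
    using inner_T_sums[OF P_L2[OF f, of b] P_L2[OF h, of "\<not> b"]]
    by (simp only: inner_T_P[OF f h] P_self_adjoint)
  have "(\<lambda>k. of_real (s k) * L2_inner M (\<phi> k) (P True f) * L2_inner M h (\<psi> k) +
      of_real (s k) * L2_inner M (\<phi> k) (P False f) * L2_inner M h (\<psi> k)) sums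
      (L2_inner M h (T (P True f)) + L2_inner M h (T (P False f)))"
    by (intro sums_add inner_T_sums P_L2 f h)
  moreover have "of_real (s k) * L2_inner M (\<phi> k) (P True f) * L2_inner M h (\<psi> k) +
      of_real (s k) * L2_inner M (\<phi> k) (P False f) * L2_inner M h (\<psi> k) = of_real (s k) * L2_inner M (\<phi> k) f * L2_inner M h (\<psi> k)" for k
    by (simp only: inner_P_sum[OF \<phi> f] algebra_simps)
  ultimately have "L2_inner M h (T f) = L2_inner M h (T (P True f)) + L2_inner M h (T (P False f))"
    using inner_T_sums[OF f h] sums_unique2 by (simp only:) blast
  then show ?thesis using sums_add[OF block[of False] block[of True]] by (simp add: add.commute)
qed

text \<open>
  The matrices that arise from \<open>\<langle>\<phi>\<^sub>k, \<psi>\<^sub>l\<rangle>\<close> restricted to one block.  The singular values are distributed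
  symmetrically, which gives the bounds required in \<open>offdiag_integral\<close>.
\<close>

definition L :: "nat \<Rightarrow> nat \<Rightarrow> complex" where
  "L k l = of_real (sqrt (s k) * sqrt (s l)) * L2_inner M (P False (\<phi> k)) (P False (\<psi> l))"
definition N :: "nat \<Rightarrow> nat \<Rightarrow> complex" where
  "N k l = of_real (sqrt (s k) * sqrt (s l)) * L2_inner M (P True (\<phi> k)) (P True (\<psi> l))"

lemma P_norm_le: "f \<in> L2 M \<Longrightarrow> L2_norm M (P b f) \<le> L2_norm M f"
  unfolding L2_norm_def
proof (intro real_sqrt_le_mono integral_mono)
  assume f: "f \<in> L2 M"
  show "integrable M (\<lambda>z. (norm (P b f z))\<^sup>2)" "integrable M (\<lambda>z. (norm (f z))\<^sup>2)"
    by (rule L2_D(2)[OF P_L2[OF f]], rule L2_D(2)[OF f])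
qed (simp add: P_def indicator_def)

lemma P_\<phi>_norm: "L2_norm M (P b (\<phi> k)) \<le> 1" and P_\<psi>_norm: "L2_norm M (P b (\<psi> k)) \<le> 1"
  using P_norm_le[OF \<phi>, of b k] P_norm_le[OF \<psi>, of b k] \<phi>_norm[of k] \<psi>_norm[of k] by linarith+

lemma weighted_inner_bound: "norm (of_real (sqrt (s k) * sqrt (s l)) * L2_inner M (P b (\<phi> k)) (P b (\<psi> l))) \<le> sqrt (s k) * sqrt (s l)"
proof -
  have "norm (L2_inner M (P b (\<phi> k)) (P b (\<psi> l))) \<le> L2_norm M (P b (\<phi> k)) * L2_norm M (P b (\<psi> l))"
    by (rule L2_Cauchy_Schwarz[OF P_L2[OF \<phi>] P_L2[OF \<psi>]])
  also have "\<dots> \<le> 1 * 1" by (intro mult_mono P_\<phi>_norm P_\<psi>_norm L2_norm_nonneg) simp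
  finally have "norm (L2_inner M (P b (\<phi> k)) (P b (\<psi> l))) \<le> 1" by simp
  from mult_left_mono[OF this, of "sqrt (s k) * sqrt (s l)"] show ?thesis
    by (simp add: norm_mult s_nonneg)
qed

text \<open>
  The regrouped expansion is a factorization \<open>T = \<Phi> \<Psi>\<close> through sequences indexed by \<open>nat \<times> bool\<close>.
  In the basis \<open>E\<close>, \<open>perm_det_integral_swap\<close> with counting measures replaces \<open>\<Phi> \<Psi>\<close> by \<open>\<Psi> \<Phi>\<close>, and by
  Parseval's identity \<open>\<Psi> \<Phi>\<close> is the matrix \<open>offdiag L N\<close>, which does not depend on \<open>E\<close>.
\<close>

theorem ext_power_trace_eq:
  assumes E: "L2_onb M E"
  shows "ext_power_trace M E T n = (\<integral>x. perm_det {..<n} (\<lambda>i j. offdiag L N (x i) (x j))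
      \<partial>PiM {..<n} (\<lambda>_. count_space (UNIV :: (nat \<times> bool) set))) / fact n"
proof -
  note oE = L2_onb_orthonormal[OF E]
  define \<phi>' where "\<phi>' x = P (\<not> snd x) (\<phi> (fst x))" for x :: "nat \<times> bool"
  define \<psi>' where "\<psi>' x = P (snd x) (\<psi> (fst x))" for x :: "nat \<times> bool"
  have \<phi>'2: "\<phi>' x \<in> L2 M" and \<psi>'2: "\<psi>' x \<in> L2 M" for x
    unfolding \<phi>'_def \<psi>'_def by (rule P_L2[OF \<phi>], rule P_L2[OF \<psi>])
  \<comment> \<open>The basis may be uncountable, but counting measure on it has to be sigma-finite.
    Only the countably many elements of \<open>E'\<close> matter.\<close>
  define E' where "E' = (\<Union>x. {e\<in>E. L2_inner M e (\<phi>' x) \<noteq> 0} \<union> {e\<in>E. L2_inner M e (\<psi>' x) \<noteq> 0})"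
  have cE': "countable E'"
    unfolding E'_def by (intro countable_UN countable_Un L2_inner_support_countable[OF oE] \<phi>'2 \<psi>'2) simp
  have E'E: "E' \<subseteq> E" by (auto simp: E'_def)
  have notE': "L2_inner M e (\<psi>' x) = 0" "L2_inner M (\<phi>' x) e = 0" if "e \<in> E" "e \<notin> E'" for e x
  proof -
    show "L2_inner M e (\<psi>' x) = 0" using that unfolding E'_def by blast
    have "L2_inner M e (\<phi>' x) = 0" using that unfolding E'_def by blast
    then show "L2_inner M (\<phi>' x) e = 0" using L2_inner_cnj[of M e "\<phi>' x"] by simp
  qed
  define \<Phi> where "\<Phi> e x = of_real (sqrt (s (fst x))) * L2_inner M e (\<psi>' x)" for e and x :: "nat \<times> bool"
  define \<Psi> where "\<Psi> x e = of_real (sqrt (s (fst x))) * L2_inner M (\<phi>' x) e" for e and x :: "nat \<times> bool"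
  have Te: "L2_inner M e (T e') = (\<integral>x. \<Phi> e x * \<Psi> x e' \<partial>count_space UNIV)" if e: "e \<in> E" "e' \<in> E" for e e'
  proof -
    note e2 = orthonormalD(1)[OF oE e(1)] and e2' = orthonormalD(1)[OF oE e(2)]
    have eq: "\<Phi> e (k, b) * \<Psi> (k, b) e' = of_real (s k) * L2_inner M (P (\<not> b) (\<phi> k)) e' * L2_inner M e (P b (\<psi> k))" for k b
      using s_nonneg[of k] by (simp add: \<Phi>_def \<Psi>_def \<phi>'_def \<psi>'_def of_real_mult[symmetric] mult_ac)
    have sm: "summable (\<lambda>k. norm (\<Phi> e (k, b) * \<Psi> (k, b) e'))" for b
      unfolding eq using inner_T_summable[OF P_L2[OF e2', of "\<not> b"] P_L2[OF e2, of b]]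
      by (simp only: P_self_adjoint)
    have "(\<integral>x. \<Phi> e x * \<Psi> x e' \<partial>count_space UNIV) = (\<Sum>k. \<Phi> e (k, True) * \<Psi> (k, True) e' + \<Phi> e (k, False) * \<Psi> (k, False) e')"
      by (rule integral_count_space_nat_bool(2)[OF summable_add[OF sm sm]])
    also have "\<dots> = L2_inner M e (T e')"
      using inner_T_blocks_sums[OF e2' e2] unfolding eq by (simp add: sums_iff)
    finally show ?thesis ..
  qed
  have \<Psi>\<Phi>: "(\<integral>e. \<Psi> x e * \<Phi> e y \<partial>count_space E') = offdiag L N x y" for x y
  proof -
    let ?c = "of_real (sqrt (s (fst x)) * sqrt (s (fst y))) :: complex"
    have ps: "((\<lambda>e. L2_inner M (\<phi>' x) e * L2_inner M e (\<psi>' y)) has_sum L2_inner M (\<phi>' x) (\<psi>' y)) E'"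
      using Parseval[OF E \<psi>'2 \<phi>'2, of x y]
      by (rule has_sum_cong_neutral[THEN iffD1, rotated 3]) (use E'E notE' in auto)
    have hs: "((\<lambda>e. \<Psi> x e * \<Phi> e y) has_sum ?c * L2_inner M (\<phi>' x) (\<psi>' y)) E'"
      using has_sum_cmult_right[OF ps, of ?c] by (simp add: \<Phi>_def \<Psi>_def mult_ac)
    have "(\<lambda>e. norm (\<Psi> x e * \<Phi> e y)) summable_on E'"
      by (rule summable_on_iff_abs_summable_on_complex[THEN iffD1, OF has_sum_imp_summable[OF hs]])
    then have "(\<integral>e. \<Psi> x e * \<Phi> e y \<partial>count_space E') = (\<Sum>\<^sub>\<infinity>e\<in>E'. \<Psi> x e * \<Phi> e y)"
      by (rule infsum_eq_integral_count_space[symmetric, OF integrable_count_space_if_summable_on])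
    also have "\<dots> = ?c * L2_inner M (\<phi>' x) (\<psi>' y)" using hs by (rule infsumI)
    also have "\<dots> = offdiag L N x y"
      using P_inner_other[of "snd y" "\<phi> (fst x)" "\<psi> (fst y)"]  P_inner_other[of "\<not> snd x" "\<phi> (fst x)" "\<psi> (fst y)"]
      by (auto simp: offdiag_def L_def N_def \<phi>'_def \<psi>'_def)
    finally show ?thesis .
  qed
  have sq: "integrable (count_space E' \<Otimes>\<^sub>M count_space (UNIV :: (nat \<times> bool) set)) (\<lambda>(e, x). (norm (g e x))\<^sup>2)"
    if g: "\<And>e x. e \<in> E' \<Longrightarrow> norm (g e x) = sqrt (s (fst x)) * norm (L2_inner M e (\<xi> x))"
      and \<xi>: "\<And>x. \<xi> x \<in> L2 M" "\<And>x. L2_norm M (\<xi> x) \<le> 1" for g :: "(complex \<Rightarrow> complex) \<Rightarrow> nat \<times> bool \<Rightarrow> complex" and \<xi>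
  proof -
    interpret A: sigma_finite_measure "count_space E'" by (rule sigma_finite_count_space[OF cE'])
    interpret B: sigma_finite_measure "count_space (UNIV :: (nat \<times> bool) set)" by (rule sigma_finite_count_space) simp
    interpret BA: pair_sigma_finite "count_space (UNIV :: (nat \<times> bool) set)" "count_space E'" ..
    have Pm: "count_space (UNIV :: (nat \<times> bool) set) \<Otimes>\<^sub>M count_space E' = count_space (UNIV \<times> E')"
      by (rule pair_measure_countable) (simp_all add: cE')
    have inner: "integrable (count_space E') (\<lambda>e. (norm (g e x))\<^sup>2)"
      "(\<integral>e. (norm (g e x))\<^sup>2 \<partial>count_space E') \<le> s (fst x)" for x
    proof -
      have gg: "(norm (g e x))\<^sup>2 = s (fst x) * (norm (L2_inner M e (\<xi> x)))\<^sup>2" if "e \<in> E'" for e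
        by (simp add: g[OF that] power_mult_distrib s_nonneg)
      have b1: "(\<lambda>e. (norm (L2_inner M e (\<xi> x)))\<^sup>2) summable_on E'"
        by (rule summable_on_subset_banach[OF Bessel_summable(1)[OF oE \<xi>(1)] E'E])
      then have "integrable (count_space E') (\<lambda>e. (norm (L2_inner M e (\<xi> x)))\<^sup>2)"
        by (intro integrable_count_space_if_summable_on) simp
      then have b2: "integrable (count_space E') (\<lambda>e. s (fst x) * (norm (L2_inner M e (\<xi> x)))\<^sup>2)"
        by (rule integrable_mult_right)
      show "integrable (count_space E') (\<lambda>e. (norm (g e x))\<^sup>2)"
        by (rule Bochner_Integration.integrable_cong[THEN iffD2, OF refl _ b2]) (simp add: gg)
      have "(\<integral>e. (norm (g e x))\<^sup>2 \<partial>count_space E') = (\<integral>e. s (fst x) * (norm (L2_inner M e (\<xi> x)))\<^sup>2 \<partial>count_space E')"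
        by (rule Bochner_Integration.integral_cong) (simp_all add: gg)
      also have "\<dots> = s (fst x) * (\<Sum>\<^sub>\<infinity>e\<in>E'. (norm (L2_inner M e (\<xi> x)))\<^sup>2)"
      proof -
        have "Infinite_Set_Sum.abs_summable_on (\<lambda>e. (norm (L2_inner M e (\<xi> x)))\<^sup>2) E'"
          using b1 by (subst abs_summable_equivalent[symmetric]) simp
        from infsetsum_infsum[OF this] show ?thesis by (simp add: infsetsum_def)
      qed
      also have "\<dots> \<le> s (fst x) * 1"
      proof (rule mult_left_mono[OF _ s_nonneg])
        have "(\<Sum>\<^sub>\<infinity>e\<in>E'. (norm (L2_inner M e (\<xi> x)))\<^sup>2) \<le> (\<Sum>\<^sub>\<infinity>e\<in>E. (norm (L2_inner M e (\<xi> x)))\<^sup>2)"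
          by (rule infsum_mono_neutral[OF b1 Bessel_summable(1)[OF oE \<xi>(1)]]) (use E'E in auto)
        also have "\<dots> \<le> (L2_norm M (\<xi> x))\<^sup>2" by (rule Bessel_summable(2)[OF oE \<xi>(1)])
        also have "\<dots> \<le> 1" using \<xi>(2)[of x] by (simp add: L2_norm_nonneg power_le_one)
        finally show "(\<Sum>\<^sub>\<infinity>e\<in>E'. (norm (L2_inner M e (\<xi> x)))\<^sup>2) \<le> 1" .
      qed
      finally show "(\<integral>e. (norm (g e x))\<^sup>2 \<partial>count_space E') \<le> s (fst x)" by simp
    qed
    have "integrable (count_space UNIV \<Otimes>\<^sub>M count_space E') (\<lambda>(x, e). (norm (g e x))\<^sup>2)"
    proof (rule BA.Fubini_integrable)
      show "(\<lambda>(x, e). (norm (g e x))\<^sup>2) \<in> borel_measurable (count_space UNIV \<Otimes>\<^sub>M count_space E')" unfolding Pm by simp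
      have "integrable (count_space UNIV) (\<lambda>x::nat \<times> bool. complex_of_real (s (fst x)))"
        by (rule integral_count_space_nat_bool(1)) (simp add: s_nonneg summable_add s_summable)
      then have "integrable (count_space UNIV) (\<lambda>x::nat \<times> bool. s (fst x))"
        by (simp only: complex_of_real_integrable_eq)
      then show "integrable (count_space UNIV) (\<lambda>x. \<integral>e. norm (case (x, e) of (x, e) \<Rightarrow> (norm (g e x))\<^sup>2) \<partial>count_space E')"
        by (rule Bochner_Integration.integrable_bound) (use inner(2) s_nonneg in \<open>simp_all add: abs_of_nonneg\<close>)
      show "AE x in count_space UNIV. integrable (count_space E') (\<lambda>e. case (x, e) of (x, e) \<Rightarrow> (norm (g e x))\<^sup>2)"
        using inner(1) by simp
    qed
    then show ?thesis
      using BA.integrable_product_swap_iff[of "\<lambda>(x, e). (norm (g e x))\<^sup>2"] by simp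
  qed
  have norm': "L2_norm M (\<phi>' x) \<le> 1" "L2_norm M (\<psi>' x) \<le> 1" for x
    by (simp_all add: \<phi>'_def \<psi>'_def P_\<phi>_norm P_\<psi>_norm)
  have n\<Phi>: "norm (\<Phi> e x) = sqrt (s (fst x)) * norm (L2_inner M e (\<psi>' x))" for e x
    by (simp add: \<Phi>_def norm_mult s_nonneg)
  have n\<Psi>: "norm (\<Psi> x e) = sqrt (s (fst x)) * norm (L2_inner M e (\<phi>' x))" for e x
    using L2_inner_cnj[of M e "\<phi>' x"] by (simp add: \<Psi>_def norm_mult s_nonneg) (metis complex_mod_cnj)
  let ?X = "count_space E'" and ?Y = "count_space (UNIV :: (nat \<times> bool) set)"
  have sX: "sigma_finite_measure ?X" and sY: "sigma_finite_measure ?Y"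
    by (rule sigma_finite_count_space[OF cE'], rule sigma_finite_count_space) simp
  have XY: "?X \<Otimes>\<^sub>M ?Y = count_space (E' \<times> UNIV)" "?Y \<Otimes>\<^sub>M ?X = count_space (UNIV \<times> E')"
    by (rule pair_measure_countable, simp_all add: cE')+
  interpret X: sigma_finite_measure ?X by fact
  interpret Y: sigma_finite_measure ?Y by fact
  interpret YX: pair_sigma_finite ?Y ?X ..
  have i1: "integrable (?X \<Otimes>\<^sub>M ?Y) (\<lambda>(e, x). (norm (\<Phi> e x))\<^sup>2)"
    by (rule sq[where \<xi>=\<psi>', OF n\<Phi> \<psi>'2 norm'(2)])
  have "integrable (?X \<Otimes>\<^sub>M ?Y) (\<lambda>(e, x). (norm (\<Psi> x e))\<^sup>2)"
    by (rule sq[where \<xi>=\<phi>' and g="\<lambda>e x. \<Psi> x e", OF n\<Psi> \<phi>'2 norm'(1)])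
  then have i2: "integrable (?Y \<Otimes>\<^sub>M ?X) (\<lambda>(x, e). (norm (\<Psi> x e))\<^sup>2)"
    using YX.integrable_product_swap_iff[of "\<lambda>(x, e). (norm (\<Psi> x e))\<^sup>2"] by simp
  have m1: "case_prod \<Phi> \<in> borel_measurable (?X \<Otimes>\<^sub>M ?Y)" and m2: "case_prod \<Psi> \<in> borel_measurable (?Y \<Otimes>\<^sub>M ?X)"
    unfolding XY by simp_all
  note swap = perm_det_integral_swap[OF sX sY m1 m2 i1 i2, of n]
  have PX: "PiM {..<n} (\<lambda>_. ?X) = count_space (PiE {..<n} (\<lambda>_. E'))"
    by (rule count_space_PiM_finite) (simp_all add: cE')
  let ?D = "\<lambda>e. perm_det {..<n} (\<lambda>i j. L2_inner M (e i) (T (e j)))"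
  let ?D' = "\<lambda>e. perm_det {..<n} (\<lambda>i j. \<integral>y. \<Phi> (e i) y * \<Psi> y (e j) \<partial>?Y)"
  have DD': "?D e = ?D' e" if "e \<in> PiE {..<n} (\<lambda>_. E)" for e
    unfolding perm_det_def
  proof (intro sum.cong refl arg_cong2[where f="(*)"] prod.cong)
    fix p i assume "p \<in> {p. p permutes {..<n}}" "i \<in> {..<n}"
    then show "L2_inner M (e i) (T (e (p i))) = (\<integral>y. \<Phi> (e i) y * \<Psi> y (e (p i)) \<partial>?Y)"
      using that permutes_lessThan[of p n i] by (intro Te) (auto simp: PiE_iff)
  qed
  have "(\<Sum>\<^sub>\<infinity>e\<in>PiE {..<n} (\<lambda>_. E). ?D e) = (\<Sum>\<^sub>\<infinity>e\<in>PiE {..<n} (\<lambda>_. E'). ?D' e)"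
  proof (rule infsum_cong_neutral)
    fix e assume e: "e \<in> PiE {..<n} (\<lambda>_. E) - PiE {..<n} (\<lambda>_. E')"
    then obtain i where i: "i < n" "e i \<in> E" "e i \<notin> E'" by (auto simp: PiE_iff)
    have "\<Phi> (e i) y = 0" for y using notE'(1)[OF i(2,3)] by (simp add: \<Phi>_def)
    then have z: "(\<Prod>j<n. \<integral>y. \<Phi> (e j) y * \<Psi> y (e (p j)) \<partial>?Y) = 0" for p
      using i by (intro prod_zero bexI[of _ i]) simp_all
    have "?D' e = 0" unfolding perm_det_def z by simp
    then show "?D e = 0" using DD'[of e] e by simp
  next
    fix e assume "e \<in> PiE {..<n} (\<lambda>_. E) \<inter> PiE {..<n} (\<lambda>_. E')"
    then show "?D e = ?D' e" by (intro DD') simp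
  next
    fix e assume e: "e \<in> PiE {..<n} (\<lambda>_. E') - PiE {..<n} (\<lambda>_. E)"
    then show "?D' e = 0" using PiE_mono[of "{..<n}" "\<lambda>_. E'" "\<lambda>_. E"] E'E by blast
  qed
  also have "\<dots> = (\<integral>e. ?D' e \<partial>PiM {..<n} (\<lambda>_. ?X))"
    unfolding PX by (rule infsum_eq_integral_count_space) (rule swap(1)[unfolded PX])
  also have "\<dots> = (\<integral>x. perm_det {..<n} (\<lambda>i j. offdiag L N (x i) (x j)) \<partial>PiM {..<n} (\<lambda>_. ?Y))"
    unfolding swap(2) \<Psi>\<Phi> ..
  finally show ?thesis unfolding ext_power_trace_def det_mat_eq_perm_det by simp
qed

end

section \<open>The Fredholm series of the product of the blocks\<close>

lemma perm_det_scale: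
  assumes S: "finite S"
  shows "perm_det S (\<lambda>i j. a i * f i j * b j) = (\<Prod>i\<in>S. a i) * (\<Prod>i\<in>S. b i) * perm_det S f"
proof -
  have "of_int (sign p) * (\<Prod>i\<in>S. a i * f i (p i) * b (p i)) =
      (\<Prod>i\<in>S. a i) * (\<Prod>i\<in>S. b i) * (of_int (sign p) * (\<Prod>i\<in>S. f i (p i)))" if p: "p permutes S" for p
  proof -
    have "(\<Prod>i\<in>S. b (p i)) = (\<Prod>i\<in>S. b i)" using prod.permute[OF p, of b] by (simp only: o_def)
    then show ?thesis by (simp add: prod.distrib mult_ac)
  qed
  then show ?thesis unfolding perm_det_def sum_distrib_left by (intro sum.cong) auto
qed

lemma perm_det_cong:
  assumes "\<And>i j. i \<in> S \<Longrightarrow> j \<in> S \<Longrightarrow> f i j = g i j"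
  shows "perm_det S f = perm_det S g"
  unfolding perm_det_def
proof (intro sum.cong refl arg_cong2[where f="(*)"] prod.cong)
  fix p i assume "p \<in> {p. p permutes S}" "i \<in> S"
  then show "f i (p i) = g i (p i)" using assms permutes_in_image[of p S i] by auto
qed

lemma fredholm_integrand_eq_perm_det:
  "fredholm_integrand \<tau> K n u = perm_det {..<n} (\<lambda>i j. K (u i) (u j) * \<tau> (u j))"
  using perm_det_scale[of "{..<n}" "\<lambda>_. 1" "\<lambda>i j. K (u i) (u j)" "\<lambda>j. \<tau> (u j)"]
  by (simp add: fredholm_integrand_def det_mat_eq_perm_det mult.commute)

lemma integral_restrict_space_mult:
  fixes f :: "'a \<Rightarrow> complex"
  assumes "S \<in> sets M"
  shows "(\<integral>x. f x \<partial>restrict_space M S) = (\<integral>x. indicator S x * f x \<partial>M)"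
proof -
  have "S \<inter> space M \<in> sets M" using assms by auto
  then have "(\<integral>x. f x \<partial>restrict_space M S) = (\<integral>x. indicat_real S x *\<^sub>R f x \<partial>M)"
    by (rule integral_restrict_space)
  also have "\<dots> = (\<integral>x. indicator S x * f x \<partial>M)"
    by (rule Bochner_Integration.integral_cong) (auto simp: indicator_def)
  finally show ?thesis .
qed

lemma integrable_count_nat_times:
  fixes g :: "nat \<Rightarrow> complex \<Rightarrow> complex" and t :: "nat \<Rightarrow> real"
  assumes sf: "sigma_finite_measure M" and S: "S \<in> sets M"
    and g: "\<And>k. g k \<in> L2 M" and le: "\<And>k. (L2_norm M (g k))\<^sup>2 \<le> t k" and t: "summable t"
  shows "case_prod g \<in> borel_measurable (count_space UNIV \<Otimes>\<^sub>M restrict_space M S)"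
    and "integrable (count_space UNIV \<Otimes>\<^sub>M restrict_space M S) (\<lambda>(k, u). (norm (g k u))\<^sup>2)"
proof -
  let ?M = "restrict_space M S"
  have S': "S \<inter> space M \<in> sets M" using S by auto
  interpret A: sigma_finite_measure "count_space (UNIV :: nat set)" by (rule sigma_finite_count_space) simp
  interpret B: sigma_finite_measure ?M by (rule sigma_finite_measure_restrict_space[OF sf S])
  interpret AB: pair_sigma_finite "count_space (UNIV :: nat set)" ?M ..
  have mg: "g k \<in> borel_measurable ?M" for k
    by (rule measurable_restrict_space1[OF L2_D(1)[OF g]])
  show m: "case_prod g \<in> borel_measurable (count_space UNIV \<Otimes>\<^sub>M ?M)"
    by (rule measurable_pair_measure_countable1) (simp_all add: mg)
  have ig: "integrable ?M (\<lambda>u. (norm (g k u))\<^sup>2)" for k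
    unfolding integrable_restrict_space[OF S'] by (rule integrable_mult_indicator[OF S L2_D(2)[OF g]])
  have leg: "(\<integral>u. (norm (g k u))\<^sup>2 \<partial>?M) \<le> t k" for k
  proof -
    have "(\<integral>u. (norm (g k u))\<^sup>2 \<partial>?M) = (\<integral>u. indicat_real S u *\<^sub>R (norm (g k u))\<^sup>2 \<partial>M)"
      by (rule integral_restrict_space[OF S'])
    also have "\<dots> \<le> (\<integral>u. (norm (g k u))\<^sup>2 \<partial>M)"
      by (rule integral_mono[OF integrable_mult_indicator[OF S L2_D(2)[OF g]] L2_D(2)[OF g]]) (simp add: indicator_def)
    also have "\<dots> \<le> t k" using le by (simp only: L2_norm_power2)
    finally show ?thesis .
  qed
  show "integrable (count_space UNIV \<Otimes>\<^sub>M ?M) (\<lambda>(k, u). (norm (g k u))\<^sup>2)"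
  proof (rule AB.Fubini_integrable)
    have "(\<lambda>z. (norm (case_prod g z))\<^sup>2) \<in> borel_measurable (count_space UNIV \<Otimes>\<^sub>M ?M)" using m by measurable
    then show "(\<lambda>(k, u). (norm (g k u))\<^sup>2) \<in> borel_measurable (count_space UNIV \<Otimes>\<^sub>M ?M)"
      by (simp only: case_prod_unfold)
    have "summable (\<lambda>k. \<integral>u. (norm (g k u))\<^sup>2 \<partial>?M)"
      by (rule summable_comparison_test'[OF t]) (simp add: leg)
    then show "integrable (count_space UNIV) (\<lambda>k. \<integral>u. norm (case (k, u) of (k, u) \<Rightarrow> (norm (g k u))\<^sup>2) \<partial>?M)"
      unfolding integrable_count_space_nat_iff by simp
    show "AE k in count_space UNIV. integrable ?M (\<lambda>u. case (k, u) of (k, u) \<Rightarrow> (norm (g k u))\<^sup>2)"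
      by (simp add: ig)
  qed
qed

context block_kernel
begin

lemma AE_Ht_section: "AE w in M. (\<lambda>v. Ht v w) \<in> L2 M"
proof -
  have "AE w in M. integrable M (\<lambda>v. (norm (Ht v w))\<^sup>2)"
    using MM.AE_integrable_snd[of "\<lambda>u v. (norm (Ht u v))\<^sup>2"] Ht_square_integrable by simp
  then show ?thesis using AE_space
  proof eventually_elim
    case (elim w)
    then have "(\<lambda>v. Ht v w) \<in> borel_measurable M" by measurable
    then show ?case using elim(1) by (rule L2_I)
  qed
qed

text \<open>
  For \<open>u\<close> and \<open>w\<close> in \<open>S1\<close>, the kernel of the product of the two off-diagonal blocks with respect to \<open>M\<close>.
\<close>

definition Gt :: "complex \<Rightarrow> complex \<Rightarrow> complex" where
  "Gt u w = (\<integral>v. Ht u v * P False (\<lambda>v. Ht v w) v \<partial>M)"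

lemma Gt_measurable: "case_prod Gt \<in> borel_measurable (M \<Otimes>\<^sub>M M)"
proof -
  have f: "(\<lambda>z. fst (fst z)) \<in> measurable ((M \<Otimes>\<^sub>M M) \<Otimes>\<^sub>M M) M"
    "(\<lambda>z. snd (fst z)) \<in> measurable ((M \<Otimes>\<^sub>M M) \<Otimes>\<^sub>M M) M"
    by measurable
  have "(\<lambda>z. Ht (fst (fst z)) (snd z) * (indicator S2 (snd z) * Ht (snd z) (snd (fst z))))
      \<in> borel_measurable ((M \<Otimes>\<^sub>M M) \<Otimes>\<^sub>M M)"
    by (intro borel_measurable_times measurable_kernel_comp[OF Ht_measurable] f measurable_snd
        measurable_compose[OF measurable_snd borel_measurable_indicator[OF S2]])
  then have "(\<lambda>(z, v). Ht (fst z) v * (indicator S2 v * Ht v (snd z))) \<in> borel_measurable ((M \<Otimes>\<^sub>M M) \<Otimes>\<^sub>M M)"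
    by (simp only: case_prod_unfold)
  from borel_measurable_lebesgue_integral[OF this] show ?thesis
    by (simp add: Gt_def[abs_def] P_def case_prod_unfold)
qed

text \<open>
  The adjoint of \<open>T\<close> applied to the part of \<open>\<phi>\<close> on \<open>S2\<close>, up to complex conjugation.
\<close>

definition \<Psi>0 :: "nat \<Rightarrow> complex \<Rightarrow> complex" where
  "\<Psi>0 k w = L2_inner M (P False (\<phi> k)) (\<lambda>v. Ht v w)"

lemma \<Psi>0_L2: "\<Psi>0 k \<in> L2 M" "(L2_norm M (\<Psi>0 k))\<^sup>2 \<le> (\<integral>z. (case z of (u, v) \<Rightarrow> (norm (Ht u v))\<^sup>2) \<partial>(M \<Otimes>\<^sub>M M))"
proof -
  have mP: "P False (\<phi> k) \<in> borel_measurable M" using L2_D(1)[OF P_L2[OF \<phi>]] .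
  have m: "\<Psi>0 k \<in> borel_measurable M"
    unfolding \<Psi>0_def[abs_def] L2_inner_def using mP by measurable
  have sw: "integrable (M \<Otimes>\<^sub>M M) (\<lambda>(w, v). (norm (Ht v w))\<^sup>2)"
    using MM.integrable_product_swap_iff[of "\<lambda>(u, v). (norm (Ht u v))\<^sup>2"] Ht_square_integrable by simp
  have ih: "integrable M (\<lambda>w. \<integral>v. (norm (Ht v w))\<^sup>2 \<partial>M)"
    using MM.integrable_fst'[OF sw] by simp
  have le: "AE w in M. (norm (\<Psi>0 k w))\<^sup>2 \<le> (\<integral>v. (norm (Ht v w))\<^sup>2 \<partial>M)"
    using AE_Ht_section
  proof eventually_elim
    case (elim w)
    have "norm (\<Psi>0 k w) \<le> L2_norm M (P False (\<phi> k)) * L2_norm M (\<lambda>v. Ht v w)"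
      unfolding \<Psi>0_def by (rule L2_Cauchy_Schwarz[OF P_L2[OF \<phi>] elim])
    also have "\<dots> \<le> 1 * L2_norm M (\<lambda>v. Ht v w)"
      by (intro mult_right_mono P_\<phi>_norm L2_norm_nonneg)
    finally have "(norm (\<Psi>0 k w))\<^sup>2 \<le> (L2_norm M (\<lambda>v. Ht v w))\<^sup>2" by (intro power_mono) simp_all
    then show ?case unfolding L2_norm_power2 .
  qed
  have int: "integrable M (\<lambda>w. (norm (\<Psi>0 k w))\<^sup>2)"
  proof (rule Bochner_Integration.integrable_bound[OF ih])
    show "(\<lambda>w. (norm (\<Psi>0 k w))\<^sup>2) \<in> borel_measurable M" using m by measurable
    show "AE w in M. norm ((norm (\<Psi>0 k w))\<^sup>2) \<le> norm (\<integral>v. (norm (Ht v w))\<^sup>2 \<partial>M)"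
      using le by eventually_elim simp
  qed
  show "\<Psi>0 k \<in> L2 M" by (rule L2_I[OF m int])
  have "(L2_norm M (\<Psi>0 k))\<^sup>2 \<le> (\<integral>w. \<integral>v. (norm (Ht v w))\<^sup>2 \<partial>M \<partial>M)"
    unfolding L2_norm_power2 by (rule integral_mono_AE[OF int ih le])
  also have "\<dots> = (\<integral>z. (case z of (u, v) \<Rightarrow> (norm (Ht u v))\<^sup>2) \<partial>(M \<Otimes>\<^sub>M M))"
    using MM.integral_snd[of "\<lambda>u v. (norm (Ht u v))\<^sup>2"] Ht_square_integrable by simp
  finally show "(L2_norm M (\<Psi>0 k))\<^sup>2 \<le> (\<integral>z. (case z of (u, v) \<Rightarrow> (norm (Ht u v))\<^sup>2) \<partial>(M \<Otimes>\<^sub>M M))" .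
qed

lemma \<Psi>0_pairing:
  assumes g: "g \<in> L2 M"
  shows "(\<integral>w. \<Psi>0 k w * g w \<partial>M) = L2_inner M (P False (\<phi> k)) (T g)"
proof -
  let ?f = "P False (\<phi> k)"
  have f: "?f \<in> L2 M" by (rule P_L2[OF \<phi>])
  have m: "?f \<in> borel_measurable M" "g \<in> borel_measurable M" using L2_D(1) f g by auto
  have fg: "integrable (M \<Otimes>\<^sub>M M) (\<lambda>(v, w). (norm (?f v))\<^sup>2 * (norm (g w))\<^sup>2)"
  proof (rule MM.Fubini_integrable)
    show "(\<lambda>(v, w). (norm (?f v))\<^sup>2 * (norm (g w))\<^sup>2) \<in> borel_measurable (M \<Otimes>\<^sub>M M)" using m by measurable
    show "integrable M (\<lambda>v. \<integral>w. norm (case (v, w) of (v, w) \<Rightarrow> (norm (?f v))\<^sup>2 * (norm (g w))\<^sup>2) \<partial>M)"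
      using L2_D(2)[OF f] by simp
    show "AE v in M. integrable M (\<lambda>w. case (v, w) of (v, w) \<Rightarrow> (norm (?f v))\<^sup>2 * (norm (g w))\<^sup>2)"
      using L2_D(2)[OF g] by simp
  qed
  have int: "integrable (M \<Otimes>\<^sub>M M) (\<lambda>(v, w). cnj (?f v) * Ht v w * g w)"
  proof (rule Bochner_Integration.integrable_bound[OF Bochner_Integration.integrable_add[OF fg Ht_square_integrable]])
    show "(\<lambda>(v, w). cnj (?f v) * Ht v w * g w) \<in> borel_measurable (M \<Otimes>\<^sub>M M)" using m by measurable
    have "norm (cnj (?f v) * Ht v w * g w) \<le> (norm (?f v))\<^sup>2 * (norm (g w))\<^sup>2 + (norm (Ht v w))\<^sup>2" for v w
    proof -
      let ?a = "norm (?f v) * norm (g w)" and ?b = "norm (Ht v w)"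
      have "0 \<le> ?a * ?b" by simp
      then have "?a * ?b \<le> ?a\<^sup>2 + ?b\<^sup>2" using sum_squares_bound[of ?a ?b] by linarith
      then show ?thesis by (simp add: norm_mult power_mult_distrib mult_ac)
    qed
    then show "AE z in M \<Otimes>\<^sub>M M. norm (case z of (v, w) \<Rightarrow> cnj (?f v) * Ht v w * g w) \<le>
        norm ((case z of (v, w) \<Rightarrow> (norm (?f v))\<^sup>2 * (norm (g w))\<^sup>2) + (case z of (u, v) \<Rightarrow> (norm (Ht u v))\<^sup>2))"
      by (intro AE_I2) (auto simp: case_prod_unfold intro: order_trans[OF _ abs_ge_self])
  qed
  have "(\<integral>w. \<Psi>0 k w * g w \<partial>M) = (\<integral>w. \<integral>v. cnj (?f v) * Ht v w * g w \<partial>M \<partial>M)"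
    unfolding \<Psi>0_def L2_inner_def by simp
  also have "\<dots> = (\<integral>v. \<integral>w. cnj (?f v) * Ht v w * g w \<partial>M \<partial>M)"
    by (rule MM.Fubini_integral[OF int])
  also have "\<dots> = L2_inner M ?f (T g)"
    unfolding L2_inner_def kernel_op_Ht by (simp add: mult.assoc)
  finally show ?thesis .
qed

text \<open>
  In \<open>Gt u w\<close>, the integral of \<open>Ht u v * Ht v w\<close> over \<open>S2\<close>, only the first factor is expanded
  in its Schmidt series.  This factorizes \<open>Gt\<close> as \<open>\<Phi> \<Psi>\<close> through sequences, and the identity holds
  for \<open>u\<close> and \<open>w\<close> outside a null set of points.  This is essential, because the diagonal
  entries of the Fredholm integrand have \<open>u = w\<close>, where an identity for almost all pairs says nothing.
  Interchanging the factors leaves the matrix \<open>\<Psi> \<Phi> = L N\<close>.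
\<close>

theorem fredholm_integral_eq:
  defines "M1 \<equiv> restrict_space M S1" and "M2 \<equiv> restrict_space M S2"
  shows "(\<integral>u. fredholm_integrand \<tau> (kernel_prod M2 \<tau> H H) n u \<partial>PiM {..<n} (\<lambda>_. M1)) =
    (\<integral>x. perm_det {..<n} (\<lambda>i j. \<Sum>m. L (x i) m * N m (x j)) \<partial>PiM {..<n} (\<lambda>_. count_space UNIV))"
proof -
  let ?C = "count_space (UNIV :: nat set)"
  have sM1: "sigma_finite_measure M1" unfolding M1_def by (rule sigma_finite_measure_restrict_space[OF sigma_finite S1])
  have sC: "sigma_finite_measure ?C" by (rule sigma_finite_count_space) simp
  interpret M1: sigma_finite_measure M1 by fact
  interpret C: sigma_finite_measure ?C by fact
  interpret CM: pair_sigma_finite ?C M1 ..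
  interpret MC: pair_sigma_finite M1 ?C ..
  have spM1: "space M1 = S1" and S1M: "S1 \<subseteq> space M"
    using sets.sets_into_space[OF S1] by (auto simp: M1_def space_restrict_space)
  define \<Phi> where "\<Phi> u k = of_real (sqrt (s k)) * \<psi> k u" for u k
  define \<Psi> where "\<Psi> k w = of_real (sqrt (s k)) * \<Psi>0 k w" for k w
  let ?h = "\<integral>z. (case z of (u, v) \<Rightarrow> (norm (Ht u v))\<^sup>2) \<partial>(M \<Otimes>\<^sub>M M)"
  have scale: "(L2_norm M (\<lambda>z. of_real (sqrt (s k)) * f z))\<^sup>2 = s k * (L2_norm M f)\<^sup>2" for k f
    by (simp add: L2_norm_power2 norm_mult power_mult_distrib s_nonneg)
  have n\<psi>: "(L2_norm M (\<lambda>u. \<Phi> u k))\<^sup>2 \<le> s k" for k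
  proof -
    have "(L2_norm M (\<psi> k))\<^sup>2 \<le> 1" using \<psi>_norm[of k] by (simp add: L2_norm_nonneg power_le_one)
    from mult_left_mono[OF this s_nonneg[of k]] show ?thesis unfolding \<Phi>_def scale by simp
  qed
  have n\<Psi>: "(L2_norm M (\<Psi> k))\<^sup>2 \<le> s k * ?h" for k
    unfolding \<Psi>_def scale by (rule mult_left_mono[OF \<Psi>0_L2(2) s_nonneg])
  have \<Phi>2: "(\<lambda>u. \<Phi> u k) \<in> L2 M" for k unfolding \<Phi>_def by (rule L2_scale[OF \<psi>])
  have \<Psi>2: "\<Psi> k \<in> L2 M" for k unfolding \<Psi>_def[abs_def] by (rule L2_scale[OF \<Psi>0_L2(1)])
  note A = integrable_count_nat_times[OF sigma_finite S1 \<Phi>2 n\<psi> s_summable, folded M1_def]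
  note B = integrable_count_nat_times[OF sigma_finite S1 \<Psi>2 n\<Psi> summable_mult2[OF s_summable], folded M1_def]
  have m\<Phi>: "case_prod \<Phi> \<in> borel_measurable (M1 \<Otimes>\<^sub>M ?C)"
    using A(1) measurable_pair_swap_iff[of "case_prod \<Phi>" M1 ?C borel] by simp
  have i\<Phi>: "integrable (M1 \<Otimes>\<^sub>M ?C) (\<lambda>(u, k). (norm (\<Phi> u k))\<^sup>2)"
    using A(2) CM.integrable_product_swap_iff[of "\<lambda>(k, u). (norm (\<Phi> u k))\<^sup>2"] by simp
  note swap = perm_det_integral_swap[OF sM1 sC m\<Phi> B(1) i\<Phi> B(2), of n]
  \<comment> \<open>The entry is \<open>\<langle>\<phi>\<^sub>k, T \<psi>\<^sub>l\<rangle>\<close> with \<open>\<phi>\<^sub>k\<close> on \<open>S2\<close> and \<open>\<psi>\<^sub>l\<close> on \<open>S1\<close>; expanding \<open>T\<close> gives the product.\<close>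
  have \<Psi>\<Phi>: "(\<integral>w. \<Psi> k w * \<Phi> w l \<partial>M1) = (\<Sum>m. L k m * N m l)" for k l
  proof -
    let ?c = "of_real (sqrt (s k) * sqrt (s l)) :: complex"
    have "(\<integral>w. \<Psi> k w * \<Phi> w l \<partial>M1) = (\<integral>w. indicator S1 w * (\<Psi> k w * \<Phi> w l) \<partial>M)"
      unfolding M1_def by (rule integral_restrict_space_mult[OF S1])
    also have "\<dots> = (\<integral>w. ?c * (\<Psi>0 k w * P True (\<psi> l) w) \<partial>M)"
      by (rule Bochner_Integration.integral_cong) (simp_all add: \<Psi>_def \<Phi>_def P_def mult_ac)
    also have "\<dots> = ?c * L2_inner M (P False (\<phi> k)) (T (P True (\<psi> l)))"
      by (simp add: \<Psi>0_pairing[OF P_L2[OF \<psi>]])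
    finally have e: "(\<integral>w. \<Psi> k w * \<Phi> w l \<partial>M1) = ?c * L2_inner M (P False (\<phi> k)) (T (P True (\<psi> l)))" .
    have "(\<lambda>m. ?c * (of_real (s m) * L2_inner M (\<phi> m) (P True (\<psi> l)) * L2_inner M (P False (\<phi> k)) (\<psi> m))) sums
        (?c * L2_inner M (P False (\<phi> k)) (T (P True (\<psi> l))))"
      by (intro sums_mult inner_T_sums P_L2 \<phi> \<psi>)
    moreover have "?c * (of_real (s m) * L2_inner M (\<phi> m) (P True (\<psi> l)) * L2_inner M (P False (\<phi> k)) (\<psi> m)) = L k m * N m l" for m
    proof -
      have s: "of_real (s m) = (of_real (sqrt (s m)) * of_real (sqrt (s m)) :: complex)"
        using s_nonneg[of m] by (simp only: of_real_mult[symmetric]) simp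
      have 1: "L2_inner M (P True (\<phi> m)) (P True (\<psi> l)) = L2_inner M (\<phi> m) (P True (\<psi> l))"
        by (simp only: P_self_adjoint P_idem)
      have 2: "L2_inner M (P False (\<phi> k)) (P False (\<psi> m)) = L2_inner M (P False (\<phi> k)) (\<psi> m)"
        by (simp only: P_self_adjoint[symmetric] P_idem)
      show ?thesis unfolding L_def N_def 1 2 s of_real_mult by (simp only: mult_ac)
    qed
    ultimately show ?thesis unfolding e by (simp add: sums_iff)
  qed
  have \<Phi>\<Psi>: "(\<integral>k. \<Phi> u k * \<Psi> k w \<partial>?C) = Gt u w"
    if u: "summable (\<lambda>k. s k * (norm (\<psi> k u))\<^sup>2)" "AE v in M. Ht u v = F u v" "u \<in> space M"
      and w: "(\<lambda>v. Ht v w) \<in> L2 M" for u w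
  proof -
    let ?f = "P False (\<lambda>v. Ht v w)"
    have f: "?f \<in> L2 M" by (rule P_L2[OF w])
    have eq: "\<Phi> u k * \<Psi> k w = of_real (s k) * \<psi> k u * L2_inner M (\<phi> k) ?f" for k
    proof -
      have s: "of_real (s k) = (of_real (sqrt (s k)) * of_real (sqrt (s k)) :: complex)"
        using s_nonneg[of k] by (simp only: of_real_mult[symmetric]) simp
      show ?thesis unfolding \<Phi>_def \<Psi>_def \<Psi>0_def s P_self_adjoint by (simp only: mult_ac)
    qed
    have "summable (\<lambda>k. (s k + s k * (norm (\<psi> k u))\<^sup>2) * L2_norm M ?f)"
      by (intro summable_mult2 summable_add s_summable u)
    then have "summable (\<lambda>k. norm (\<Phi> u k * \<Psi> k w))"
    proof (rule summable_comparison_test')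
      fix k
      have "norm (\<psi> k u) \<le> 1 + (norm (\<psi> k u))\<^sup>2"
        using sum_squares_bound[of 1 "norm (\<psi> k u)"] norm_ge_zero[of "\<psi> k u"]
        unfolding mult_1_right power_one by linarith
      from mult_left_mono[OF this s_nonneg[of k]]
      have "s k * norm (\<psi> k u) \<le> s k + s k * (norm (\<psi> k u))\<^sup>2" by (simp add: distrib_left)
      then have "s k * norm (\<psi> k u) * norm (L2_inner M (\<phi> k) ?f) \<le> (s k + s k * (norm (\<psi> k u))\<^sup>2) * L2_norm M ?f"
        by (intro mult_mono inner_le f add_nonneg_nonneg mult_nonneg_nonneg s_nonneg) simp_all
      then show "norm (norm (\<Phi> u k * \<Psi> k w)) \<le> (s k + s k * (norm (\<psi> k u))\<^sup>2) * L2_norm M ?f"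
        unfolding eq by (simp add: norm_mult s_nonneg)
    qed
    then have "integrable ?C (\<lambda>k. \<Phi> u k * \<Psi> k w)" by (simp add: integrable_count_space_nat_iff)
    then have "(\<integral>k. \<Phi> u k * \<Psi> k w \<partial>?C) = (\<Sum>k. \<Phi> u k * \<Psi> k w)" by (rule integral_count_space_nat)
    also have "\<dots> = (\<integral>v. F u v * ?f v \<partial>M)"
      using F_integral(2)[OF u(1) f] unfolding eq by (simp add: sums_iff)
    also have "\<dots> = Gt u w"
      unfolding Gt_def
    proof (rule integral_cong_AE)
      show "(\<lambda>v. F u v * ?f v) \<in> borel_measurable M"
        by (rule borel_measurable_integrable[OF F_integral(1)[OF u(1) f]])
      have "(\<lambda>v. Ht u v) \<in> borel_measurable M" using u(3) by measurable
      then show "(\<lambda>v. Ht u v * ?f v) \<in> borel_measurable M" using L2_D(1)[OF f] by measurable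
      show "AE v in M. F u v * ?f v = Ht u v * ?f v" using u(2) by eventually_elim simp
    qed
    finally show ?thesis .
  qed
  have G: "kernel_prod M2 \<tau> H H u w * \<tau> w = Gt u w" for u w
  proof -
    have "kernel_prod M2 \<tau> H H u w * \<tau> w = (\<integral>v. indicator S2 v * (H u v * H v w * \<tau> v) \<partial>M) * \<tau> w"
      unfolding kernel_prod_def M2_def by (simp only: integral_restrict_space_mult[OF S2])
    also have "\<dots> = (\<integral>v. indicator S2 v * (H u v * H v w * \<tau> v) * \<tau> w \<partial>M)" by simp
    also have "\<dots> = Gt u w"
      unfolding Gt_def by (rule Bochner_Integration.integral_cong) (simp_all add: P_def Ht_def mult_ac)
    finally show ?thesis .
  qed
  have comp: "(\<lambda>u. u i) \<in> measurable (PiM {..<n} (\<lambda>_. M1)) M" if "i < n" for i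
  proof (rule measurable_compose[of _ _ M1])
    show "(\<lambda>u. u i) \<in> measurable (PiM {..<n} (\<lambda>_. M1)) M1"
      by (rule measurable_component_singleton) (use that in simp)
    show "(\<lambda>x. x) \<in> measurable M1 M" unfolding M1_def by (rule measurable_restrict_space1) simp
  qed
  have mG: "(\<lambda>u. perm_det {..<n} (\<lambda>i j. Gt (u i) (u j))) \<in> borel_measurable (PiM {..<n} (\<lambda>_. M1))"
    unfolding perm_det_def
    by (intro borel_measurable_sum borel_measurable_times borel_measurable_const borel_measurable_prod
        measurable_kernel_comp[OF Gt_measurable] comp) (auto dest: permutes_lessThan)
  have restr: "AE x in M1. Q x" if "AE x in M. Q x" for Q
    unfolding M1_def using that S1 by (subst AE_restrict_space_iff) (auto elim: eventually_mono)
  have "AE u in M1. summable (\<lambda>k. s k * (norm (\<psi> k u))\<^sup>2) \<and> (AE v in M. Ht u v = F u v) \<and> (\<lambda>v. Ht v u) \<in> L2 M"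
    using restr[OF AE_weights_summable(1)] restr[OF kernel_eq_series] restr[OF AE_Ht_section]
    by eventually_elim (intro conjI)
  from AE_PiM_lessThan[OF sM1 this, of n]
  have ae: "AE u in PiM {..<n} (\<lambda>_. M1). perm_det {..<n} (\<lambda>i j. Gt (u i) (u j)) =
      perm_det {..<n} (\<lambda>i j. \<integral>k. \<Phi> (u i) k * \<Psi> k (u j) \<partial>?C)"
    using AE_space[of "PiM {..<n} (\<lambda>_. M1)"]
  proof eventually_elim
    case (elim u)
    show ?case
    proof (rule perm_det_cong)
      fix i j assume "i \<in> {..<n}" "j \<in> {..<n}"
      then show "Gt (u i) (u j) = (\<integral>k. \<Phi> (u i) k * \<Psi> k (u j) \<partial>?C)"
        using elim(1)[rule_format, of i] elim(1)[rule_format, of j] space_PiM_lessThan[OF elim(2), of i] spM1 S1M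
        by (subst \<Phi>\<Psi>) auto
    qed
  qed
  have "(\<integral>u. fredholm_integrand \<tau> (kernel_prod M2 \<tau> H H) n u \<partial>PiM {..<n} (\<lambda>_. M1)) =
      (\<integral>u. perm_det {..<n} (\<lambda>i j. Gt (u i) (u j)) \<partial>PiM {..<n} (\<lambda>_. M1))"
    unfolding fredholm_integrand_eq_perm_det G ..
  also have "\<dots> = (\<integral>u. perm_det {..<n} (\<lambda>i j. \<integral>k. \<Phi> (u i) k * \<Psi> k (u j) \<partial>?C) \<partial>PiM {..<n} (\<lambda>_. M1))"
    by (rule integral_cong_AE[OF mG borel_measurable_integrable[OF swap(1)] ae])
  also have "\<dots> = (\<integral>x. perm_det {..<n} (\<lambda>i j. \<Sum>m. L (x i) m * N m (x j)) \<partial>PiM {..<n} (\<lambda>_. count_space UNIV))"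
    unfolding swap(2) \<Psi>\<Phi> ..
  finally show ?thesis .
qed

theorem ext_power_trace_fredholm:
  assumes E: "L2_onb M E"
  defines "M1 \<equiv> restrict_space M S1" and "M2 \<equiv> restrict_space M S2"
  shows "ext_power_trace M E T (2 * n) = fredholm_term M1 \<tau> (kernel_prod M2 \<tau> H H) n"
    and "ext_power_trace M E T (2 * n + 1) = 0"
proof -
  have LN: "norm (L k l) \<le> sqrt (s k) * sqrt (s l)" "norm (N k l) \<le> sqrt (s k) * sqrt (s l)" for k l
    unfolding L_def N_def by (rule weighted_inner_bound)+
  note off = offdiag_integral[OF s_nonneg s_summable LN]
  show "ext_power_trace M E T (2 * n) = fredholm_term M1 \<tau> (kernel_prod M2 \<tau> H H) n"
    unfolding ext_power_trace_eq[OF E] off(1) fredholm_term_def M1_def M2_def fredholm_integral_eq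
    by simp
  show "ext_power_trace M E T (2 * n + 1) = 0"
    unfolding ext_power_trace_eq[OF E] off(2) by simp
qed

text \<open>
  The two series differ by interspersed zeros, the traces of the odd exterior powers.  As this holds
  in every basis and there is a basis, the sum is the determinant.
\<close>

theorem fredholm_series_eq_det_one_minus:
  defines "M1 \<equiv> restrict_space M S1" and "M2 \<equiv> restrict_space M S2"
  assumes sm: "summable (fredholm_term M1 \<tau> (kernel_prod M2 \<tau> H H))"
  shows "det_one_minus M T = fredholm_series M1 \<tau> (kernel_prod M2 \<tau> H H)"
proof -
  let ?t = "fredholm_term M1 \<tau> (kernel_prod M2 \<tau> H H)"
  have sums: "(\<lambda>n. (- 1) ^ n * ext_power_trace M E T n) sums suminf ?t" if E: "L2_onb M E" for E
  proof -
    let ?a = "\<lambda>n. (- 1) ^ n * ext_power_trace M E T n"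
    have even: "?a (2 * n) = ?t n" and odd: "?a (2 * n + 1) = 0" for n
      using ext_power_trace_fredholm[OF E, of n] by (simp_all add: M1_def M2_def)
    have "(\<lambda>n. ?a (2 * n)) sums suminf ?t" unfolding even using sm by (rule summable_sums)
    moreover have "strict_mono (\<lambda>n::nat. 2 * n)" by (simp add: strict_mono_def)
    moreover have "?a n = 0" if "n \<notin> range (\<lambda>n. 2 * n)" for n
    proof -
      have "odd n" using that by (auto elim!: evenE)
      then obtain k where "n = 2 * k + 1" by (rule oddE)
      then show ?thesis using odd[of k] by simp
    qed
    ultimately show ?thesis using sums_mono_reindex[of "\<lambda>n. 2 * n" ?a "suminf ?t"] by simp
  qed
  obtain E0 where E0: "L2_onb M E0" using L2_onb_exists by blast
  show ?thesis
    unfolding det_one_minus_def fredholm_series_def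
  proof (rule the_equality)
    show "\<forall>E. L2_onb M E \<longrightarrow> (\<lambda>n. (- 1) ^ n * ext_power_trace M E T n) sums suminf ?t"
      by (intro allI impI sums)
    fix d assume "\<forall>E. L2_onb M E \<longrightarrow> (\<lambda>n. (- 1) ^ n * ext_power_trace M E T n) sums d"
    then have "(\<lambda>n. (- 1) ^ n * ext_power_trace M E0 T n) sums d" using E0 by (elim allE impE)
    with sums[OF E0] show "d = suminf ?t" by (rule sums_unique2[rotated])
  qed
qed

end

section \<open>The vectors \<open>f\<close> and \<open>g\<close>\<close>

text \<open>
  Every column of the \<open>(m + 1) \<times> 2m\<close> matrix \<open>big_mat m\<close> contains a single \<open>1\<close>.  In the columns \<open>i\<close> and \<open>m + i\<close> it is in
  the rows \<open>odd_index i\<close> and \<open>even_index m i\<close> (counted from \<open>1\<close>).  Subtracting \<open>E11\<close> from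
  \<open>Lambda2\<close> and repeating it below moves the entry of column \<open>m + 1\<close> from the first to the last row.
\<close>

definition odd_index :: "nat \<Rightarrow> nat" where
  "odd_index i = (if odd i then i else i - 1)"

definition even_index :: "nat \<Rightarrow> nat \<Rightarrow> nat" where
  "even_index m i = (if i = 1 then m + 1 else if even i then i else i - 1)"

lemma dim_diag_block_replicate:
  "dim_row (diag_block_mat (replicate k U_block @ Bs)) = 2 * k + dim_row (diag_block_mat Bs)"
  "dim_col (diag_block_mat (replicate k U_block @ Bs)) = 2 * k + dim_col (diag_block_mat Bs)"
  by (induction k) (simp_all add: Let_def U_block_def mat_of_rows_list_def)

lemma U_block_index: "r < 2 \<Longrightarrow> j < 2 \<Longrightarrow> U_block $$ (r, j) = of_bool (r = 0)"
  by (auto simp: U_block_def mat_of_rows_list_def less_2_cases_iff)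

lemma diag_block_replicate_index:
  assumes "r < 2 * k + dim_row (diag_block_mat Bs)" "j < 2 * k + dim_col (diag_block_mat Bs)"
  shows "diag_block_mat (replicate k U_block @ Bs) $$ (r, j) =
    (if r < 2 * k \<or> j < 2 * k then of_bool (even r \<and> (j = r \<or> j = Suc r))
     else diag_block_mat Bs $$ (r - 2 * k, j - 2 * k))"
  using assms
proof (induction k arbitrary: r j)
  case 0 then show ?case by simp
next
  case (Suc k)
  have dimU: "dim_row U_block = 2" "dim_col U_block = 2" by (simp_all add: U_block_def mat_of_rows_list_def)
  let ?D = "diag_block_mat (replicate k U_block @ Bs)"
  have dimD: "dim_row ?D = 2 * k + dim_row (diag_block_mat Bs)" "dim_col ?D = 2 * k + dim_col (diag_block_mat Bs)"
    by (rule dim_diag_block_replicate)+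
  have "diag_block_mat (replicate (Suc k) U_block @ Bs) $$ (r, j) =
      (if r < 2 then if j < 2 then U_block $$ (r, j) else 0 else if j < 2 then 0 else ?D $$ (r - 2, j - 2))"
    using Suc.prems by (simp add: Let_def dimU dimD)
  also have "\<dots> = (if r < 2 * Suc k \<or> j < 2 * Suc k then of_bool (even r \<and> (j = r \<or> j = Suc r))
     else diag_block_mat Bs $$ (r - 2 * Suc k, j - 2 * Suc k))"
  proof (cases "r < 2 \<or> j < 2")
    case True
    then show ?thesis by (auto simp: U_block_index less_2_cases_iff)
  next
    case False
    then have "?D $$ (r - 2, j - 2) = (if r - 2 < 2 * k \<or> j - 2 < 2 * k
        then of_bool (even (r - 2) \<and> (j - 2 = r - 2 \<or> j - 2 = Suc (r - 2)))
        else diag_block_mat Bs $$ (r - 2 - 2 * k, j - 2 - 2 * k))"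
      using Suc.prems by (intro Suc.IH) auto
    moreover obtain r' j' where "r = r' + 2" "j = j' + 2" using False by (metis add.commute le_Suc_ex not_less)
    ultimately show ?thesis by simp
  qed
  finally show ?case .
qed

lemma Lambda1_dim: "dim_row (Lambda1 m) = m" "dim_col (Lambda1 m) = m"
  using dim_diag_block_replicate[of "m div 2" "[]"] dim_diag_block_replicate[of "m div 2" "[1\<^sub>m 1]"]
  by (auto simp: Lambda1_def Let_def elim: oddE)

lemma Lambda1_index:
  assumes "r < m" "j < m"
  shows "Lambda1 m $$ (r, j) = of_bool (Suc r = odd_index (Suc j))"
proof -
  have *: "of_bool (even r \<and> (j = r \<or> j = Suc r)) = (of_bool (Suc r = odd_index (Suc j)) :: complex)"
  proof -
    have "even r \<and> (j = r \<or> j = Suc r) \<longleftrightarrow> Suc r = odd_index (Suc j)"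
      unfolding odd_index_def by presburger
    then show ?thesis by simp
  qed
  show ?thesis
  proof (cases "even m")
    case True
    then show ?thesis using assms diag_block_replicate_index[of r "m div 2" "[]" j] by (simp add: Lambda1_def *[symmetric])
  next
    case False
    then have m: "m = 2 * (m div 2) + 1" by (auto elim: oddE)
    have d: "dim_row (diag_block_mat [1\<^sub>m 1 :: complex mat]) = 1" "dim_col (diag_block_mat [1\<^sub>m 1 :: complex mat]) = 1"
      by (simp_all add: Let_def)
    have one: "diag_block_mat [1\<^sub>m 1 :: complex mat] $$ (0, 0) = 1" by (simp add: Let_def)
    have L1: "Lambda1 m = diag_block_mat (replicate (m div 2) U_block @ [1\<^sub>m 1])"
      using False by (simp add: Lambda1_def)
    have "Lambda1 m $$ (r, j) = (if r < 2 * (m div 2) \<or> j < 2 * (m div 2) then of_bool (even r \<and> (j = r \<or> j = Suc r))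
       else diag_block_mat [1\<^sub>m 1] $$ (r - 2 * (m div 2), j - 2 * (m div 2)))"
      unfolding L1 by (rule diag_block_replicate_index; subst d) (use assms m in linarith)+
    also have "\<dots> = of_bool (even r \<and> (j = r \<or> j = Suc r))"
    proof (cases "r < 2 * (m div 2) \<or> j < 2 * (m div 2)")
      case False
      then have "r = 2 * (m div 2)" "j = 2 * (m div 2)" using assms m by linarith+
      then show ?thesis by (simp add: one del: diag_block_mat.simps)
    qed simp
    finally show ?thesis unfolding * .
  qed
qed

text \<open>
  \<open>Lambda2\<close> is \<open>Lambda1\<close> of smaller size, shifted by one along the diagonal; the corner entry is
  cancelled by \<open>E11\<close>.
\<close>

lemma Lambda2_minus_E11_index:
  assumes "r < m" "j < m"
  shows "(Lambda2 m - E11 m) $$ (r, j) = of_bool (Suc r = even_index m (Suc j))"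
proof -
  have m1: "m \<ge> 1" using assms by simp
  have E: "(Lambda2 m - E11 m) $$ (r, j) = Lambda2 m $$ (r, j) - of_bool (r = 0 \<and> j = 0)"
    using assms by (simp add: E11_def mat_diag_def)
  define k Bs where "k = (if even m then m div 2 - 1 else m div 2)" and "Bs = (if even m then [1\<^sub>m 1] else [] :: complex mat list)"
  let ?D = "diag_block_mat (replicate k U_block @ Bs)"
  have L: "Lambda2 m = diag_block_mat (1\<^sub>m 1 # (replicate k U_block @ Bs))"
    by (simp add: Lambda2_def k_def Bs_def)
  have dB: "dim_row (diag_block_mat Bs) = (if even m then 1 else 0)" "dim_col (diag_block_mat Bs) = (if even m then 1 else 0)"
    by (simp_all add: Bs_def Let_def)
  have mk: "m = Suc (2 * k + (if even m then 1 else 0))"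
    using m1 by (auto simp: k_def elim!: evenE oddE)
  have dD: "dim_row ?D = m - 1" "dim_col ?D = m - 1"
    using mk by (simp_all only: dim_diag_block_replicate dB)
  have "Lambda2 m $$ (r, j) = (if r < 1 then if j < 1 then 1 else 0 else if j < 1 then 0 else ?D $$ (r - 1, j - 1))"
    using assms unfolding L by (simp add: Let_def dD)
  moreover have "?D $$ (r - 1, j - 1) = of_bool (even (r - 1) \<and> (j - 1 = r - 1 \<or> j - 1 = Suc (r - 1)))" if "r \<ge> 1" "j \<ge> 1"
  proof -
    have "?D $$ (r - 1, j - 1) = (if r - 1 < 2 * k \<or> j - 1 < 2 * k then of_bool (even (r - 1) \<and> (j - 1 = r - 1 \<or> j - 1 = Suc (r - 1)))
        else diag_block_mat Bs $$ (r - 1 - 2 * k, j - 1 - 2 * k))"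
      by (rule diag_block_replicate_index; subst dB) (use that assms mk in linarith)+
    also have "\<dots> = of_bool (even (r - 1) \<and> (j - 1 = r - 1 \<or> j - 1 = Suc (r - 1)))"
    proof (cases "r - 1 < 2 * k \<or> j - 1 < 2 * k")
      case False
      have em: "even m" using False assms mk that by (auto split: if_splits)
      then have "r - 1 = 2 * k" "j - 1 = 2 * k" using assms mk that False by (auto split: if_splits)
      moreover have "diag_block_mat Bs $$ (0, 0) = 1" using em by (simp add: Bs_def Let_def)
      ultimately show ?thesis by simp
    qed simp
    finally show ?thesis .
  qed
  ultimately have "(Lambda2 m - E11 m) $$ (r, j) =
      (if r < 1 \<or> j < 1 then 0 else of_bool (even (r - 1) \<and> (j - 1 = r - 1 \<or> j - 1 = Suc (r - 1))))"
    unfolding E by auto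
  also have "\<dots> = of_bool (Suc r = even_index m (Suc j))"
  proof (cases "r < 1 \<or> j < 1")
    case True
    then show ?thesis using assms by (auto simp: even_index_def)
  next
    case False
    then obtain r' j' where rj: "r = Suc r'" "j = Suc j'" by (metis One_nat_def less_one not0_implies_Suc)
    have "even r' \<and> (j' = r' \<or> j' = Suc r') \<longleftrightarrow>
        Suc (Suc r') = (if even (Suc (Suc j')) then Suc (Suc j') else Suc j')" by presburger
    then show ?thesis unfolding rj by (simp add: even_index_def)
  qed
  finally show ?thesis .
qed

lemma big_mat_dim:
  "dim_row (big_mat m) = m + 1" "dim_col (big_mat m) = 2 * m"
  by (simp_all add: big_mat_def P_mat_def Lambda1_dim E11_def mat_diag_def)

text \<open>
  Multiplication by \<open>P_mat m\<close> from the left keeps the first \<open>m + 1\<close> rows.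
\<close>

lemma big_mat_index:
  assumes m: "m \<ge> 1" and r: "r < m + 1" and i: "i \<in> {1..m}"
  shows "big_mat m $$ (r, i - 1) = of_bool (Suc r = odd_index i)"
    and "big_mat m $$ (r, m + (i - 1)) = of_bool (Suc r = even_index m i)"
proof -
  let ?F = "four_block_mat (Lambda1 m) (Lambda2 m - E11 m) (0\<^sub>m m m) (E11 m)"
  have dF: "dim_row ?F = 2 * m" "dim_col ?F = 2 * m"
    by (simp_all add: Lambda1_dim E11_def mat_diag_def)
  have P: "big_mat m $$ (r, j) = ?F $$ (r, j)" if j: "j < 2 * m" for j
  proof -
    have "big_mat m $$ (r, j) = scalar_prod (Matrix.row (P_mat m) r) (Matrix.col ?F j)"
      unfolding big_mat_def by (rule index_mult_mat(1)) (use r j dF in \<open>simp_all add: P_mat_def\<close>)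
    also have "\<dots> = (\<Sum>k<2 * m. Matrix.row (P_mat m) r $ k * Matrix.col ?F j $ k)"
      by (simp only: scalar_prod_def dim_col dF lessThan_atLeast0)
    also have "\<dots> = (\<Sum>k<2 * m. (if r = k then 1 else 0) * ?F $$ (k, j))"
    proof (intro sum.cong refl arg_cong2[where f="(*)"])
      fix k assume "k \<in> {..<2 * m}"
      then have k: "k < 2 * m" by simp
      show "Matrix.row (P_mat m) r $ k = (if r = k then 1 else 0)" using r k by (simp add: P_mat_def)
      show "Matrix.col ?F j $ k = ?F $$ (k, j)" by (rule index_col) (use k j dF in simp_all)
    qed
    also have "\<dots> = (\<Sum>k<2 * m. if k = r then ?F $$ (k, j) else 0)" by (intro sum.cong) auto
    also have "\<dots> = ?F $$ (r, j)" using r m by simp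
    finally show ?thesis .
  qed
  have lt: "i - 1 < 2 * m" "m + (i - 1) < 2 * m" using i m by auto
  have odd_le: "odd_index i \<le> m" using i by (auto simp: odd_index_def)
  have "?F $$ (r, i - 1) = (if r < m then Lambda1 m $$ (r, i - 1) else 0)"
    using r i m by (subst index_mat_four_block(1)) (auto simp: Lambda1_dim E11_def mat_diag_def)
  also have "\<dots> = of_bool (Suc r = odd_index i)"
    using i odd_le Lambda1_index[of r m "i - 1"] by auto
  finally show "big_mat m $$ (r, i - 1) = of_bool (Suc r = odd_index i)"
    unfolding P[OF lt(1)] .
  have "?F $$ (r, m + (i - 1)) = (if r < m then (Lambda2 m - E11 m) $$ (r, i - 1) else E11 m $$ (r - m, i - 1))"
    using r i m by (subst index_mat_four_block(1)) (auto simp: Lambda1_dim E11_def mat_diag_def)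
  also have "\<dots> = of_bool (Suc r = even_index m i)"
  proof (cases "r < m")
    case True
    have "i - 1 < m" "Suc (i - 1) = i" using i by auto
    then show ?thesis using True Lambda2_minus_E11_index[of r m "i - 1"] by simp
  next
    case False
    then have "r = m" using r by simp
    then show ?thesis using i by (auto simp: E11_def mat_diag_def even_index_def)
  qed
  finally show "big_mat m $$ (r, m + (i - 1)) = of_bool (Suc r = even_index m i)"
    unfolding P[OF lt(2)] .
qed

lemma mult_mat_vec_index:
  "r < dim_row A \<Longrightarrow> dim_col A = n \<Longrightarrow> dim_vec v = n \<Longrightarrow>
    (A *\<^sub>v v) $ r = (\<Sum>k<n. A $$ (r, k) * v $ k)"
  by (simp add: scalar_prod_def lessThan_atLeast0)

lemma mat_diag_mult_vec_index:
  assumes "r < n" "dim_vec v = n"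
  shows "(mat_diag n f *\<^sub>v v) $ r = f r * v $ r"
proof -
  have "(mat_diag n f *\<^sub>v v) $ r = (\<Sum>k<n. mat_diag n f $$ (r, k) * v $ k)"
    by (rule mult_mat_vec_index) (use assms in \<open>simp_all add: mat_diag_def\<close>)
  also have "\<dots> = (\<Sum>k<n. if k = r then f r * v $ r else 0)"
    by (intro sum.cong refl) (use assms(1) in \<open>simp add: mat_diag_def\<close>)
  also have "\<dots> = f r * v $ r" using assms(1) by simp
  finally show ?thesis .
qed

locale block_sets =
  fixes m :: nat and \<Omega> :: "nat \<Rightarrow> nat \<Rightarrow> complex set"
    and A B ms :: "nat \<Rightarrow> complex \<Rightarrow> complex" and c :: "complex \<Rightarrow> complex"
  assumes m: "m \<ge> 1"
    and disjoint: "disjoint_family_on (\<lambda>(l, j). \<Omega> l j) ({1, 2} \<times> {1..m})"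
    and ms_nonzero: "\<And>j z. j \<in> {1..m} \<Longrightarrow> z \<in> Omega_total m \<Omega> \<Longrightarrow> ms j z \<noteq> 0"
    and c_nonzero: "\<And>z. z \<in> Omega_total m \<Omega> \<Longrightarrow> c z \<noteq> 0"
begin

lemma block_unique:
  assumes "z \<in> \<Omega> l i" "z \<in> \<Omega> l' i'" "l \<in> {1, 2}" "l' \<in> {1, 2}" "i \<in> {1..m}" "i' \<in> {1..m}"
  shows "l' = l" "i' = i"
proof -
  have "(l', i') = (l, i)"
  proof (rule ccontr)
    assume "(l', i') \<noteq> (l, i)"
    moreover have "(l', i') \<in> {1, 2} \<times> {1..m}" "(l, i) \<in> {1, 2} \<times> {1..m}" using assms by simp_all
    ultimately have "(\<lambda>(l, j). \<Omega> l j) (l', i') \<inter> (\<lambda>(l, j). \<Omega> l j) (l, i) = {}"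
      by (intro disjoint[unfolded disjoint_family_on_def, rule_format])
    then have "\<Omega> l' i' \<inter> \<Omega> l i = {}" by simp
    then show False using assms by blast
  qed
  then show "l' = l" "i' = i" by simp_all
qed

lemma indicator_block:
  assumes "z \<in> \<Omega> l i" "l \<in> {1, 2}" "l' \<in> {1, 2}" "i \<in> {1..m}" "i' \<in> {1..m}"
  shows "indicator (\<Omega> l' i') z = (of_bool (l' = l \<and> i' = i) :: complex)"
proof (cases "z \<in> \<Omega> l' i'")
  case True
  from block_unique[OF assms(1) this assms(2-5)] show ?thesis using True by (simp add: indicator_def)
next
  case False
  then have "\<not> (l' = l \<and> i' = i)" using assms(1) by blast
  then show ?thesis using False by (simp add: indicator_def)
qed

text \<open>
  By disjointness the stacked vector is a multiple of a unit vector, so the product is a column of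
  \<open>big_mat m\<close>.  Stated for \<open>D\<close> and \<open>l1, l2\<close> in order to cover both \<open>U\<close> and \<open>V\<close>.
\<close>

lemma mult_selected_column:
  assumes z: "z \<in> \<Omega> l i" "l \<in> {1, 2}" "i \<in> {1..m}" and l': "{l1, l2} = {1, 2}" "l1 \<noteq> l2" and r: "r < m + 1"
  shows "(big_mat m *\<^sub>v ((diag_fun m D z * X_mat m \<Omega> l1 z *\<^sub>v ones_vec m) @\<^sub>v
      (diag_fun m D z * X_mat m \<Omega> l2 z *\<^sub>v ones_vec m))) $ r =
    D i z * of_bool (Suc r = (if l = l1 then odd_index i else even_index m i))"
proof -
  have mask: "(diag_fun m D z * X_mat m \<Omega> l' z *\<^sub>v ones_vec m) $ j = D (Suc j) z * of_bool (l' = l \<and> Suc j = i)"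
    if "j < m" "l' \<in> {1, 2}" for l' j
  proof -
    have "diag_fun m D z * X_mat m \<Omega> l' z = mat_diag m (\<lambda>j. D (Suc j) z * indicator (\<Omega> l' (Suc j)) z)"
      unfolding diag_fun_def X_mat_def by (rule mat_diag_diag)
    then have e: "(diag_fun m D z * X_mat m \<Omega> l' z *\<^sub>v ones_vec m) $ j = D (Suc j) z * indicator (\<Omega> l' (Suc j)) z"
      using mat_diag_mult_vec_index[OF that(1), of "ones_vec m"] that(1) by (simp add: ones_vec_def)
    show ?thesis unfolding e using indicator_block[OF z(1,2) that(2) z(3), of "Suc j"] that by simp
  qed
  have l12: "l1 \<in> {1, 2}" "l2 \<in> {1, 2}" using l' by blast+
  have dims: "dim_vec (diag_fun m D z * X_mat m \<Omega> l' z *\<^sub>v ones_vec m) = m" for l'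
    by (simp add: diag_fun_def mat_diag_def)
  let ?v = "(diag_fun m D z * X_mat m \<Omega> l1 z *\<^sub>v ones_vec m) @\<^sub>v (diag_fun m D z * X_mat m \<Omega> l2 z *\<^sub>v ones_vec m)"
  let ?j = "if l = l1 then i - 1 else m + (i - 1)"
  have v: "?v $ k = (if k = ?j then D i z else 0)" if k: "k < 2 * m" for k
  proof (cases "k < m")
    case True
    then have E: "?v $ k = D (Suc k) z * of_bool (l1 = l \<and> Suc k = i)"
    proof -
      have "k < dim_vec (diag_fun m D z * X_mat m \<Omega> l1 z *\<^sub>v ones_vec m) +
          dim_vec (diag_fun m D z * X_mat m \<Omega> l2 z *\<^sub>v ones_vec m)"
        unfolding dims using k by simp
      then have "?v $ k = (diag_fun m D z * X_mat m \<Omega> l1 z *\<^sub>v ones_vec m) $ k"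
        by (simp only: index_append_vec(1) dims True if_True)
      then show ?thesis using mask[OF True l12(1)] by simp
    qed
    show ?thesis unfolding E using True z(3) by auto
  next
    case False
    have E: "?v $ k = D (Suc (k - m)) z * of_bool (l2 = l \<and> Suc (k - m) = i)"
    proof -
      have "k < dim_vec (diag_fun m D z * X_mat m \<Omega> l1 z *\<^sub>v ones_vec m) +
          dim_vec (diag_fun m D z * X_mat m \<Omega> l2 z *\<^sub>v ones_vec m)"
        unfolding dims using k by simp
      then have "?v $ k = (diag_fun m D z * X_mat m \<Omega> l2 z *\<^sub>v ones_vec m) $ (k - m)"
        by (simp only: index_append_vec(1) dims False if_False)
      then show ?thesis using mask[of "k - m", OF _ l12(2)] k False by simp
    qed
    have "l2 = l \<longleftrightarrow> l \<noteq> l1" using z(2) unfolding l'(1)[symmetric] using l'(2) by blast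
    moreover have "Suc (k - m) = i \<longleftrightarrow> k = m + (i - 1)" using False z(3) by auto
    moreover have "k \<noteq> i - 1" using False z(3) by auto
    moreover have "Suc (i - 1) = i" using z(3) by simp
    ultimately show ?thesis unfolding E by (cases "l = l1") (simp_all del: One_nat_def)
  qed
  have "(big_mat m *\<^sub>v ?v) $ r = (\<Sum>k<2 * m. big_mat m $$ (r, k) * ?v $ k)"
  proof (rule mult_mat_vec_index)
    show "dim_vec ?v = 2 * m" unfolding index_append_vec(2) dims by simp
  qed (use r in \<open>simp_all add: big_mat_dim\<close>)
  also have "\<dots> = (\<Sum>k<2 * m. if k = ?j then big_mat m $$ (r, k) * D i z else 0)"
    by (intro sum.cong refl) (use v in auto)
  also have "\<dots> = big_mat m $$ (r, ?j) * D i z" using z(3) by auto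
  also have "\<dots> = D i z * of_bool (Suc r = (if l = l1 then odd_index i else even_index m i))"
    using big_mat_index[OF m r z(3)] by auto
  finally show ?thesis .
qed

text \<open>
  The only component of \<open>f\<close> that may be nonzero on \<open>\<Omega> l i\<close>; for \<open>g\<close> it is \<open>row (3 - l) i\<close>, since \<open>3 - l\<close>
  exchanges \<open>1\<close> and \<open>2\<close>.
\<close>

definition row :: "nat \<Rightarrow> nat \<Rightarrow> nat" where
  "row l i = (if l = 1 then odd_index i else even_index m i)"

text \<open>
  The diagonal entries of \<open>\<Delta>\<close>, counted from \<open>1\<close>.
\<close>

definition \<delta> :: "nat \<Rightarrow> complex \<Rightarrow> complex" where
  "\<delta> k z = (if k \<le> m then ms k z else 1)"

lemma row_bounds: "i \<in> {1..m} \<Longrightarrow> 1 \<le> row l i \<and> row l i \<le> m + 1"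
  by (simp add: row_def odd_index_def even_index_def) presburger

lemma row_distinct: "i \<in> {1..m} \<Longrightarrow> j \<in> {1..m} \<Longrightarrow> odd_index i \<noteq> even_index m j"
  unfolding odd_index_def even_index_def by simp presburger

lemma f_vec_index:
  assumes z: "z \<in> \<Omega> l i" "l \<in> {1, 2}" "i \<in> {1..m}" and r: "r < m + 1"
  shows "f_vec m \<Omega> A ms c z $ r = of_bool (Suc r = row l i) * (c z * \<delta> (row l i) z * A i z)"
proof -
  have dU: "dim_vec (U_vec m \<Omega> A z) = m + 1" by (simp add: U_vec_def big_mat_dim)
  have U: "U_vec m \<Omega> A z $ k = A i z * of_bool (Suc k = row l i)" if "k < m + 1" for k
    unfolding U_vec_def row_def by (rule mult_selected_column[OF z _ _ that]) auto
  have "f_vec m \<Omega> A ms c z $ r = c z * (Delta_mat m ms z *\<^sub>v U_vec m \<Omega> A z) $ r"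
    unfolding f_vec_def by (rule index_smult_vec(1)) (use r in \<open>simp add: Delta_mat_def mat_diag_def\<close>)
  also have "(Delta_mat m ms z *\<^sub>v U_vec m \<Omega> A z) $ r = \<delta> (Suc r) z * U_vec m \<Omega> A z $ r"
    unfolding Delta_mat_def by (subst mat_diag_mult_vec_index[OF r dU]) (simp add: \<delta>_def)
  finally show ?thesis using U[OF r] by auto
qed

lemma g_vec_index:
  assumes z: "z \<in> \<Omega> l i" "l \<in> {1, 2}" "i \<in> {1..m}" and r: "r < m + 1"
  shows "g_vec m \<Omega> B ms c z $ r =
    of_bool (Suc r = row (3 - l) i) * (inverse (c z) * inverse (\<delta> (row (3 - l) i) z) * B i z)"
proof -
  have dV: "dim_vec (V_vec m \<Omega> B z) = m + 1" by (simp add: V_vec_def big_mat_dim)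
  have V: "V_vec m \<Omega> B z $ k = B i z * of_bool (Suc k = row (3 - l) i)" if "k < m + 1" for k
  proof -
    have "{2, 1} = {1, 2 :: nat}" by auto
    from mult_selected_column[OF z this _ that, of B]
    have "V_vec m \<Omega> B z $ k = B i z * of_bool (Suc k = (if l = 2 then odd_index i else even_index m i))"
      unfolding V_vec_def by simp
    then show ?thesis using z(2) by (auto simp: row_def)
  qed
  have "g_vec m \<Omega> B ms c z $ r = inverse (c z) * (Delta_inv_mat m ms z *\<^sub>v V_vec m \<Omega> B z) $ r"
    unfolding g_vec_def by (rule index_smult_vec(1)) (use r in \<open>simp add: Delta_inv_mat_def mat_diag_def\<close>)
  also have "(Delta_inv_mat m ms z *\<^sub>v V_vec m \<Omega> B z) $ r = inverse (\<delta> (Suc r) z) * V_vec m \<Omega> B z $ r"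
    unfolding Delta_inv_mat_def by (subst mat_diag_mult_vec_index[OF r dV]) (simp add: \<delta>_def)
  finally show ?thesis using V[OF r] by auto
qed

lemma Omega_total_blocks:
  assumes "z \<in> Omega_total m \<Omega>"
  obtains l i where "z \<in> \<Omega> l i" "l \<in> {1, 2}" "i \<in> {1..m}"
  using assms by (auto simp: Omega_total_def Omega_def)

theorem f_g_product_zero:
  assumes z: "z \<in> Omega_total m \<Omega>" and i: "i \<in> {1..m + 1}"
  shows "f_vec m \<Omega> A ms c z $ (i - 1) * g_vec m \<Omega> B ms c z $ (i - 1) = 0"
proof -
  obtain l k where k: "z \<in> \<Omega> l k" "l \<in> {1, 2}" "k \<in> {1..m}" using Omega_total_blocks[OF z] .
  have "row l k \<noteq> row (3 - l) k" using k(2) row_distinct[OF k(3) k(3)] by (auto simp: row_def)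
  then show ?thesis using f_vec_index[OF k, of "i - 1"] g_vec_index[OF k, of "i - 1"] i by auto
qed

lemma f_g_scalar_prod:
  assumes u: "u \<in> \<Omega> l i" "l \<in> {1, 2}" "i \<in> {1..m}" and v: "v \<in> \<Omega> l' j" "l' \<in> {1, 2}" "j \<in> {1..m}"
  shows "scalar_prod (f_vec m \<Omega> A ms c u) (g_vec m \<Omega> B ms c v) =
    of_bool (row l i = row (3 - l') j) *
      (c u * \<delta> (row l i) u * A i u * (inverse (c v) * inverse (\<delta> (row l i) v) * B j v))"
proof -
  let ?x = "c u * \<delta> (row l i) u * A i u" and ?y = "inverse (c v) * inverse (\<delta> (row (3 - l') j) v) * B j v"
  have dg: "dim_vec (g_vec m \<Omega> B ms c v) = m + 1" by (simp add: g_vec_def Delta_inv_mat_def mat_diag_def)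
  have "scalar_prod (f_vec m \<Omega> A ms c u) (g_vec m \<Omega> B ms c v) =
      (\<Sum>k<m + 1. f_vec m \<Omega> A ms c u $ k * g_vec m \<Omega> B ms c v $ k)"
    by (simp add: scalar_prod_def dg lessThan_atLeast0)
  also have "\<dots> = (\<Sum>k<m + 1. if k = row l i - 1 then of_bool (row l i = row (3 - l') j) * (?x * ?y) else 0)"
  proof (intro sum.cong refl)
    fix k assume "k \<in> {..<m + 1}"
    then have k: "k < m + 1" by simp
    show "f_vec m \<Omega> A ms c u $ k * g_vec m \<Omega> B ms c v $ k =
        (if k = row l i - 1 then of_bool (row l i = row (3 - l') j) * (?x * ?y) else 0)"
      unfolding f_vec_index[OF u k] g_vec_index[OF v k] using row_bounds[OF u(3), of l] by auto
  qed
  also have "\<dots> = of_bool (row l i = row (3 - l') j) * (?x * ?y)"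
  proof -
    have "row l i - 1 < m + 1" using row_bounds[OF u(3), of l] by linarith
    then show ?thesis by simp
  qed
  finally show ?thesis by (cases "row l i = row (3 - l') j") simp_all
qed

lemma H_diagonal_blocks:
  assumes "l \<in> {1, 2}" "u \<in> Omega m \<Omega> l" "v \<in> Omega m \<Omega> l"
  shows "H_kernel m \<Omega> A B ms c u v = 0"
proof -
  obtain i j where ij: "u \<in> \<Omega> l i" "i \<in> {1..m}" "v \<in> \<Omega> l j" "j \<in> {1..m}" using assms by (auto simp: Omega_def)
  have "row l i \<noteq> row (3 - l) j"
    using assms(1) row_distinct[OF ij(2,4)] row_distinct[OF ij(4,2)] by (auto simp: row_def)
  then show ?thesis using f_g_scalar_prod[OF ij(1) assms(1) ij(2,3) assms(1) ij(4)] by (simp add: H_kernel_def)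
qed

lemma H_off_diagonal_blocks:
  assumes "u \<in> \<Omega> l i" "l \<in> {1, 2}" "i \<in> {1..m}" "v \<in> \<Omega> (3 - l) j" "j \<in> {1..m}"
  shows "H_kernel m \<Omega> A B ms c u v = of_bool (row l i = row l j) *
      (c u * \<delta> (row l i) u * A i u * (inverse (c v) * inverse (\<delta> (row l i) v) * B j v)) / (u - v)"
proof -
  have l: "3 - l \<in> {1, 2}" "3 - (3 - l) = l" "3 - l \<noteq> l" using assms(2) by auto
  have "u \<noteq> v" using block_unique(1)[OF assms(1) _ assms(2) l(1) assms(3,5)] assms(4) l(3) by blast
  then show ?thesis using f_g_scalar_prod[OF assms(1-4) l(1) assms(5)] by (simp add: H_kernel_def l(2))
qed

text \<open>
  The exceptional case \<open>i = 1\<close> fits in because \<open>row 2 1 = m + 1\<close> and the last entry of \<open>\<Delta>\<close> is \<open>1\<close>.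
\<close>

lemma Mratio_eq: "i \<in> {1..m} \<Longrightarrow> Mratio ms i z = \<delta> (row 1 i) z / \<delta> (row 2 i) z"
  by (auto simp: Mratio_def \<delta>_def row_def odd_index_def even_index_def elim!: oddE evenE)

lemma odd_index_eq_iff:
  "1 \<le> i \<Longrightarrow> 1 \<le> j \<Longrightarrow> odd_index i = odd_index j \<longleftrightarrow> i = j \<or> (if even i then i = j + 1 else j = i + 1)"
  unfolding odd_index_def by presburger

lemma even_index_eq_iff:
  "1 \<le> i \<Longrightarrow> 1 \<le> j \<Longrightarrow> i \<le> m \<Longrightarrow> j \<le> m \<Longrightarrow>
    even_index m i = even_index m j \<longleftrightarrow> i = j \<or> (if even i then j = i + 1 else i = j + 1)"
proof (cases "i = 1 \<or> j = 1")
  case True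
  assume "1 \<le> i" "1 \<le> j" "i \<le> m" "j \<le> m"
  with True show ?thesis by (auto simp: even_index_def split: if_splits)
next
  case False
  assume "1 \<le> i" "1 \<le> j"
  then have "(if even i then i else i - 1) = (if even j then j else j - 1) \<longleftrightarrow>
      i = j \<or> (if even i then j = i + 1 else i = j + 1)"
    by presburger
  then show ?thesis using False by (simp add: even_index_def)
qed

text \<open>
  The Kronecker deltas select the pairs \<open>i, j\<close> that share a block \<open>U_block\<close> (or coincide) in \<open>Lambda1\<close>, resp.
  \<open>Lambda2\<close>.
\<close>

lemma kronecker_row:
  assumes "i \<in> {1..m}" "j \<in> {1..m}"
  shows "kronecker (int i) (int j) + kronecker (int i) (int j + (- 1) ^ i) = of_bool (row 1 i = row 1 j)"
    and "kronecker (int i) (int j) + kronecker (int i) (int j - (- 1) ^ i) = of_bool (row 2 i = row 2 j)"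
proof -
  have ij: "1 \<le> i" "1 \<le> j" "i \<le> m" "j \<le> m" using assms by simp_all
  have r1: "row 1 i = row 1 j \<longleftrightarrow> i = j \<or> (if even i then i = j + 1 else j = i + 1)"
    using odd_index_eq_iff[OF ij(1,2)] by (simp add: row_def)
  have r2: "row 2 i = row 2 j \<longleftrightarrow> i = j \<or> (if even i then j = i + 1 else i = j + 1)"
    using even_index_eq_iff[OF ij] by (simp add: row_def)
  have p: "(- 1) ^ i = (if even i then 1 else (- 1 :: int))" by simp
  have k1: "int i = int j + (- 1) ^ i \<longleftrightarrow> (if even i then i = j + 1 else j = i + 1)"
    unfolding p by (cases "even i") (simp_all, linarith+)
  have k2: "int i = int j - (- 1) ^ i \<longleftrightarrow> (if even i then j = i + 1 else i = j + 1)"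
    unfolding p by (cases "even i") (simp_all, linarith+)
  show "kronecker (int i) (int j) + kronecker (int i) (int j + (- 1) ^ i) = of_bool (row 1 i = row 1 j)"
    unfolding kronecker_def k1 r1 by (cases "i = j") simp_all
  show "kronecker (int i) (int j) + kronecker (int i) (int j - (- 1) ^ i) = of_bool (row 2 i = row 2 j)"
    unfolding kronecker_def k2 r2 by (cases "i = j") simp_all
qed

lemma double_sum_single:
  fixes F :: "nat \<Rightarrow> nat \<Rightarrow> complex"
  assumes "i \<in> {1..m}" "j \<in> {1..m}" "\<And>i' j'. i' \<in> {1..m} \<Longrightarrow> j' \<in> {1..m} \<Longrightarrow> (i', j') \<noteq> (i, j) \<Longrightarrow> F i' j' = 0"
  shows "(\<Sum>i'=1..m. \<Sum>j'=1..m. F i' j') = F i j"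
proof -
  have "(\<Sum>j'=1..m. F i' j') = (if i' = i then F i j else 0)" if "i' \<in> {1..m}" for i'
  proof -
    have "(\<Sum>j'=1..m. F i' j') = (\<Sum>j'=1..m. if j' = j then (if i' = i then F i j else 0) else 0)"
    proof (intro sum.cong refl)
      fix j' assume "j' \<in> {1..m}"
      from assms(3)[OF that this] show "F i' j' = (if j' = j then (if i' = i then F i j else 0) else 0)"
        by (cases "i' = i"; cases "j' = j") simp_all
    qed
    then show ?thesis using assms(2) by simp
  qed
  then have "(\<Sum>i'=1..m. \<Sum>j'=1..m. F i' j') = (\<Sum>i'=1..m. if i' = i then F i j else 0)"
    by (intro sum.cong refl)
  then show ?thesis using assms(1) by simp
qed

lemma conjugate_cancel:
  fixes a b d p q w x y :: complex
  assumes "x \<noteq> 0" "y \<noteq> 0" "d \<noteq> 0"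
  shows "p / q * a * b / w = inverse (x * q) * (x * p * a * (inverse y * inverse d * b) / w) * (y * d)"
  using assms by (cases "q = 0"; cases "w = 0") (simp_all add: field_simps)

text \<open>
  In the block \<open>\<Omega>\<^sub>1 \<times> \<Omega>\<^sub>2\<close> the kernel \<open>H\<close> carries, up to \<open>c\<close>, the factor \<open>\<delta>(row 1 i)(u) / \<delta>(row 1 j)(v)\<close>, whereas \<open>K\<^sub>1\<close> has
  \<open>\<delta>(row 1 i)(u) / \<delta>(row 2 i)(u)\<close>.  The quotient is a function of \<open>u\<close> times a function of \<open>v\<close>.
\<close>

lemma K1_conjugate:
  assumes u: "u \<in> \<Omega> 1 i" "i \<in> {1..m}" and v: "v \<in> \<Omega> 2 j" "j \<in> {1..m}"
  shows "K1_kernel m \<Omega> A B ms u v =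
    inverse (c u * \<delta> (row 2 i) u) * H_kernel m \<Omega> A B ms c u v * (c v * \<delta> (row 1 j) v)"
proof -
  have tot: "u \<in> Omega_total m \<Omega>" "v \<in> Omega_total m \<Omega>" using u v by (auto simp: Omega_total_def Omega_def)
  have \<delta>0: "\<delta> k z \<noteq> 0" if "1 \<le> k" "z \<in> Omega_total m \<Omega>" for k z using ms_nonzero[of k z] that by (auto simp: \<delta>_def)
  have iu: "indicator (\<Omega> 1 i') u = (of_bool (i' = i) :: complex)" if "i' \<in> {1..m}" for i'
    using indicator_block[OF u(1) _ _ u(2) that, of 1] by simp
  have iv: "indicator (\<Omega> 2 j') v = (of_bool (j' = j) :: complex)" if "j' \<in> {1..m}" for j'
    using indicator_block[OF v(1) _ _ v(2) that, of 2] by simp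
  have "K1_kernel m \<Omega> A B ms u v = of_bool (row 1 i = row 1 j) * (\<delta> (row 1 i) u / \<delta> (row 2 i) u * A i u * B j v / (u - v))"
    unfolding K1_kernel_def using u v
    by (subst double_sum_single[of i j]) (auto simp: iu iv kronecker_row(1)[OF u(2) v(2)] Mratio_eq simp del: One_nat_def)
  also have "\<dots> = inverse (c u * \<delta> (row 2 i) u) * H_kernel m \<Omega> A B ms c u v * (c v * \<delta> (row 1 j) v)"
  proof (cases "row 1 i = row 1 j")
    case True
    have "3 - 1 = (2::nat)" by simp
    then have H: "H_kernel m \<Omega> A B ms c u v =
        c u * \<delta> (row 1 i) u * A i u * (inverse (c v) * inverse (\<delta> (row 1 i) v) * B j v) / (u - v)"
      using H_off_diagonal_blocks[of u 1 i v j] u v True by simp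
    have "\<delta> (row 1 i) v \<noteq> 0" using \<delta>0[OF _ tot(2)] row_bounds[OF u(2)] by blast
    then show ?thesis
      unfolding H True[symmetric] using conjugate_cancel[OF c_nonzero[OF tot(1)] c_nonzero[OF tot(2)]] by simp
  next
    case False
    then show ?thesis using H_off_diagonal_blocks[of u 1 i v j] u v by simp
  qed
  finally show ?thesis .
qed

lemma K2_conjugate:
  assumes u: "u \<in> \<Omega> 2 i" "i \<in> {1..m}" and v: "v \<in> \<Omega> 1 j" "j \<in> {1..m}"
  shows "K2_kernel m \<Omega> A B ms u v =
    inverse (c u * \<delta> (row 1 i) u) * H_kernel m \<Omega> A B ms c u v * (c v * \<delta> (row 2 j) v)"
proof -
  have tot: "u \<in> Omega_total m \<Omega>" "v \<in> Omega_total m \<Omega>" using u v by (auto simp: Omega_total_def Omega_def)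
  have \<delta>0: "\<delta> k z \<noteq> 0" if "1 \<le> k" "z \<in> Omega_total m \<Omega>" for k z using ms_nonzero[of k z] that by (auto simp: \<delta>_def)
  have iu: "indicator (\<Omega> 2 i') u = (of_bool (i' = i) :: complex)" if "i' \<in> {1..m}" for i'
    using indicator_block[OF u(1) _ _ u(2) that, of 2] by simp
  have iv: "indicator (\<Omega> 1 j') v = (of_bool (j' = j) :: complex)" if "j' \<in> {1..m}" for j'
    using indicator_block[OF v(1) _ _ v(2) that, of 1] by simp
  have "K2_kernel m \<Omega> A B ms u v = of_bool (row 2 i = row 2 j) * (\<delta> (row 2 i) u / \<delta> (row 1 i) u * A i u * B j v / (u - v))"
    unfolding K2_kernel_def using u v
    by (subst double_sum_single[of i j]) (auto simp: iu iv kronecker_row(2)[OF u(2) v(2)] Mratio_eq simp del: One_nat_def)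
  also have "\<dots> = inverse (c u * \<delta> (row 1 i) u) * H_kernel m \<Omega> A B ms c u v * (c v * \<delta> (row 2 j) v)"
  proof (cases "row 2 i = row 2 j")
    case True
    have "3 - 2 = (1::nat)" by simp
    then have H: "H_kernel m \<Omega> A B ms c u v =
        c u * \<delta> (row 2 i) u * A i u * (inverse (c v) * inverse (\<delta> (row 2 i) v) * B j v) / (u - v)"
      using H_off_diagonal_blocks[of u 2 i v j] u v True by simp
    have "\<delta> (row 2 i) v \<noteq> 0" using \<delta>0[OF _ tot(2)] row_bounds[OF u(2)] by blast
    then show ?thesis
      unfolding H True[symmetric] using conjugate_cancel[OF c_nonzero[OF tot(1)] c_nonzero[OF tot(2)]] by simp
  next
    case False
    then show ?thesis using H_off_diagonal_blocks[of u 2 i v j] u v by simp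
  qed
  finally show ?thesis .
qed

text \<open>
  The conjugating functions on \<open>\<Omega>\<^sub>2\<close> in \<open>K1_conjugate\<close> and \<open>K2_conjugate\<close> are inverse to each other and
  cancel under the integral.
\<close>

theorem kernel_prod_conjugate:
  assumes M2: "space M2 = Omega m \<Omega> 2"
  shows "\<exists>a. (\<forall>u\<in>Omega m \<Omega> 1. a u \<noteq> 0) \<and> (\<forall>u\<in>Omega m \<Omega> 1. \<forall>w\<in>Omega m \<Omega> 1.
      kernel_prod M2 \<tau> (K1_kernel m \<Omega> A B ms) (K2_kernel m \<Omega> A B ms) u w =
      inverse (a u) * kernel_prod M2 \<tau> (H_kernel m \<Omega> A B ms c) (H_kernel m \<Omega> A B ms c) u w * a w)"
proof -
  define a where "a u = c u * \<delta> (row 2 (SOME i. i \<in> {1..m} \<and> u \<in> \<Omega> 1 i)) u" for u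
  have a: "a u = c u * \<delta> (row 2 i) u" if "u \<in> \<Omega> 1 i" "i \<in> {1..m}" for u i
  proof -
    have "(SOME i. i \<in> {1..m} \<and> u \<in> \<Omega> 1 i) = i"
    proof (rule some_equality)
      show "i \<in> {1..m} \<and> u \<in> \<Omega> 1 i" using that by blast
      fix i' assume "i' \<in> {1..m} \<and> u \<in> \<Omega> 1 i'"
      then show "i' = i" by (intro block_unique(2)[OF that(1), of 1]) (use that(2) in simp_all)
    qed
    then show ?thesis by (simp add: a_def)
  qed
  have \<delta>0: "\<delta> k z \<noteq> 0" if "1 \<le> k" "z \<in> Omega_total m \<Omega>" for k z using ms_nonzero[of k z] that by (auto simp: \<delta>_def)
  have cancel: "(p * q * x) * (inverse x * r * y) * t = p * (q * r * t) * y" if "x \<noteq> 0" for p q r t x y :: complex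
    using that by simp
  show ?thesis
  proof (intro exI[of _ a] conjI ballI)
    fix u assume "u \<in> Omega m \<Omega> 1"
    then obtain i where i: "u \<in> \<Omega> 1 i" "i \<in> {1..m}" by (auto simp: Omega_def)
    then have "u \<in> Omega_total m \<Omega>" by (auto simp: Omega_total_def Omega_def)
    then show "a u \<noteq> 0" using a[OF i] c_nonzero \<delta>0 row_bounds[OF i(2), of 2] by simp
  next
    fix u w assume "u \<in> Omega m \<Omega> 1" "w \<in> Omega m \<Omega> 1"
    then obtain i k where i: "u \<in> \<Omega> 1 i" "i \<in> {1..m}" and k: "w \<in> \<Omega> 1 k" "k \<in> {1..m}" by (auto simp: Omega_def)
    let ?H = "H_kernel m \<Omega> A B ms c"
    have "kernel_prod M2 \<tau> (K1_kernel m \<Omega> A B ms) (K2_kernel m \<Omega> A B ms) u w =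
        (\<integral>v. inverse (a u) * (?H u v * ?H v w * \<tau> v) * a w \<partial>M2)"
      unfolding kernel_prod_def
    proof (rule Bochner_Integration.integral_cong[OF refl])
      fix v assume "v \<in> space M2"
      then obtain j where j: "v \<in> \<Omega> 2 j" "j \<in> {1..m}" unfolding M2 by (auto simp: Omega_def)
      then have tot: "v \<in> Omega_total m \<Omega>" by (auto simp: Omega_total_def Omega_def)
      have "c v \<noteq> 0" "\<delta> (row 1 j) v \<noteq> 0"
        using c_nonzero[OF tot] \<delta>0[OF _ tot, of "row 1 j"] row_bounds[OF j(2), of 1] by auto
      then show "K1_kernel m \<Omega> A B ms u v * K2_kernel m \<Omega> A B ms v w * \<tau> v = inverse (a u) * (?H u v * ?H v w * \<tau> v) * a w"
        unfolding K1_conjugate[OF i j] K2_conjugate[OF j k] a[OF i] a[OF k] by (intro cancel) simp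
    qed
    then show "kernel_prod M2 \<tau> (K1_kernel m \<Omega> A B ms) (K2_kernel m \<Omega> A B ms) u w =
        inverse (a u) * kernel_prod M2 \<tau> ?H ?H u w * a w"
      by (simp add: kernel_prod_def)
  qed
qed

end

section \<open>Contour measures and counting measures\<close>

text \<open>
  Continuous images of Borel sets need not be Borel sets, but continuous images of sigma-compact sets are
  sigma-compact, hence Borel.  All parameter sets below are therefore kept sigma-compact.
\<close>

definition sigma_compact :: "'a::topological_space set \<Rightarrow> bool" where
  "sigma_compact S \<longleftrightarrow> (\<exists>K :: nat \<Rightarrow> 'a set. (\<forall>n. compact (K n)) \<and> S = (\<Union>n. K n))"

lemma sigma_compactI: "(\<And>n::nat. compact (K n)) \<Longrightarrow> S = (\<Union>n. K n) \<Longrightarrow> sigma_compact S"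
  unfolding sigma_compact_def by blast

lemma sigma_compact_UN:
  assumes "\<And>n::nat. sigma_compact (S n)"
  shows "sigma_compact (\<Union>n. S n)"
proof -
  obtain K :: "nat \<Rightarrow> nat \<Rightarrow> _" where K: "\<And>n k. compact (K n k)" "\<And>n. S n = (\<Union>k. K n k)"
    using assms unfolding sigma_compact_def by metis
  show ?thesis
  proof (rule sigma_compactI)
    show "compact (K (fst (prod_decode i)) (snd (prod_decode i)))" for i by (rule K(1))
    show "(\<Union>n. S n) = (\<Union>i. K (fst (prod_decode i)) (snd (prod_decode i)))"
    proof (intro equalityI subsetI)
      fix x assume "x \<in> (\<Union>n. S n)"
      then obtain n k where "x \<in> K n k" using K(2) by blast
      then show "x \<in> (\<Union>i. K (fst (prod_decode i)) (snd (prod_decode i)))"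
        by (intro UN_I[of "prod_encode (n, k)"]) simp_all
    qed (use K(2) in blast)
  qed
qed

lemma sigma_compact_Int_closed:
  assumes "sigma_compact S" "closed C"
  shows "sigma_compact (S \<inter> C)"
proof -
  obtain K :: "nat \<Rightarrow> _" where K: "\<And>n. compact (K n)" "S = (\<Union>n. K n)"
    using assms(1) unfolding sigma_compact_def by blast
  show ?thesis
    by (rule sigma_compactI[of "\<lambda>n. K n \<inter> C"]) (use K compact_Int_closed[OF _ assms(2)] in auto)
qed

lemma sigma_compact_Int_open:
  fixes S :: "'a::euclidean_space set"
  assumes "sigma_compact S" "open U"
  shows "sigma_compact (S \<inter> U)"
proof -
  obtain C :: "nat \<Rightarrow> 'a set" where C: "\<And>n. compact (C n)" "(\<Union>n. C n) = U"
    by (rule open_Union_compact_subsets[OF assms(2)]) blast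
  have "sigma_compact (\<Union>n. S \<inter> C n)"
    by (intro sigma_compact_UN sigma_compact_Int_closed assms(1) compact_imp_closed C(1))
  then show ?thesis unfolding C(2)[symmetric] Int_UN_distrib .
qed

lemma sigma_compact_UNIV: "sigma_compact (UNIV :: 'a::euclidean_space set)"
proof -
  obtain C :: "nat \<Rightarrow> 'a set" where C: "\<And>n. compact (C n)" "(\<Union>n. C n) = UNIV"
    by (rule open_Union_compact_subsets[OF open_UNIV]) blast
  show ?thesis by (rule sigma_compactI[OF C(1) C(2)[symmetric]])
qed

lemma sigma_compact_image:
  assumes "sigma_compact S" "continuous_on S f"
  shows "sigma_compact (f ` S)"
proof -
  obtain K :: "nat \<Rightarrow> _" where K: "\<And>n. compact (K n)" "S = (\<Union>n. K n)"
    using assms(1) unfolding sigma_compact_def by blast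
  show ?thesis
  proof (rule sigma_compactI)
    show "compact (f ` K n)" for n
      by (rule compact_continuous_image[OF continuous_on_subset[OF assms(2)] K(1)]) (use K(2) in blast)
    show "f ` S = (\<Union>n. f ` K n)" unfolding K(2) by (rule image_UN)
  qed
qed

lemma sigma_compact_borel:
  fixes S :: "'a::t2_space set"
  assumes "sigma_compact S"
  shows "S \<in> sets borel"
proof -
  obtain K :: "nat \<Rightarrow> 'a set" where K: "\<And>n. compact (K n)" "S = (\<Union>n. K n)"
    using assms(1) unfolding sigma_compact_def by blast
  have "K n \<in> sets borel" for n by (intro borel_closed compact_imp_closed K(1))
  then show ?thesis unfolding K(2) by blast
qed

lemma sigma_compact_interval:
  fixes I :: "real set"
  assumes "is_interval I"
  shows "sigma_compact I"
proof -
  have oc: "sigma_compact (U \<inter> C)" if "open U" "closed C" for U C :: "real set"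
    using sigma_compact_Int_closed[OF sigma_compact_Int_open[OF sigma_compact_UNIV that(1)] that(2)] by simp
  obtain a b where "I = {} \<or> I = UNIV \<or> I = {..<b} \<or> I = {..b} \<or> I = {a<..} \<or> I = {a..} \<or>
      I = {a<..<b} \<or> I = {a<..b} \<or> I = {a..<b} \<or> I = {a..b}"
    using is_real_interval[OF assms] by blast
  then show ?thesis
  proof (elim disjE)
    assume "I = {}" then show ?thesis using oc[of "{}" UNIV] by simp
  next
    assume "I = UNIV" then show ?thesis using oc[of UNIV UNIV] by simp
  next
    assume "I = {..<b}" then show ?thesis using oc[of "{..<b}" UNIV] by simp
  next
    assume "I = {..b}" then show ?thesis using oc[of UNIV "{..b}"] by simp
  next
    assume "I = {a<..}" then show ?thesis using oc[of "{a<..}" UNIV] by simp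
  next
    assume "I = {a..}" then show ?thesis using oc[of UNIV "{a..}"] by simp
  next
    assume "I = {a<..<b}" then show ?thesis using oc[of "{a<..<b}" UNIV] by simp
  next
    assume "I = {a<..b}" then show ?thesis using oc[of "{a<..}" "{..b}"] by (simp add: greaterThanAtMost_def)
  next
    assume "I = {a..<b}" then show ?thesis using oc[of "{..<b}" "{a..}"] by (simp add: atLeastLessThan_def Int_commute)
  next
    assume "I = {a..b}" then show ?thesis using oc[of UNIV "{a..b}"] by simp
  qed
qed

abbreviation vd :: "contour \<Rightarrow> real \<Rightarrow> complex" where
  "vd x t \<equiv> vector_derivative (fst x) (at t)"

definition crossings :: "contour set \<Rightarrow> contour \<Rightarrow> real set" where
  "crossings C x = {t \<in> snd x. \<exists>y\<in>C. \<exists>s\<in>snd y. (y, s) \<noteq> (x, t) \<and> fst y s = fst x t}"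

text \<open>
  The speed of a contour is continuous off finitely many parameters, and what remains of the
  parameter interval is still sigma-compact.
\<close>

lemma contour_pieces:
  assumes "is_contour x"
  obtains S where "finite S" "continuous_on (snd x) (fst x)" "continuous_on (snd x - S) (vd x)"
    "sigma_compact (snd x)" "sigma_compact (snd x - S)"
proof -
  obtain \<gamma> I where x: "x = (\<gamma>, I)" by (cases x)
  from assms have I: "is_interval I" and pc: "\<gamma> piecewise_C1_differentiable_on I" by (auto simp: is_contour_def x)
  from pc obtain S where S: "finite S" "continuous_on I \<gamma>" "\<gamma> C1_differentiable_on (I - S)"
    unfolding piecewise_C1_differentiable_on_def by blast
  from S(3) obtain D where D: "\<forall>t\<in>I - S. (\<gamma> has_vector_derivative D t) (at t)" "continuous_on (I - S) D"
    unfolding C1_differentiable_on_def by blast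
  have "continuous_on (I - S) (\<lambda>t. vector_derivative \<gamma> (at t))"
    using D(2) by (rule continuous_on_eq) (use D(1) vector_derivative_at in metis)
  moreover have "sigma_compact (I \<inter> - S)"
    by (rule sigma_compact_Int_open[OF sigma_compact_interval[OF I]]) (use S(1) finite_imp_closed in blast)
  ultimately show ?thesis
    using S(1,2) sigma_compact_interval[OF I] by (intro that[of S]) (simp_all add: x Diff_eq)
qed

lemma contour_measurable:
  assumes x: "is_contour x"
  shows "snd x \<in> sets borel" "B \<in> sets borel \<Longrightarrow> {t \<in> snd x. fst x t \<in> B} \<in> sets borel"
    and "(\<lambda>t. indicator (snd x) t * ennreal (norm (vd x t))) \<in> borel_measurable borel"
proof -
  obtain S where S: "finite S" "continuous_on (snd x) (fst x)" "continuous_on (snd x - S) (vd x)"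
    "sigma_compact (snd x)" "sigma_compact (snd x - S)" by (rule contour_pieces[OF x])
  show I: "snd x \<in> sets borel" by (rule sigma_compact_borel[OF S(4)])
  have m: "(\<lambda>t. indicator (snd x) t *\<^sub>R fst x t) \<in> borel_measurable borel"
    by (rule borel_measurable_continuous_on_indicator[OF I S(2)])
  show "{t \<in> snd x. fst x t \<in> B} \<in> sets borel" if "B \<in> sets borel"
  proof -
    have "{t \<in> snd x. fst x t \<in> B} = snd x \<inter> ((\<lambda>t. indicator (snd x) t *\<^sub>R fst x t) -` B \<inter> space borel)"
      by auto
    also have "\<dots> \<in> sets borel" by (intro sets.Int I measurable_sets[OF m that])
    finally show ?thesis .
  qed
  have IS: "snd x - S \<in> sets borel" by (rule sigma_compact_borel[OF S(5)])
  have "(\<lambda>t. indicator (snd x - S) t *\<^sub>R vd x t) \<in> borel_measurable borel"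
    by (rule borel_measurable_continuous_on_indicator[OF IS S(3)])
  then have "(\<lambda>t. ennreal (norm (indicator (snd x - S) t *\<^sub>R vd x t))) \<in> borel_measurable borel" by measurable
  then show "(\<lambda>t. indicator (snd x) t * ennreal (norm (vd x t))) \<in> borel_measurable borel"
    by (rule measurable_discrete_difference[where X=S]) (use S(1) in \<open>auto simp: indicator_def countable_finite\<close>)
qed

definition arclength :: "contour set \<Rightarrow> complex set \<Rightarrow> ennreal" where
  "arclength C S = (\<Sum>x\<in>C. \<integral>\<^sup>+t. indicator S (fst x t) * ennreal (norm (vd x t)) * indicator (snd x) t \<partial>lborel)"

lemma arclength_integrand_measurable:
  assumes x: "is_contour x" "x \<in> C" and S: "S \<in> sets (restrict_space borel (contour_trace C))"
  shows "(\<lambda>t. indicator S (fst x t) * ennreal (norm (vd x t)) * indicator (snd x) t) \<in> borel_measurable borel"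
proof -
  obtain B where B: "B \<in> sets borel" "S = contour_trace C \<inter> B" using S by (auto simp: sets_restrict_space)
  have "fst x t \<in> contour_trace C" if "t \<in> snd x" for t
    using that x(2) unfolding contour_trace_def by (intro UN_I[OF x(2)]) (auto simp: case_prod_unfold)
  then have "(\<lambda>t. indicator S (fst x t) * ennreal (norm (vd x t)) * indicator (snd x) t) =
      (\<lambda>t. indicator {t \<in> snd x. fst x t \<in> B} t * (indicator (snd x) t * ennreal (norm (vd x t))))"
    by (intro ext) (auto simp: B(2) indicator_def)
  also have "\<dots> \<in> borel_measurable borel"
    by (intro borel_measurable_times_ennreal contour_measurable(3)[OF x(1)] borel_measurable_indicator
        contour_measurable(2)[OF x(1) B(1)])
  finally show ?thesis .
qed

lemma arclength_measure_space:
  shows "space (arclength_measure C) = contour_trace C"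
    and "sets (arclength_measure C) = sets (restrict_space borel (contour_trace C))"
proof -
  let ?A = "sets (restrict_space borel (contour_trace C))"
  have A: "?A \<subseteq> Pow (contour_trace C)" by (auto simp: sets_restrict_space)
  show "space (arclength_measure C) = contour_trace C"
    unfolding arclength_measure_def by (rule space_measure_of[OF A])
  have "sets (arclength_measure C) = sigma_sets (contour_trace C) ?A"
    unfolding arclength_measure_def by (rule sets_measure_of[OF A])
  also have "\<dots> = ?A"
    using sets.sigma_sets_eq[of "restrict_space borel (contour_trace C)"] by (simp add: space_restrict_space)
  finally show "sets (arclength_measure C) = ?A" .
qed

text \<open>
  The measure in the definition is indeed countably additive; otherwise \<open>measure_of\<close> would be the zero measure.
\<close>

lemma emeasure_arclength_measure:
  assumes C: "finite C" "\<And>x. x \<in> C \<Longrightarrow> is_contour x"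
    and S: "S \<in> sets (restrict_space borel (contour_trace C))"
  shows "emeasure (arclength_measure C) S = arclength C S"
proof -
  let ?A = "sets (restrict_space borel (contour_trace C))"
  have eq: "arclength_measure C = measure_of (contour_trace C) ?A (arclength C)"
    unfolding arclength_measure_def arclength_def by (simp add: case_prod_unfold)
  show ?thesis
  proof (rule emeasure_measure_of[OF eq])
    show "?A \<subseteq> Pow (contour_trace C)" by (auto simp: sets_restrict_space)
    show "S \<in> sets (arclength_measure C)" using S by (simp only: arclength_measure_space)
    show "positive (sets (arclength_measure C)) (arclength C)" by (simp add: positive_def arclength_def)
    show "countably_additive (sets (arclength_measure C)) (arclength C)"
    proof (rule countably_additiveI)
      fix A :: "nat \<Rightarrow> complex set"
      assume A: "range A \<subseteq> sets (arclength_measure C)" "disjoint_family A"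
      have Ai: "A i \<in> ?A" for i using A(1) by (auto simp: arclength_measure_space)
      let ?f = "\<lambda>S x t. indicator S (fst x t) * ennreal (norm (vd x t)) * indicator (snd x) t"
      have "(\<Sum>i. arclength C (A i)) = (\<Sum>x\<in>C. \<Sum>i. \<integral>\<^sup>+t. ?f (A i) x t \<partial>lborel)"
        unfolding arclength_def by (rule suminf_sum) simp
      also have "\<dots> = (\<Sum>x\<in>C. \<integral>\<^sup>+t. ?f (\<Union>i. A i) x t \<partial>lborel)"
      proof (intro sum.cong refl)
        fix x assume x: "x \<in> C"
        have "(\<Sum>i. \<integral>\<^sup>+t. ?f (A i) x t \<partial>lborel) = (\<integral>\<^sup>+t. (\<Sum>i. ?f (A i) x t) \<partial>lborel)"
          by (rule nn_integral_suminf[symmetric])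
            (use arclength_integrand_measurable[OF C(2)[OF x] x Ai] in simp)
        also have "\<dots> = (\<integral>\<^sup>+t. ?f (\<Union>i. A i) x t \<partial>lborel)"
          using A(2) by (intro nn_integral_cong) (simp add: ennreal_suminf_multc suminf_indicator)
        finally show "(\<Sum>i. \<integral>\<^sup>+t. ?f (A i) x t \<partial>lborel) = (\<integral>\<^sup>+t. ?f (\<Union>i. A i) x t \<partial>lborel)" .
      qed
      finally show "(\<Sum>i. arclength C (A i)) = arclength C (\<Union>i. A i)" by (simp only: arclength_def)
    qed
  qed
qed

context
  fixes C :: "contour set"
  assumes C: "contour_union C"
begin

lemma contour_union_D: "finite C" "x \<in> C \<Longrightarrow> is_contour x" "x \<in> C \<Longrightarrow> countable (crossings C x)"
  using C by (auto simp: contour_union_def crossings_def)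

lemma not_crossing_unique:
  assumes "t \<in> snd x" "t \<notin> crossings C x" "y \<in> C" "s \<in> snd y" "fst y s = fst x t"
  shows "y = x" "s = t"
proof -
  have "(y, s) = (x, t)"
  proof (rule ccontr)
    assume "(y, s) \<noteq> (x, t)"
    then have "t \<in> crossings C x" unfolding crossings_def using assms by blast
    then show False using assms(2) by contradiction
  qed
  then show "y = x" "s = t" by simp_all
qed

lemma trace_image: "x \<in> C \<Longrightarrow> fst x ` snd x \<subseteq> contour_trace C"
  unfolding contour_trace_def by (auto simp: case_prod_unfold)

lemma trace_cases: "z \<in> contour_trace C \<Longrightarrow> \<exists>x\<in>C. \<exists>t\<in>snd x. z = fst x t"
  unfolding contour_trace_def by (auto simp: case_prod_unfold)

lemma sigma_compact_trace: "sigma_compact (contour_trace C)"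
proof -
  have 0: "sigma_compact ({} :: complex set)" by (rule sigma_compactI[of "\<lambda>_. {}"]) auto
  have "sigma_compact (\<Union>x\<in>D. fst x ` snd x)" if "finite D" "D \<subseteq> C" for D
    using that
  proof (induction D rule: finite_induct)
    case (insert x D)
    have "is_contour x" using insert.prems by (intro contour_union_D(2)) simp
    then obtain S where "continuous_on (snd x) (fst x)" "sigma_compact (snd x)" by (rule contour_pieces)
    then have 1: "sigma_compact (fst x ` snd x)" by (intro sigma_compact_image)
    have "sigma_compact (\<Union>n::nat. if n = 0 then fst x ` snd x else (\<Union>x\<in>D. fst x ` snd x))"
      using insert 1 by (intro sigma_compact_UN) auto
    also have "(\<Union>n::nat. if n = 0 then fst x ` snd x else (\<Union>x\<in>D. fst x ` snd x)) = (\<Union>x\<in>insert x D. fst x ` snd x)"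
      by (auto split: if_splits intro: exI[of _ "Suc 0"])
    finally show ?case .
  qed (simp add: 0)
  from this[OF contour_union_D(1) subset_refl] show ?thesis
    unfolding contour_trace_def by (simp add: case_prod_unfold)
qed

text \<open>
  Since crossings are countable, for almost all parameters \<open>t\<close> of any contour \<open>y\<close> of the union the point
  \<open>fst y t\<close> lies on the piece only if \<open>y = x\<close> and \<open>t \<in> K\<close>.  So the piece gets no length from
  other contours and at most \<open>b\<close> times the length of an interval from its own parametrization.
\<close>

lemma emeasure_piece_finite:
  assumes x: "x \<in> C" and K: "compact K" "K \<subseteq> snd x" and b: "\<And>t. t \<in> K \<Longrightarrow> norm (vd x t) \<le> b"
    and meas: "fst x ` K \<in> sets (arclength_measure C)"
  shows "emeasure (arclength_measure C) (fst x ` K) < \<infinity>"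
proof -
  let ?f = "\<lambda>y t. indicator (fst x ` K) (fst y t) * ennreal (norm (vd y t)) * indicator (snd y) t"
  obtain r where r: "\<forall>t\<in>K. norm t \<le> r" using compact_imp_bounded[OF K(1)] by (auto simp: bounded_iff)
  have fin: "(\<integral>\<^sup>+t. ?f y t \<partial>lborel) < \<infinity>" if y: "y \<in> C" for y
  proof -
    have "AE t in lborel. t \<notin> crossings C y"
      by (rule AE_not_in[OF countable_imp_null_set_lborel[OF contour_union_D(3)[OF y]]])
    then have "AE t in lborel. ?f y t \<le> ennreal b * indicator {-r..r} t"
    proof eventually_elim
      case (elim t)
      show ?case
      proof (cases "t \<in> snd y \<and> fst y t \<in> fst x ` K")
        case True
        then obtain s where s: "s \<in> K" "fst x s = fst y t" by auto
        have "x = y" "s = t"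
          using not_crossing_unique[of t y x s] True elim x s K(2) by auto
        then have "norm (vd y t) \<le> b" "norm t \<le> r" using b[of t] r s by auto
        then show ?thesis using True by (simp add: indicator_def ennreal_leI abs_le_iff)
      qed (auto simp: indicator_def)
    qed
    then have "(\<integral>\<^sup>+t. ?f y t \<partial>lborel) \<le> (\<integral>\<^sup>+t. ennreal b * indicator {-r..r} t \<partial>lborel)"
      by (rule nn_integral_mono_AE)
    also have "\<dots> = ennreal b * emeasure lborel {-r..r}" by (rule nn_integral_cmult_indicator) simp
    also have "\<dots> < \<infinity>" by (simp add: ennreal_mult_less_top emeasure_lborel_Icc_eq)
    finally show ?thesis .
  qed
  have "emeasure (arclength_measure C) (fst x ` K) = arclength C (fst x ` K)"
    using meas by (intro emeasure_arclength_measure contour_union_D) (simp_all only: arclength_measure_space)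
  also have "\<dots> < \<infinity>" unfolding arclength_def using fin contour_union_D(1) by simp
  finally show ?thesis .
qed

text \<open>
  Each contour is covered by countably many compact pieces with bounded speed, the finitely many
  exceptional parameters being pieces of their own.
\<close>

lemma sigma_finite_arclength_measure: "sigma_finite_measure (arclength_measure C)"
proof -
  have "\<exists>\<K>. countable \<K> \<and> (\<Union>\<K>) = snd x \<and> (\<forall>K\<in>\<K>. compact K \<and> (\<exists>b. \<forall>t\<in>K. norm (vd x t) \<le> b))" if x: "x \<in> C" for x
  proof -
    obtain S where S: "finite S" "continuous_on (snd x - S) (vd x)" "sigma_compact (snd x - S)"
      using contour_pieces[OF contour_union_D(2)[OF x]] by metis
    obtain K :: "nat \<Rightarrow> real set" where K: "\<And>n. compact (K n)" "snd x - S = (\<Union>n. K n)"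
      using S(3) unfolding sigma_compact_def by blast
    let ?\<K> = "range K \<union> (\<lambda>t. {t}) ` (snd x \<inter> S)"
    have "finite ((\<lambda>t. {t}) ` (snd x \<inter> S))" using S(1) by (intro finite_imageI finite_Int disjI2)
    then have "countable ((\<lambda>t. {t}) ` (snd x \<inter> S))" by (rule countable_finite)
    moreover have "countable (range K)" by (rule countable_image) simp
    ultimately have "countable ?\<K>" by (intro countable_Un)
    moreover have "\<Union>?\<K> = snd x"
    proof -
      have "\<Union>?\<K> = (\<Union>n. K n) \<union> (snd x \<inter> S)" by simp
      also have "\<dots> = snd x" unfolding K(2)[symmetric] by (simp only: Un_Diff_Int)
      finally show ?thesis .
    qed
    moreover have "compact A \<and> (\<exists>b. \<forall>t\<in>A. norm (vd x t) \<le> b)" if A: "A \<in> ?\<K>" for A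
    proof (cases "A \<in> range K")
      case True
      then obtain n where n: "A = K n" by blast
      have "K n \<subseteq> snd x - S" unfolding K(2) by (rule UN_upper[OF UNIV_I])
      then have "continuous_on (K n) (vd x)" by (rule continuous_on_subset[OF S(2)])
      then have "compact (vd x ` K n)" by (rule compact_continuous_image[OF _ K(1)])
      then obtain b where "\<forall>w\<in>vd x ` K n. norm w \<le> b" using compact_imp_bounded bounded_iff by metis
      then show ?thesis using n K(1) by blast
    next
      case False
      then obtain t where "A = {t}" using A by blast
      then show ?thesis by auto
    qed
    ultimately show ?thesis by (intro exI[of _ ?\<K>]) blast
  qed
  then obtain \<K> where \<K>: "\<And>x. x \<in> C \<Longrightarrow> countable (\<K> x)" "\<And>x. x \<in> C \<Longrightarrow> \<Union>(\<K> x) = snd x"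
    "\<And>x K. x \<in> C \<Longrightarrow> K \<in> \<K> x \<Longrightarrow> compact K \<and> (\<exists>b. \<forall>t\<in>K. norm (vd x t) \<le> b)" by metis
  have meas: "fst x ` K \<in> sets (arclength_measure C)" if x: "x \<in> C" "K \<in> \<K> x" for x K
  proof -
    have "K \<subseteq> snd x" using \<K>(2)[OF x(1)] x(2) by blast
    moreover have "continuous_on (snd x) (fst x)" by (rule contour_pieces[OF contour_union_D(2)[OF x(1)]])
    ultimately have "compact (fst x ` K)"
      using compact_continuous_image[OF continuous_on_subset] \<K>(3)[OF x] by blast
    then have "fst x ` K \<in> sets borel" by (intro borel_closed compact_imp_closed)
    moreover have "fst x ` K \<subseteq> contour_trace C" using trace_image[OF x(1)] \<open>K \<subseteq> snd x\<close> by blast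
    ultimately show ?thesis unfolding arclength_measure_space sets_restrict_space by blast
  qed
  let ?A = "\<Union>x\<in>C. (\<lambda>K. fst x ` K) ` \<K> x"
  show ?thesis
  proof
    show "\<exists>A. countable A \<and> A \<subseteq> sets (arclength_measure C) \<and> \<Union>A = space (arclength_measure C) \<and>
        (\<forall>a\<in>A. emeasure (arclength_measure C) a \<noteq> \<infinity>)"
    proof (intro exI[of _ ?A] conjI)
      show "countable ?A" by (intro countable_UN countable_image countable_finite contour_union_D(1) \<K>(1))
      show "?A \<subseteq> sets (arclength_measure C)" using meas by blast
      have "z \<in> \<Union>?A" if z: "z \<in> contour_trace C" for z
      proof -
        obtain x t where "x \<in> C" "t \<in> snd x" "z = fst x t" using trace_cases[OF z] by blast
        moreover then obtain K where "K \<in> \<K> x" "t \<in> K" using \<K>(2)[of x] by blast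
        ultimately show ?thesis by blast
      qed
      moreover have "\<Union>?A \<subseteq> contour_trace C"
        using meas sets.sets_into_space arclength_measure_space(1) by blast
      ultimately show "\<Union>?A = space (arclength_measure C)" unfolding arclength_measure_space by blast
      show "\<forall>a\<in>?A. emeasure (arclength_measure C) a \<noteq> \<infinity>"
      proof
        fix a assume "a \<in> ?A"
        then obtain x K where xK: "x \<in> C" "K \<in> \<K> x" "a = fst x ` K" by blast
        obtain b where b: "\<forall>t\<in>K. norm (vd x t) \<le> b" using \<K>(3)[OF xK(1,2)] by blast
        have "K \<subseteq> snd x" using \<K>(2)[OF xK(1)] xK(2) by blast
        then have "emeasure (arclength_measure C) a < \<infinity>"
          unfolding xK(3) using b \<K>(3)[OF xK(1,2)] by (intro emeasure_piece_finite[OF xK(1)] meas[OF xK(1,2)]) auto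
        then show "emeasure (arclength_measure C) a \<noteq> \<infinity>" by simp
      qed
    qed
  qed
qed

text \<open>
  Off the countable set \<open>Z\<close> of crossing points and corners, the parameter is determined by the point.  There
  the preimage of an open set is a union of continuous images of sigma-compact parameter sets; a countable set is
  Borel whatever the choice of the tangent at its points.
\<close>

lemma unit_tangent_measurable: "unit_tangent C \<in> borel_measurable (arclength_measure C)"
proof -
  define pt where "pt z = (SOME (x, t). x \<in> C \<and> t \<in> snd x \<and> fst x t = z)" for z
  define \<delta> where "\<delta> z = vd (fst (pt z)) (snd (pt z))" for z
  have ut: "unit_tangent C z = sgn (\<delta> z)" for z
    unfolding unit_tangent_def \<delta>_def pt_def by (simp add: Let_def case_prod_unfold)
  have "\<forall>x\<in>C. \<exists>S. finite S \<and> continuous_on (snd x) (fst x) \<and> continuous_on (snd x - S) (vd x) \<and>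
      sigma_compact (snd x - S)"
  proof
    fix x assume "x \<in> C"
    then obtain S where "finite S" "continuous_on (snd x) (fst x)" "continuous_on (snd x - S) (vd x)"
      "sigma_compact (snd x - S)"
      by (rule contour_pieces[OF contour_union_D(2)])
    then show "\<exists>S. finite S \<and> continuous_on (snd x) (fst x) \<and> continuous_on (snd x - S) (vd x) \<and>
        sigma_compact (snd x - S)"
      by (intro exI[of _ S] conjI)
  qed
  from bchoice[OF this] obtain S where S': "\<forall>x\<in>C. finite (S x) \<and> continuous_on (snd x) (fst x) \<and>
      continuous_on (snd x - S x) (vd x) \<and> sigma_compact (snd x - S x)" ..
  have S: "finite (S x)" "continuous_on (snd x) (fst x)" "continuous_on (snd x - S x) (vd x)"
    "sigma_compact (snd x - S x)" if "x \<in> C" for x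
    using bspec[OF S' that] by simp_all
  define Z where "Z = (\<Union>x\<in>C. fst x ` (crossings C x \<union> S x))"
  have Z: "countable Z"
    unfolding Z_def by (intro countable_UN countable_image countable_Un countable_finite contour_union_D S(1))
  have \<delta>: "\<delta> (fst x t) = vd x t" if xt: "x \<in> C" "t \<in> snd x" "fst x t \<notin> Z" for x t
  proof -
    have nc: "t \<notin> crossings C x" using xt unfolding Z_def by blast
    have "pt (fst x t) = (x, t)"
      unfolding pt_def
    proof (rule some_equality)
      show "case (x, t) of (x', t') \<Rightarrow> x' \<in> C \<and> t' \<in> snd x' \<and> fst x' t' = fst x t" using xt by simp
      fix p assume p: "case p of (x', t') \<Rightarrow> x' \<in> C \<and> t' \<in> snd x' \<and> fst x' t' = fst x t"
      obtain y s where ys: "p = (y, s)" by (cases p)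
      show "p = (x, t)" using not_crossing_unique[OF xt(2) nc, of y s] p unfolding ys by simp
    qed
    then show ?thesis by (simp add: \<delta>_def)
  qed
  have "\<delta> \<in> borel_measurable (restrict_space borel (contour_trace C))"
  proof (rule borel_measurableI)
    fix U :: "complex set" assume U: "open U"
    define W where "W = (\<Union>x\<in>C. fst x ` {t \<in> snd x - S x. vd x t \<in> U})"
    have "fst x ` {t \<in> snd x - S x. vd x t \<in> U} \<in> sets borel" if x: "x \<in> C" for x
    proof -
      obtain T where T: "open T" "T \<inter> (snd x - S x) = vd x -` U \<inter> (snd x - S x)"
        using S(3)[OF x] U unfolding continuous_on_open_invariant by blast
      have "{t \<in> snd x - S x. vd x t \<in> U} = (snd x - S x) \<inter> T" using T(2) by blast
      then have "sigma_compact {t \<in> snd x - S x. vd x t \<in> U}"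
        using sigma_compact_Int_open[OF S(4)[OF x] T(1)] by simp
      then have "sigma_compact (fst x ` {t \<in> snd x - S x. vd x t \<in> U})"
        by (rule sigma_compact_image) (rule continuous_on_subset[OF S(2)[OF x]], blast)
      then show ?thesis by (rule sigma_compact_borel)
    qed
    then have W: "W \<in> sets borel" unfolding W_def by (intro sets.finite_UN contour_union_D(1))
    define Z' where "Z' = {z \<in> Z \<inter> contour_trace C. \<delta> z \<in> U}"
    have "countable Z'" by (rule countable_subset[OF _ Z]) (auto simp: Z'_def)
    then have Z': "Z' \<in> sets borel" by (rule sets.countable[rotated]) simp
    have ZB: "Z \<in> sets borel" by (rule sets.countable[OF _ Z]) simp
    have "\<delta> -` U \<inter> contour_trace C = contour_trace C \<inter> ((W - Z) \<union> Z')"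
    proof (intro equalityI subsetI)
      fix z assume z: "z \<in> \<delta> -` U \<inter> contour_trace C"
      show "z \<in> contour_trace C \<inter> ((W - Z) \<union> Z')"
      proof (cases "z \<in> Z")
        case False
        obtain x t where xt: "x \<in> C" "t \<in> snd x" "z = fst x t" using trace_cases z by blast
        have "t \<notin> S x" using False xt unfolding Z_def by blast
        moreover have "vd x t \<in> U" using \<delta>[of x t] z xt False by simp
        ultimately have "z \<in> W" unfolding W_def using xt by blast
        then show ?thesis using z False by blast
      qed (use z Z'_def in blast)
    next
      fix z assume z: "z \<in> contour_trace C \<inter> ((W - Z) \<union> Z')"
      show "z \<in> \<delta> -` U \<inter> contour_trace C"
      proof (cases "z \<in> Z'")
        case False
        then have "z \<in> W" "z \<notin> Z" using z by blast+
        then obtain x t where "x \<in> C" "t \<in> snd x" "vd x t \<in> U" "z = fst x t" unfolding W_def by blast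
        then show ?thesis using \<delta>[of x t] z \<open>z \<notin> Z\<close> by simp
      qed (auto simp: Z'_def)
    qed
    moreover have "(W - Z) \<union> Z' \<in> sets borel" by (intro sets.Un sets.Diff W ZB Z')
    ultimately show "\<delta> -` U \<inter> space (restrict_space borel (contour_trace C)) \<in> sets (restrict_space borel (contour_trace C))"
      unfolding space_restrict_space sets_restrict_space by auto
  qed
  then have "\<delta> \<in> borel_measurable (arclength_measure C)"
    by (subst measurable_cong_sets[OF arclength_measure_space(2) refl])
  then have "(\<lambda>z. sgn (\<delta> z)) \<in> borel_measurable (arclength_measure C)" by measurable
  then show ?thesis unfolding ut[symmetric] .
qed

end

text \<open>
  Every point of a discrete set is singled out by an element of a countable base.
\<close>

lemma discrete_countable:
  fixes S :: "'a::second_countable_topology set"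
  assumes "discrete S"
  shows "countable S"
proof -
  obtain B :: "'a set set" where B: "countable B" "topological_basis B" using ex_countable_basis by blast
  have "\<exists>b\<in>B. x \<in> b \<and> b \<inter> S \<subseteq> {x}" if x: "x \<in> S" for x
  proof -
    have "x isolated_in S" using assms x by (rule discreteD)
    then obtain T where T: "open T" "T \<inter> S = {x}" by (rule isolated_inE)
    have "x \<in> T" using T(2) by blast
    from topological_basisE[OF B(2) T(1) this] obtain b where "b \<in> B" "x \<in> b" "b \<subseteq> T" .
    then show ?thesis using T(2) by blast
  qed
  then obtain b where b: "\<And>x. x \<in> S \<Longrightarrow> b x \<in> B \<and> x \<in> b x \<and> b x \<inter> S \<subseteq> {x}" by metis
  have "inj_on b S"
  proof (rule inj_onI)
    fix x y assume "x \<in> S" "y \<in> S" "b x = b y"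
    then have "y \<in> b x \<inter> S" using b[of y] by simp
    then show "x = y" using b[OF \<open>x \<in> S\<close>] by blast
  qed
  moreover have "countable (b ` S)" by (rule countable_subset[OF _ B(1)]) (use b in blast)
  ultimately show ?thesis by (rule countable_image_inj_on[rotated])
qed

text \<open>
  The traces on \<open>X\<close> of the finite intersections of a countable base.
\<close>

lemma countable_generator_restrict_borel:
  fixes X :: "'a::second_countable_topology set"
  assumes "space M = X" "sets M = sets (restrict_space borel X)"
  obtains \<C> where "sets M = sigma_sets (space M) \<C>" "\<C> \<subseteq> Pow (space M)" "Int_stable \<C>" "countable \<C>"
proof -
  obtain B :: "'a set set" where B: "countable B" "topological_basis B" using ex_countable_basis by blast
  define \<D> where "\<D> = Inter ` {F. finite F \<and> F \<subseteq> B}"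
  have oD: "open d" if "d \<in> \<D>" for d
    using that topological_basis_open[OF B(2)] unfolding \<D>_def by (auto intro!: open_Inter)
  have BD: "b \<in> \<D>" if "b \<in> B" for b unfolding \<D>_def by (rule image_eqI[of _ _ "{b}"]) (use that in auto)
  have cD: "countable \<D>" unfolding \<D>_def by (intro countable_image countable_Collect_finite_subset B(1))
  have borel: "sets (borel :: 'a measure) = sigma_sets UNIV \<D>"
  proof (intro equalityI subsetI)
    fix A :: "'a set" assume "A \<in> sets borel"
    then have "A \<in> sigma_sets UNIV {S. open S}" by (simp add: borel_def)
    then show "A \<in> sigma_sets UNIV \<D>"
    proof (induction rule: sigma_sets.induct)
      case (Basic S)
      then obtain B' where B': "B' \<subseteq> B" "S = \<Union>B'" using B(2) unfolding topological_basis_def by blast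
      have "countable B'" using B(1) B'(1) countable_subset by blast
      then show ?case unfolding B'(2) using B'(1) BD
        by (intro sigma_sets_UNION) (auto intro: sigma_sets.Basic)
    qed (auto intro: sigma_sets.intros)
  next
    fix A :: "'a set" assume "A \<in> sigma_sets UNIV \<D>"
    then show "A \<in> sets borel"
    proof (induction rule: sigma_sets.induct)
      case (Compl a) then show ?case by (simp add: Compl_eq_Diff_UNIV[symmetric])
    qed (auto intro: borel_open oD)
  qed
  let ?C = "(\<lambda>d. X \<inter> d) ` \<D>"
  show ?thesis
  proof (rule that)
    show "sets M = sigma_sets (space M) ?C"
    proof (intro equalityI subsetI)
      fix A assume "A \<in> sets M"
      then obtain A' where A': "A' \<in> sigma_sets UNIV \<D>" "A = X \<inter> A'"
        unfolding assms(2) sets_restrict_space borel by blast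
      from A'(1) have "X \<inter> A' \<in> sigma_sets X ?C"
      proof (induction rule: sigma_sets.induct)
        case (Basic a) then show ?case by (intro sigma_sets.Basic) blast
      next
        case Empty show ?case by (simp add: sigma_sets.Empty)
      next
        case (Compl a)
        have "X \<inter> (UNIV - a) = X - (X \<inter> a)" by blast
        then show ?case using sigma_sets.Compl[OF Compl.IH] by simp
      next
        case (Union a)
        have "X \<inter> (\<Union>i. a i) = (\<Union>i. X \<inter> a i)" by blast
        then show ?case using sigma_sets.Union[OF Union.IH] by simp
      qed
      then show "A \<in> sigma_sets (space M) ?C" by (simp only: A'(2) assms(1))
    next
      fix A assume "A \<in> sigma_sets (space M) ?C"
      moreover have "?C \<subseteq> sets M" unfolding assms(2) sets_restrict_space using oD by (auto intro: borel_open)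
      ultimately show "A \<in> sets M" using sets.sigma_sets_subset by blast
    qed
    show "?C \<subseteq> Pow (space M)" by (auto simp: assms(1))
    show "countable ?C" by (rule countable_image[OF cD])
    show "Int_stable ?C"
    proof (rule Int_stableI)
      fix a b assume "a \<in> ?C" "b \<in> ?C"
      then obtain F G where F: "finite F" "F \<subseteq> B" "a = X \<inter> \<Inter>F" and G: "finite G" "G \<subseteq> B" "b = X \<inter> \<Inter>G"
        unfolding \<D>_def by blast
      have "a \<inter> b = X \<inter> \<Inter>(F \<union> G)" using F(3) G(3) by blast
      moreover have "\<Inter>(F \<union> G) \<in> \<D>" unfolding \<D>_def using F G by (intro image_eqI[OF refl]) blast
      ultimately show "a \<inter> b \<in> ?C" by blast
    qed
  qed
qed

text \<open>
  By disjointness, crossings within the total union are crossings within one of the sets \<open>\<Omega> l j\<close>, so the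
  total union is again a \<open>contour_union\<close>.
\<close>

lemma contour_setting_regular:
  assumes disj: "disjoint_family_on (\<lambda>(l, j). \<Omega> l j) ({1, 2} \<times> {1..m})" and c: "contour_setting m \<Omega> M \<tau>"
  shows "sigma_finite_measure M" "space M = Omega_total m \<Omega>" "sets M = sets (restrict_space borel (Omega_total m \<Omega>))"
    "\<tau> \<in> borel_measurable M" "l \<in> {1, 2} \<Longrightarrow> Omega m \<Omega> l \<in> sets M"
proof -
  obtain C where C: "\<forall>l\<in>{1, 2}. \<forall>j\<in>{1..m}. contour_union (C l j) \<and> \<Omega> l j = contour_trace (C l j)"
    "M = arclength_measure (\<Union>l\<in>{1, 2}. \<Union>j\<in>{1..m}. C l j)"
    "\<tau> = unit_tangent (\<Union>l\<in>{1, 2}. \<Union>j\<in>{1..m}. C l j)"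
    using c unfolding contour_setting_def by blast
  define D where "D = (\<Union>l\<in>{1, 2}. \<Union>j\<in>{1..m}. C l j)"
  have cu: "contour_union (C l j)" and tr: "\<Omega> l j = contour_trace (C l j)" if "l \<in> {1, 2}" "j \<in> {1..m}" for l j
    using C(1) that by blast+
  have inD: "\<exists>l\<in>{1, 2}. \<exists>j\<in>{1..m}. x \<in> C l j" if "x \<in> D" for x using that unfolding D_def by blast
  have img: "fst x t \<in> \<Omega> l j" if "x \<in> C l j" "t \<in> snd x" "l \<in> {1, 2}" "j \<in> {1..m}" for x t l j
    using trace_image[OF cu[OF that(3,4)] that(1)] that unfolding tr[OF that(3,4)] by blast
  have D: "contour_union D"
    unfolding contour_union_def
  proof (intro conjI ballI)
    show "finite D" unfolding D_def using contour_union_D(1)[OF cu] by blast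
    fix x assume "x \<in> D"
    then obtain l j where x: "l \<in> {1, 2}" "j \<in> {1..m}" "x \<in> C l j" using inD by blast
    show "is_contour x" by (rule contour_union_D(2)[OF cu[OF x(1,2)] x(3)])
    have "{t \<in> snd x. \<exists>y\<in>D. \<exists>s\<in>snd y. (y, s) \<noteq> (x, t) \<and> fst y s = fst x t} \<subseteq> crossings (C l j) x"
    proof
      fix t assume "t \<in> {t \<in> snd x. \<exists>y\<in>D. \<exists>s\<in>snd y. (y, s) \<noteq> (x, t) \<and> fst y s = fst x t}"
      then obtain y s where t: "t \<in> snd x" "y \<in> D" "s \<in> snd y" "(y, s) \<noteq> (x, t)" "fst y s = fst x t" by blast
      obtain l' j' where y: "l' \<in> {1, 2}" "j' \<in> {1..m}" "y \<in> C l' j'" using inD[OF t(2)] by blast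
      have "fst x t \<in> \<Omega> l j \<inter> \<Omega> l' j'" using img[OF x(3) t(1) x(1,2)] img[OF y(3) t(3) y(1,2)] t(5) by simp
      then have "(l', j') = (l, j)"
        using disjoint_family_onD[OF disj, of "(l, j)" "(l', j')"] x y by fastforce
      then show "t \<in> crossings (C l j) x" unfolding crossings_def using t y by blast
    qed
    then show "countable {t \<in> snd x. \<exists>y\<in>D. \<exists>s\<in>snd y. (y, s) \<noteq> (x, t) \<and> fst y s = fst x t}"
      using contour_union_D(3)[OF cu[OF x(1,2)] x(3)] countable_subset by blast
  qed
  have Om: "Omega m \<Omega> l = (\<Union>j\<in>{1..m}. contour_trace (C l j))" if "l \<in> {1, 2}" for l
    unfolding Omega_def using tr[OF that] by blast
  have trD: "contour_trace D = Omega_total m \<Omega>"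
  proof -
    have "contour_trace D = (\<Union>l\<in>{1, 2}. \<Union>j\<in>{1..m}. contour_trace (C l j))"
      unfolding contour_trace_def D_def by (simp only: UN_UN_flatten)
    also have "\<dots> = Omega m \<Omega> 1 \<union> Omega m \<Omega> 2" using Om[of 1] Om[of 2] by simp
    finally show ?thesis by (simp only: Omega_total_def)
  qed
  have MD: "M = arclength_measure D" "\<tau> = unit_tangent D" by (simp_all only: C(2,3) D_def)
  show "sigma_finite_measure M" unfolding MD by (rule sigma_finite_arclength_measure[OF D])
  show sp: "space M = Omega_total m \<Omega>" and se: "sets M = sets (restrict_space borel (Omega_total m \<Omega>))"
    unfolding MD arclength_measure_space trD by (rule refl)+
  show "\<tau> \<in> borel_measurable M" unfolding MD by (rule unit_tangent_measurable[OF D])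
  show "Omega m \<Omega> l \<in> sets M" if l: "l \<in> {1, 2}"
  proof -
    have "contour_trace (C l j) \<in> sets borel" if "j \<in> {1..m}" for j
      by (rule sigma_compact_borel[OF sigma_compact_trace[OF cu[OF l that]]])
    then have "Omega m \<Omega> l \<in> sets borel" unfolding Om[OF l] by (intro sets.finite_UN) auto
    moreover have "Omega m \<Omega> l \<subseteq> Omega_total m \<Omega>" using l by (auto simp: Omega_total_def)
    ultimately show ?thesis unfolding se sets_restrict_space by blast
  qed
qed

lemma discrete_setting_regular:
  assumes d: "discrete_setting m \<Omega> M \<tau>"
  shows "sigma_finite_measure M" "space M = Omega_total m \<Omega>" "sets M = sets (restrict_space borel (Omega_total m \<Omega>))"
    "\<tau> \<in> borel_measurable M" "l \<in> {1, 2} \<Longrightarrow> Omega m \<Omega> l \<in> sets M"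
proof -
  have M: "M = count_space (Omega_total m \<Omega>)" and \<tau>: "\<tau> = (\<lambda>_. 1)"
    and dl: "\<And>l j. l \<in> {1, 2} \<Longrightarrow> j \<in> {1..m} \<Longrightarrow> discrete (\<Omega> l j)"
    using d by (auto simp: discrete_setting_def)
  have cl: "countable (Omega m \<Omega> l)" if "l \<in> {1, 2}" for l
  proof -
    have "countable (\<Omega> l j)" if "j \<in> {1..m}" for j using discrete_countable[OF dl[OF \<open>l \<in> {1, 2}\<close> that]] .
    then show ?thesis unfolding Omega_def by (rule countable_UN[OF countable_finite[OF finite_atLeastAtMost]])
  qed
  have ct: "countable (Omega_total m \<Omega>)" unfolding Omega_total_def by (intro countable_Un cl) simp_all
  show "sigma_finite_measure M" unfolding M by (rule sigma_finite_measure_count_space_countable[OF ct])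
  show "space M = Omega_total m \<Omega>" by (simp add: M)
  have "A \<in> sets borel" if "A \<subseteq> Omega_total m \<Omega>" for A :: "complex set"
    by (rule sets.countable[OF _ countable_subset[OF that ct]]) simp
  then show "sets M = sets (restrict_space borel (Omega_total m \<Omega>))"
    unfolding M sets_restrict_space by auto
  show "\<tau> \<in> borel_measurable M" by (simp add: M)
  show "Omega m \<Omega> l \<in> sets M" if "l \<in> {1, 2}" using that by (auto simp: M Omega_total_def)
qed

section \<open>The determinant identity\<close>

text \<open>
  In a minor, conjugation multiplies each row and each column by a factor; the factors cancel in
  pairs.
\<close>

lemma fredholm_term_conjugate:
  assumes nz: "\<And>u. u \<in> space M \<Longrightarrow> a u \<noteq> 0"
    and K: "\<And>u w. u \<in> space M \<Longrightarrow> w \<in> space M \<Longrightarrow> K u w = inverse (a u) * L u w * a w"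
  shows "fredholm_term M \<tau> K = fredholm_term M \<tau> L"
proof
  fix n
  have "fredholm_integrand \<tau> K n u = fredholm_integrand \<tau> L n u" if u: "u \<in> space (PiM {..<n} (\<lambda>_. M))" for u
  proof -
    note uM = space_PiM_lessThan[OF u]
    have "fredholm_integrand \<tau> K n u =
        perm_det {..<n} (\<lambda>i j. inverse (a (u i)) * (L (u i) (u j) * \<tau> (u j)) * a (u j))"
      unfolding fredholm_integrand_eq_perm_det by (rule perm_det_cong) (simp add: K uM)
    also have "\<dots> = (\<Prod>i<n. inverse (a (u i)) * a (u i)) * fredholm_integrand \<tau> L n u"
      unfolding fredholm_integrand_eq_perm_det by (simp only: perm_det_scale[OF finite_lessThan] prod.distrib)
    also have "(\<Prod>i<n. inverse (a (u i)) * a (u i)) = 1" by (rule prod.neutral) (simp add: nz uM)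
    finally show ?thesis by simp
  qed
  then show "fredholm_term M \<tau> K n = fredholm_term M \<tau> L n"
    unfolding fredholm_term_def by (intro arg_cong2[where f="(*)"] refl Bochner_Integration.integral_cong)
qed

theorem theorem5p3:
  fixes m :: nat and \<Omega> :: "nat \<Rightarrow> nat \<Rightarrow> complex set"
    and M :: "complex measure" and \<tau> :: "complex \<Rightarrow> complex"
    and A B ms :: "nat \<Rightarrow> complex \<Rightarrow> complex" and c :: "complex \<Rightarrow> complex"
  defines "M1 \<equiv> restrict_space M (Omega m \<Omega> 1)"
    and "M2 \<equiv> restrict_space M (Omega m \<Omega> 2)"
    and "K1 \<equiv> K1_kernel m \<Omega> A B ms"
    and "K2 \<equiv> K2_kernel m \<Omega> A B ms"
    and "H \<equiv> H_kernel m \<Omega> A B ms c"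
  assumes m: "m \<ge> 1"
    and disjoint: "disjoint_family_on (\<lambda>(l, j). \<Omega> l j) ({1, 2} \<times> {1..m})"
    and setting: "contour_setting m \<Omega> M \<tau> \<or> discrete_setting m \<Omega> M \<tau>"
    and ms_nonzero: "\<And>j z. j \<in> {1..m} \<Longrightarrow> z \<in> Omega_total m \<Omega> \<Longrightarrow> ms j z \<noteq> 0"
    and c_nonzero: "\<And>z. z \<in> Omega_total m \<Omega> \<Longrightarrow> c z \<noteq> 0"
    and K1: "L2_kernel M2 M1 \<tau> K1"
    and K2: "L2_kernel M1 M2 \<tau> K2"
  shows "(kernel_prod_exists M1 M2 \<tau> K1 K2 \<and>
          fredholm_series_well_defined M1 \<tau> (kernel_prod M2 \<tau> K1 K2) \<and>
          L2_kernel M M \<tau> H \<and> trace_class M (kernel_op M \<tau> H) \<longrightarrow>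
          fredholm_series M1 \<tau> (kernel_prod M2 \<tau> K1 K2) = det_one_minus M (kernel_op M \<tau> H))
       \<and> (\<forall>z\<in>Omega_total m \<Omega>. \<forall>i\<in>{1..m + 1}.
            vec_index (f_vec m \<Omega> A ms c z) (i - 1) * vec_index (g_vec m \<Omega> B ms c z) (i - 1) = 0)"
proof (intro conjI impI ballI)
  interpret bs: block_sets m \<Omega> A B ms c
    by (unfold_locales) (rule m disjoint ms_nonzero c_nonzero; assumption)+
  show "vec_index (f_vec m \<Omega> A ms c z) (i - 1) * vec_index (g_vec m \<Omega> B ms c z) (i - 1) = 0"
    if "z \<in> Omega_total m \<Omega>" "i \<in> {1..m + 1}" for z i
    by (rule bs.f_g_product_zero[OF that])
  assume hyps: "kernel_prod_exists M1 M2 \<tau> K1 K2 \<and>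
    fredholm_series_well_defined M1 \<tau> (kernel_prod M2 \<tau> K1 K2) \<and>
    L2_kernel M M \<tau> H \<and> trace_class M (kernel_op M \<tau> H)"
  have sf: "sigma_finite_measure M" and sp: "space M = Omega_total m \<Omega>"
    and se: "sets M = sets (restrict_space borel (Omega_total m \<Omega>))" and \<tau>: "\<tau> \<in> borel_measurable M"
    using setting contour_setting_regular(1-4)[OF disjoint] discrete_setting_regular(1-4) by (elim disjE; simp)+
  have S: "Omega m \<Omega> l \<in> sets M" if "l \<in> {1, 2}" for l
    using setting contour_setting_regular(5)[OF disjoint _ that] discrete_setting_regular(5)[OF _ that] by (elim disjE) simp_all
  obtain s \<phi> \<psi> where nuc: "nuclear M (kernel_op M \<tau> H) s \<phi> \<psi>" using hyps trace_class_nuclear by blast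
  obtain \<C> where \<C>: "sets M = sigma_sets (space M) \<C>" "\<C> \<subseteq> Pow (space M)" "Int_stable \<C>" "countable \<C>"
    by (rule countable_generator_restrict_borel[OF sp se])
  have disj: "Omega m \<Omega> 1 \<inter> Omega m \<Omega> 2 = {}"
  proof (rule ccontr)
    assume "Omega m \<Omega> 1 \<inter> Omega m \<Omega> 2 \<noteq> {}"
    then obtain z where "z \<in> Omega m \<Omega> 1" "z \<in> Omega m \<Omega> 2" by blast
    then obtain i j where z: "z \<in> \<Omega> 1 i" "i \<in> {1..m}" "z \<in> \<Omega> 2 j" "j \<in> {1..m}"
      unfolding Omega_def by (elim UN_E)
    have "(2::nat) = 1" by (rule bs.block_unique(1)[OF z(1,3) _ _ z(2,4)]) simp_all
    then show False by simp
  qed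
  \<comment> \<open>\<open>H\<close> vanishes on both diagonal blocks, so the abstract result on off-diagonal operators applies.\<close>
  interpret bk: block_kernel M \<tau> H s \<phi> \<psi> \<C> "Omega m \<Omega> 1" "Omega m \<Omega> 2"
  proof (intro block_kernel.intro nuclear_kernel.intro nuclear_kernel_axioms.intro block_kernel_axioms.intro)
    show "Omega m \<Omega> 1 \<union> Omega m \<Omega> 2 = space M" by (simp only: sp Omega_total_def)
    show "H u v = 0" if "u \<in> Omega m \<Omega> 1" "v \<in> Omega m \<Omega> 1" for u v
      unfolding H_def by (rule bs.H_diagonal_blocks[OF _ that]) simp
    show "H u v = 0" if "u \<in> Omega m \<Omega> 2" "v \<in> Omega m \<Omega> 2" for u v
      unfolding H_def by (rule bs.H_diagonal_blocks[OF _ that]) simp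
    show "L2_kernel M M \<tau> H" using hyps by (elim conjE)
    show "Omega m \<Omega> 1 \<in> sets M" "Omega m \<Omega> 2 \<in> sets M" by (rule S; simp)+
  qed (fact nuc sf \<tau> \<C> disj)+
  have sub: "Omega m \<Omega> l \<subseteq> space M" if "l \<in> {1, 2}" for l by (rule sets.sets_into_space[OF S[OF that]])
  have sp1: "space M1 = Omega m \<Omega> 1" unfolding M1_def space_restrict_space using sub[of 1] by blast
  have sp2: "space M2 = Omega m \<Omega> 2" unfolding M2_def space_restrict_space using sub[of 2] by blast
  obtain a where a: "\<forall>u\<in>Omega m \<Omega> 1. a u \<noteq> 0"
    "\<forall>u\<in>Omega m \<Omega> 1. \<forall>w\<in>Omega m \<Omega> 1.
      kernel_prod M2 \<tau> K1 K2 u w = inverse (a u) * kernel_prod M2 \<tau> H H u w * a w"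
    using bs.kernel_prod_conjugate[OF sp2, of \<tau>, folded K1_def K2_def H_def] by (elim exE conjE)
  have eq: "fredholm_term M1 \<tau> (kernel_prod M2 \<tau> K1 K2) = fredholm_term M1 \<tau> (kernel_prod M2 \<tau> H H)"
  proof (rule fredholm_term_conjugate)
    show "a u \<noteq> 0" if "u \<in> space M1" for u
      using that unfolding sp1 by (rule a(1)[rule_format])
    show "kernel_prod M2 \<tau> K1 K2 u w = inverse (a u) * kernel_prod M2 \<tau> H H u w * a w"
      if "u \<in> space M1" "w \<in> space M1" for u w
      using that unfolding sp1 by (rule a(2)[rule_format])
  qed
  have "summable (fredholm_term M1 \<tau> (kernel_prod M2 \<tau> H H))"
    using hyps unfolding fredholm_series_well_defined_def eq by (elim conjE)
  then have "det_one_minus M (kernel_op M \<tau> H) = fredholm_series M1 \<tau> (kernel_prod M2 \<tau> H H)"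
    unfolding M1_def M2_def by (rule bk.fredholm_series_eq_det_one_minus)
  also have "\<dots> = fredholm_series M1 \<tau> (kernel_prod M2 \<tau> K1 K2)" by (simp only: fredholm_series_def eq)
  finally show "fredholm_series M1 \<tau> (kernel_prod M2 \<tau> K1 K2) = det_one_minus M (kernel_op M \<tau> H)" by (rule sym)
qed

end
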